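(* Let $X$ be a pure Banach space with a non-hilbertian 1-symmetric basis $E=\{e_k\}_{k=1}^\infty$. For $n\in\mathbb{N}$, $n\ge2$, let $Z_n=Z_n(X)=(\sum_{k=1}^\infty\oplus H_k)_E$, where, for all $k\in\mathbb{N}$, $H_k$ is isometric to $\ell_2^n$. Then $Z_n$ is isomorphic to $X$ and the isometry group of $Z_n$ is maximal. Moreover, if $n\ne m$ (with $n,m\ge 2$), then $\operatorname{Isom}(Z_n)$ and $\operatorname{Isom}(Z_m)$ are not conjugate to each other in the isomorphism group of $X$.
   Context: Spaces are real or complex. $\operatorname{Isom}(Z)$ is the group of surjective linear isometries of $Z$. The isometry group of $(Z,\|\cdot\|)$ is maximal if whenever $|||\cdot|||$ is an equivalent norm on $Z$ with $\operatorname{Isom}(Z,\|\cdot\|)\subseteq\operatorname{Isom}(Z,|||\cdot|||)$, then the two groups are equal. A basis of $X$ is non-hilbertian if $X$ is not isomorphic to a Hilbert space. Bases are normalized; a basis is 1-symmetric if it is 1-unconditional and isometrically equivalent to each of its permutations. A Banach space $X$ with a normalized 1-unconditional basis $\{e_\gamma\}_{\gamma\in\Gamma}$ is impure if there exist $\alpha\neq\beta$ in $\Gamma$ such that $(e_\alpha,e_\beta)$ is isometrically equivalent to the usual basis of $\ell_2^2$ and, for all $x,x'\in\operatorname{span}(e_\alpha,e_\beta)$ with $\|x\|=\|x'\|$ and all $y\in\operatorname{span}\{e_\gamma:\gamma\ne\alpha,\beta\}$, $\|x+y\|=\|x'+y\|$; otherwise it is pure. For Hilbert spaces $H_k$, $(\sum_{k}\oplus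 H_k)_E$ is the space of sequences $(z_k)$, $z_k\in H_k$, such that $\sum_k\|z_k\|e_k$ converges in $X$, normed by $\|(z_k)\|=\|\sum_k\|z_k\|e_k\|_X$. Conjugacy: since $Z_n$ and $Z_m$ are isomorphic to $X$, their isometry groups are regarded (via any isomorphisms) as subgroups of the group $\mathrm{GL}(X)$ of all isomorphisms of $X$ onto $X$; subgroups $G_1,G_2$ are conjugate if $G_1=T^{-1}G_2T$ for some $T\in\mathrm{GL}(X)$. *)

theory Defs
  imports "HOL-Analysis.Analysis" "HOL-Library.Function_Algebras"
begin

(* The scalar field is the real or the complex numbers: to_complex embeds it isometrically
   into the complex numbers, with image either the reals or everything. *)
class real_or_complex = real_normed_field +
  fixes to_complex :: "'a \<Rightarrow> complex"
  assumes to_complex_add: "to_complex (x + y) = to_complex x + to_complex y"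
    and to_complex_mult: "to_complex (x * y) = to_complex x * to_complex y"
    and to_complex_scaleR: "to_complex (r *\<^sub>R x) = r *\<^sub>R to_complex x"
    and to_complex_one: "to_complex 1 = 1"
    and norm_to_complex: "norm (to_complex x) = norm x"
    and range_to_complex: "range to_complex = \<real> \<or> range to_complex = UNIV"

instantiation real :: real_or_complex
begin
definition to_complex_real :: "real \<Rightarrow> complex" where "to_complex_real = complex_of_real"
instance by standard (auto simp: to_complex_real_def Reals_def scaleR_conv_of_real)
end

instantiation complex :: real_or_complex
begin
definition to_complex_complex :: "complex \<Rightarrow> complex" where "to_complex_complex = id"
instance by standard (auto simp: to_complex_complex_def)
end

(* Addition is the one of the ambient type; only values on carr matter. *)
record ('k, 'v) nspace =
  carr :: "'v set"
  scal :: "'k \<Rightarrow> 'v \<Rightarrow> 'v"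
  nrm :: "'v \<Rightarrow> real"

definition linear_space :: "('k::real_or_complex, 'v::ab_group_add) nspace \<Rightarrow> bool" where
  "linear_space V \<longleftrightarrow>
     0 \<in> carr V \<and>
     (\<forall>x\<in>carr V. \<forall>y\<in>carr V. x + y \<in> carr V) \<and>
     (\<forall>c. \<forall>x\<in>carr V. scal V c x \<in> carr V) \<and>
     (\<forall>c. \<forall>x\<in>carr V. \<forall>y\<in>carr V. scal V c (x + y) = scal V c x + scal V c y) \<and>
     (\<forall>c d. \<forall>x\<in>carr V. scal V (c + d) x = scal V c x + scal V d x) \<and>
     (\<forall>c d. \<forall>x\<in>carr V. scal V c (scal V d x) = scal V (c * d) x) \<and>
     (\<forall>x\<in>carr V. scal V 1 x = x)"

definition norm_on :: "('k::real_or_complex, 'v::ab_group_add) nspace \<Rightarrow> ('v \<Rightarrow> real) \<Rightarrow> bool" where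
  "norm_on V N \<longleftrightarrow>
     (\<forall>x\<in>carr V. 0 \<le> N x \<and> (N x = 0 \<longleftrightarrow> x = 0)) \<and>
     (\<forall>c. \<forall>x\<in>carr V. N (scal V c x) = norm c * N x) \<and>
     (\<forall>x\<in>carr V. \<forall>y\<in>carr V. N (x + y) \<le> N x + N y)"

definition normed_space :: "('k::real_or_complex, 'v::ab_group_add) nspace \<Rightarrow> bool" where
  "normed_space V \<longleftrightarrow> linear_space V \<and> norm_on V (nrm V)"

definition linear_map ::
    "('k::real_or_complex, 'v::ab_group_add) nspace \<Rightarrow> ('k, 'w::ab_group_add) nspace \<Rightarrow> ('v \<Rightarrow> 'w) \<Rightarrow> bool" where
  "linear_map V W T \<longleftrightarrow>
     T \<in> carr V \<rightarrow> carr W \<and>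
     (\<forall>x\<in>carr V. \<forall>y\<in>carr V. T (x + y) = T x + T y) \<and>
     (\<forall>c. \<forall>x\<in>carr V. T (scal V c x) = scal W c (T x))"

definition isomorphism ::
    "('k::real_or_complex, 'v::ab_group_add) nspace \<Rightarrow> ('k, 'w::ab_group_add) nspace \<Rightarrow> ('v \<Rightarrow> 'w) \<Rightarrow> bool" where
  "isomorphism V W T \<longleftrightarrow>
     linear_map V W T \<and> bij_betw T (carr V) (carr W) \<and>
     (\<exists>a>0. \<exists>b>0. \<forall>x\<in>carr V. a * nrm V x \<le> nrm W (T x) \<and> nrm W (T x) \<le> b * nrm V x)"

definition isomorphic ::
    "('k::real_or_complex, 'v::ab_group_add) nspace \<Rightarrow> ('k, 'w::ab_group_add) nspace \<Rightarrow> bool" where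
  "isomorphic V W \<longleftrightarrow> (\<exists>T. isomorphism V W T)"

definition surjective_isometry ::
    "('k::real_or_complex, 'v::ab_group_add) nspace \<Rightarrow> ('k, 'w::ab_group_add) nspace \<Rightarrow> ('v \<Rightarrow> 'w) \<Rightarrow> bool" where
  "surjective_isometry V W T \<longleftrightarrow>
     linear_map V W T \<and> T ` carr V = carr W \<and> (\<forall>x\<in>carr V. nrm W (T x) = nrm V x)"

definition isometric_spaces ::
    "('k::real_or_complex, 'v::ab_group_add) nspace \<Rightarrow> ('k, 'w::ab_group_add) nspace \<Rightarrow> bool" where
  "isometric_spaces V W \<longleftrightarrow> (\<exists>T. surjective_isometry V W T)"

(* Operators on V are functions that are undefined off carr V, so that they are equal
   as soon as they agree on carr V. *)
definition GL :: "('k::real_or_complex, 'v::ab_group_add) nspace \<Rightarrow> ('v \<Rightarrow> 'v) set" where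
  "GL V = {T \<in> extensional (carr V). isomorphism V V T}"

definition Isom :: "('k::real_or_complex, 'v::ab_group_add) nspace \<Rightarrow> ('v \<Rightarrow> 'v) set" where
  "Isom V = {T \<in> extensional (carr V). surjective_isometry V V T}"

definition equivalent_norm ::
    "('k::real_or_complex, 'v::ab_group_add) nspace \<Rightarrow> ('v \<Rightarrow> real) \<Rightarrow> bool" where
  "equivalent_norm V N \<longleftrightarrow>
     norm_on V N \<and> (\<exists>a>0. \<exists>b>0. \<forall>x\<in>carr V. a * nrm V x \<le> N x \<and> N x \<le> b * nrm V x)"

definition maximal_isometry_group :: "('k::real_or_complex, 'v::ab_group_add) nspace \<Rightarrow> bool" where
  "maximal_isometry_group V \<longleftrightarrow>
     (\<forall>N. equivalent_norm V N \<and> Isom V \<subseteq> Isom (V\<lparr>nrm := N\<rparr>) \<longrightarrow> Isom V = Isom (V\<lparr>nrm := N\<rparr>))"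

(* The set of all (U restricted to carr V)^-1 o g o U with g in G, as operators on V. *)
definition pull_back ::
    "('k, 'v) nspace \<Rightarrow> ('v \<Rightarrow> 'w) \<Rightarrow> ('w \<Rightarrow> 'w) set \<Rightarrow> ('v \<Rightarrow> 'v) set" where
  "pull_back V U G = (\<lambda>g. restrict (\<lambda>x. inv_into (carr V) U (g (U x))) (carr V)) ` G"

definition conjugate_in_GL ::
    "('k::real_or_complex, 'v::ab_group_add) nspace \<Rightarrow> ('v \<Rightarrow> 'v) set \<Rightarrow> ('v \<Rightarrow> 'v) set \<Rightarrow> bool" where
  "conjugate_in_GL V G1 G2 \<longleftrightarrow> (\<exists>T\<in>GL V. G1 = pull_back V T G2)"

definition hilbert_space :: "('k::real_or_complex, 'v::ab_group_add) nspace \<Rightarrow> bool" where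
  "hilbert_space H \<longleftrightarrow>
     normed_space H \<and>
     Metric_space.mcomplete (carr H) (\<lambda>x y. nrm H (x - y)) \<and>
     (\<exists>ip :: 'v \<Rightarrow> 'v \<Rightarrow> 'k.
        (\<forall>x\<in>carr H. \<forall>y\<in>carr H. \<forall>z\<in>carr H. ip (x + y) z = ip x z + ip y z) \<and>
        (\<forall>c. \<forall>x\<in>carr H. \<forall>y\<in>carr H. ip (scal H c x) y = c * ip x y) \<and>
        (\<forall>x\<in>carr H. \<forall>y\<in>carr H. to_complex (ip y x) = cnj (to_complex (ip x y))) \<and>
        (\<forall>x\<in>carr H. ip x x = of_real ((nrm H x)\<^sup>2)))"

(* H ranges over spaces on the same ambient type as V; this loses nothing, because the
   structure of any space isomorphic to V can be transported to carr V. *)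
definition hilbertian :: "('k::real_or_complex, 'v::ab_group_add) nspace \<Rightarrow> bool" where
  "hilbertian V \<longleftrightarrow> (\<exists>H :: ('k, 'v) nspace. hilbert_space H \<and> isomorphic V H)"

definition ell2 :: "nat \<Rightarrow> ('k::real_or_complex, nat \<Rightarrow> 'k) nspace" where
  "ell2 n = \<lparr>carr = {x. \<forall>i\<ge>n. x i = 0},
             scal = (\<lambda>c x i. c * x i),
             nrm = (\<lambda>x. L2_set (\<lambda>i. norm (x i)) {..<n})\<rparr>"

locale banach_space_over = vector_space smul
  for smul :: "'k::real_or_complex \<Rightarrow> 'x::banach \<Rightarrow> 'x" +
  assumes smul_of_real: "smul (of_real r) x = r *\<^sub>R x"
    and norm_smul: "norm (smul c x) = norm c * norm x"

definition whole_space :: "('k::real_or_complex \<Rightarrow> 'x::banach \<Rightarrow> 'x) \<Rightarrow> ('k, 'x) nspace" where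
  "whole_space smul = \<lparr>carr = UNIV, scal = smul, nrm = norm\<rparr>"

definition schauder_basis ::
    "('k::real_or_complex \<Rightarrow> 'x::banach \<Rightarrow> 'x) \<Rightarrow> (nat \<Rightarrow> 'x) \<Rightarrow> bool" where
  "schauder_basis smul e \<longleftrightarrow> (\<forall>x. \<exists>!a. (\<lambda>k. smul (a k) (e k)) sums x)"

definition normalized :: "(nat \<Rightarrow> 'x::banach) \<Rightarrow> bool" where
  "normalized e \<longleftrightarrow> (\<forall>k. norm (e k) = 1)"

(* The multipliers range over all scalars of modulus 1: signs in the real case,
   unimodular complex numbers in the complex case. *)
definition one_unconditional ::
    "('k::real_or_complex \<Rightarrow> 'x::banach \<Rightarrow> 'x) \<Rightarrow> (nat \<Rightarrow> 'x) \<Rightarrow> bool" where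
  "one_unconditional smul e \<longleftrightarrow>
     (\<forall>a \<theta> N. (\<forall>k. norm (\<theta> k) = 1) \<longrightarrow>
        norm (\<Sum>k<N. smul (\<theta> k * a k) (e k)) = norm (\<Sum>k<N. smul (a k) (e k)))"

definition isometrically_equivalent ::
    "('k::real_or_complex \<Rightarrow> 'x::banach \<Rightarrow> 'x) \<Rightarrow> (nat \<Rightarrow> 'x) \<Rightarrow> (nat \<Rightarrow> 'x) \<Rightarrow> bool" where
  "isometrically_equivalent smul u v \<longleftrightarrow>
     (\<forall>a N. norm (\<Sum>k<N. smul (a k) (u k)) = norm (\<Sum>k<N. smul (a k) (v k)))"

definition one_symmetric_basis ::
    "('k::real_or_complex \<Rightarrow> 'x::banach \<Rightarrow> 'x) \<Rightarrow> (nat \<Rightarrow> 'x) \<Rightarrow> bool" where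
  "one_symmetric_basis smul e \<longleftrightarrow>
     schauder_basis smul e \<and> normalized e \<and> one_unconditional smul e \<and>
     (\<forall>\<pi>. bij \<pi> \<longrightarrow> isometrically_equivalent smul e (e \<circ> \<pi>))"

definition impure ::
    "('k::real_or_complex \<Rightarrow> 'x::banach \<Rightarrow> 'x) \<Rightarrow> (nat \<Rightarrow> 'x) \<Rightarrow> bool" where
  "impure smul e \<longleftrightarrow>
     (\<exists>\<alpha> \<beta>. \<alpha> \<noteq> \<beta> \<and>
        (\<forall>a b. norm (smul a (e \<alpha>) + smul b (e \<beta>)) = sqrt ((norm a)\<^sup>2 + (norm b)\<^sup>2)) \<and>
        (\<forall>x\<in>module.span smul {e \<alpha>, e \<beta>}. \<forall>x'\<in>module.span smul {e \<alpha>, e \<beta>}.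
           norm x = norm x' \<longrightarrow>
           (\<forall>y\<in>module.span smul (e ` (- {\<alpha>, \<beta>})). norm (x + y) = norm (x' + y))))"

definition pure ::
    "('k::real_or_complex \<Rightarrow> 'x::banach \<Rightarrow> 'x) \<Rightarrow> (nat \<Rightarrow> 'x) \<Rightarrow> bool" where
  "pure smul e \<longleftrightarrow> \<not> impure smul e"

definition hilbert_sum ::
    "(nat \<Rightarrow> 'x::banach) \<Rightarrow> (nat \<Rightarrow> ('k::real_or_complex, 'h::ab_group_add) nspace) \<Rightarrow> ('k, nat \<Rightarrow> 'h) nspace" where
  "hilbert_sum e H =
     \<lparr>carr = {z. (\<forall>k. z k \<in> carr (H k)) \<and> summable (\<lambda>k. nrm (H k) (z k) *\<^sub>R e k)},
      scal = (\<lambda>c z k. scal (H k) c (z k)),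
      nrm = (\<lambda>z. norm (\<Sum>k. nrm (H k) (z k) *\<^sub>R e k))\<rparr>"

end

theory Submission imports Defs begin

text \<open>Call a bounded linear map \<open>A\<close> skew for a norm \<open>N\<close> if \<open>N (x + t A x) \<le> (1 + K t\<^sup>2) N x\<close> for small real \<open>t\<close>;
  this is the condition that \<open>A\<close> generates isometries, stated without exponentials. Skew maps form a real vector
  space stable under conjugation by isometries, and generators of rotations inside a block are skew for every
  norm \<open>N\<close> invariant under the isometries of the sum. If a skew map had a nonzero matrix entry between two
  different blocks, averaging over sign changes and using symmetry would make a rotation generator mixing two
  blocks skew. By symmetry all such generators would be skew, so \<open>N\<close> would be a multiple of the \<open>\<ell>\<^sub>2\<close> norm on a
  copy of the basis, contradicting that the basis is non-hilbertian. Hence skew maps are block diagonal.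
  For an isometry \<open>T\<close>, the conjugates \<open>T\<inverse> P\<^sub>i T\<close> of the block projections therefore commute with the rotation
  generators of each block, so they are \<open>0\<close> or the identity on it: \<open>T\<close> maps blocks onto blocks.
  Since \<open>N\<close> is a multiple of the Euclidean norm on each block, \<open>T\<close> preserves the original norm,
  and the block dimension is an invariant of the isometry group up to conjugacy.\<close>

section \<open>Normed spaces and skew maps\<close>

text \<open>The obstacle is that a renorming \<open>N\<close> is known only through its invariance
  under the isometries of the sum: nothing is known about the shape of its own isometries. What can
  be transported by an unknown isometry is a first-order property of operators, and skewness is
  chosen so that its closure properties are elementary. With exponentials a sum of generators would
  need a product formula; with a quadratic error term it is a convexity inequality, and global
  invariance along a circle is recovered because a function with increments at most
  \<open>C t\<^sup>2\<close> is constant. The sign changes single out two entries because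
  \<open>A - s A s\<close>, with \<open>s\<close> the sign change at one position, keeps exactly the
  entries linking that position to the others. The assumption \<open>n \<ge> 2\<close> enters
  through the blocks: each then contains a plane, hence a rotation generator to commute with.
  Conjugacy is reduced to renorming as well: if an isomorphism \<open>R\<close> carries isometries
  of one sum into isometries of the other, then the norm of \<open>R z\<close> is an invariant
  renorming of the first sum, and \<open>R\<close> becomes an isometry between two sums with
  possibly different block dimensions.\<close>

lemma linear_space_add: "linear_space V \<Longrightarrow> x \<in> carr V \<Longrightarrow> y \<in> carr V \<Longrightarrow> x + y \<in> carr V"
  and linear_space_scal: "linear_space V \<Longrightarrow> x \<in> carr V \<Longrightarrow> scal V c x \<in> carr V"
  and linear_space_zero: "linear_space V \<Longrightarrow> 0 \<in> carr V"
  and scal_add_right: "linear_space V \<Longrightarrow> x \<in> carr V \<Longrightarrow> y \<in> carr V \<Longrightarrow> scal V c (x + y) = scal V c x + scal V c y"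
  and scal_add_left: "linear_space V \<Longrightarrow> x \<in> carr V \<Longrightarrow> scal V (c + d) x = scal V c x + scal V d x"
  and scal_scal: "linear_space V \<Longrightarrow> x \<in> carr V \<Longrightarrow> scal V c (scal V d x) = scal V (c * d) x"
  and scal_one: "linear_space V \<Longrightarrow> x \<in> carr V \<Longrightarrow> scal V 1 x = x"
  by (auto simp: linear_space_def)

lemma scal_zero_left:
  assumes "linear_space V" "x \<in> carr V" shows "scal V 0 x = 0"
  using scal_add_left[OF assms, of 0 0] by simp

lemma scal_minus_one:
  assumes "linear_space V" "x \<in> carr V" shows "scal V (-1) x = - x"
  using scal_add_left[OF assms, of 1 "-1"] scal_zero_left[OF assms] scal_one[OF assms]
  by (simp add: eq_neg_iff_add_eq_0 add.commute)

lemma linear_space_uminus: "linear_space V \<Longrightarrow> x \<in> carr V \<Longrightarrow> - x \<in> carr V"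
  using linear_space_scal[of V x "-1"] scal_minus_one[of V x] by simp

lemma linear_space_diff: "linear_space V \<Longrightarrow> x \<in> carr V \<Longrightarrow> y \<in> carr V \<Longrightarrow> x - y \<in> carr V"
  using linear_space_add[of V x "- y"] linear_space_uminus[of V y] by simp

lemma linear_space_sum: "linear_space V \<Longrightarrow> (\<And>i. i \<in> I \<Longrightarrow> f i \<in> carr V) \<Longrightarrow> sum f I \<in> carr V"
  by (induction I rule: infinite_finite_induct) (auto simp: linear_space_add linear_space_zero)

lemma linear_map_carr: "linear_map V W T \<Longrightarrow> x \<in> carr V \<Longrightarrow> T x \<in> carr W"
  and linear_map_add: "linear_map V W T \<Longrightarrow> x \<in> carr V \<Longrightarrow> y \<in> carr V \<Longrightarrow> T (x + y) = T x + T y"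
  and linear_map_scal: "linear_map V W T \<Longrightarrow> x \<in> carr V \<Longrightarrow> T (scal V c x) = scal W c (T x)"
  by (auto simp: linear_map_def)

lemma linear_map_zero:
  assumes "linear_space V" "linear_map V W T" shows "T 0 = 0"
  using linear_map_add[OF assms(2), of 0 0] linear_space_zero[OF assms(1)] by simp

lemma linear_map_uminus:
  assumes "linear_space V" "linear_map V W T" "x \<in> carr V" shows "T (- x) = - T x"
  using linear_map_add[OF assms(2,3), of "- x"] linear_space_uminus[OF assms(1,3)] linear_map_zero[OF assms(1,2)]
  by (simp add: eq_neg_iff_add_eq_0 add.commute)

lemma linear_map_diff:
  assumes "linear_space V" "linear_map V W T" "x \<in> carr V" "y \<in> carr V" shows "T (x - y) = T x - T y"
  using linear_map_add[OF assms(2,3), of "- y"] linear_space_uminus[OF assms(1,4)] linear_map_uminus[OF assms(1,2,4)]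
  by simp

lemma linear_map_sum:
  assumes "linear_space V" "linear_map V W T" "\<And>i. i \<in> I \<Longrightarrow> f i \<in> carr V"
  shows "T (sum f I) = (\<Sum>i\<in>I. T (f i))"
  using assms(3)
  by (induction I rule: infinite_finite_induct)
     (auto simp: linear_map_zero[OF assms(1,2)] linear_map_add[OF assms(2)] linear_space_sum[OF assms(1)])

lemma linear_map_compose: "linear_map U V S \<Longrightarrow> linear_map V W T \<Longrightarrow> linear_map U W (T \<circ> S)"
  by (auto simp: linear_map_def Pi_iff)

lemma normed_space_linear: "normed_space V \<Longrightarrow> linear_space V"
  by (simp add: normed_space_def)

lemma nrm_nonneg: "normed_space V \<Longrightarrow> x \<in> carr V \<Longrightarrow> 0 \<le> nrm V x"
  and nrm_eq_zero: "normed_space V \<Longrightarrow> x \<in> carr V \<Longrightarrow> nrm V x = 0 \<longleftrightarrow> x = 0"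
  and nrm_scal: "normed_space V \<Longrightarrow> x \<in> carr V \<Longrightarrow> nrm V (scal V c x) = norm c * nrm V x"
  and nrm_add: "normed_space V \<Longrightarrow> x \<in> carr V \<Longrightarrow> y \<in> carr V \<Longrightarrow> nrm V (x + y) \<le> nrm V x + nrm V y"
  by (auto simp: normed_space_def norm_on_def)

lemma nrm_zero: "normed_space V \<Longrightarrow> nrm V 0 = 0"
  using nrm_eq_zero[of V 0] linear_space_zero[OF normed_space_linear] by auto

lemma nrm_uminus: "normed_space V \<Longrightarrow> x \<in> carr V \<Longrightarrow> nrm V (- x) = nrm V x"
  using nrm_scal[of V x "-1"] scal_minus_one[OF normed_space_linear, of V x] by simp

lemma nrm_diff: "normed_space V \<Longrightarrow> x \<in> carr V \<Longrightarrow> y \<in> carr V \<Longrightarrow> nrm V (x - y) \<le> nrm V x + nrm V y"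
  using nrm_add[of V x "- y"] nrm_uminus[of V y] linear_space_uminus[OF normed_space_linear, of V y] by simp

lemma nrm_minus_commute:
  "normed_space V \<Longrightarrow> x \<in> carr V \<Longrightarrow> y \<in> carr V \<Longrightarrow> nrm V (x - y) = nrm V (y - x)"
  using nrm_uminus[of V "x - y"] linear_space_diff[OF normed_space_linear, of V x y] by simp

lemma nrm_triangle3:
  "normed_space V \<Longrightarrow> x \<in> carr V \<Longrightarrow> y \<in> carr V \<Longrightarrow> nrm V x \<le> nrm V y + nrm V (x - y)"
  using nrm_add[of V y "x - y"] linear_space_diff[OF normed_space_linear, of V x y] by simp

lemma surjective_isometry_inj:
  assumes V: "normed_space V" and W: "normed_space W" and T: "surjective_isometry V W T"
  shows "inj_on T (carr V)"
proof (rule inj_onI)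
  fix x y assume xy: "x \<in> carr V" "y \<in> carr V" "T x = T y"
  have L: "linear_space V" and T': "linear_map V W T" using V T by (auto simp: normed_space_def surjective_isometry_def)
  have "nrm V (x - y) = nrm W (T x - T y)"
    using T linear_map_diff[OF L T' xy(1,2)] linear_space_diff[OF L xy(1,2)]
    by (metis surjective_isometry_def)
  then have "nrm V (x - y) = 0" using xy nrm_zero[OF W] by simp
  then show "x = y" using nrm_eq_zero[OF V linear_space_diff[OF L xy(1,2)]] by simp
qed

lemma surjective_isometry_bij:
  "normed_space V \<Longrightarrow> normed_space W \<Longrightarrow> surjective_isometry V W T \<Longrightarrow> bij_betw T (carr V) (carr W)"
  using surjective_isometry_inj[of V W T] by (auto simp: bij_betw_def surjective_isometry_def)

lemma linear_map_inv:
  assumes V: "linear_space V" and W: "linear_space W" and T: "linear_map V W T" and b: "bij_betw T (carr V) (carr W)"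
  shows "linear_map W V (inv_into (carr V) T)"
proof -
  let ?S = "inv_into (carr V) T"
  have S: "?S y \<in> carr V" "T (?S y) = y" if "y \<in> carr W" for y
    using that b by (auto simp: bij_betw_def inv_into_into f_inv_into_f)
  have ST: "?S (T x) = x" if "x \<in> carr V" for x using that b by (auto simp: bij_betw_def)
  have "?S (x + y) = ?S x + ?S y" if "x \<in> carr W" "y \<in> carr W" for x y
    using ST[of "?S x + ?S y"] linear_map_add[OF T, of "?S x" "?S y"] S that linear_space_add[OF V] by simp
  moreover have "?S (scal W c x) = scal V c (?S x)" if "x \<in> carr W" for c x
    using ST[of "scal V c (?S x)"] linear_map_scal[OF T, of "?S x" c] S that linear_space_scal[OF V] by simp
  ultimately show ?thesis using S by (auto simp: linear_map_def)
qed

lemma isomorphism_inv: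
  assumes V: "linear_space V" and W: "linear_space W" and T: "isomorphism V W T"
  shows "isomorphism W V (inv_into (carr V) T)"
proof -
  let ?S = "inv_into (carr V) T"
  have b: "bij_betw T (carr V) (carr W)" and l: "linear_map V W T" using T by (auto simp: isomorphism_def)
  have S: "?S y \<in> carr V" "T (?S y) = y" if "y \<in> carr W" for y
    using that b by (auto simp: bij_betw_def inv_into_into f_inv_into_f)
  obtain a b' where ab: "a > 0" "b' > 0" and *: "\<And>x. x \<in> carr V \<Longrightarrow> a * nrm V x \<le> nrm W (T x) \<and> nrm W (T x) \<le> b' * nrm V x"
    using T by (auto simp: isomorphism_def)
  have "(1/b') * nrm W y \<le> nrm V (?S y) \<and> nrm V (?S y) \<le> (1/a) * nrm W y" if "y \<in> carr W" for y
    using *[of "?S y"] S[OF that] ab by (auto simp: field_simps)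
  moreover have "1/b' > 0" "1/a > 0" using ab by auto
  ultimately show ?thesis using linear_map_inv[OF V W l b] bij_betw_inv_into[OF b]
    unfolding isomorphism_def by blast
qed

lemma isomorphism_compose:
  assumes "isomorphism U V S" "isomorphism V W T"
  shows "isomorphism U W (T \<circ> S)"
proof -
  obtain a b where ab: "a > 0" "b > 0" and 1: "\<And>x. x \<in> carr U \<Longrightarrow> a * nrm U x \<le> nrm V (S x) \<and> nrm V (S x) \<le> b * nrm U x"
    using assms(1) by (auto simp: isomorphism_def)
  obtain c d where cd: "c > 0" "d > 0" and 2: "\<And>x. x \<in> carr V \<Longrightarrow> c * nrm V x \<le> nrm W (T x) \<and> nrm W (T x) \<le> d * nrm V x"
    using assms(2) by (auto simp: isomorphism_def)
  have "(c * a) * nrm U x \<le> nrm W ((T \<circ> S) x) \<and> nrm W ((T \<circ> S) x) \<le> (d * b) * nrm U x" if x: "x \<in> carr U" for x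
  proof -
    have s: "S x \<in> carr V" using assms(1) x by (auto simp: isomorphism_def linear_map_def)
    have "c * (a * nrm U x) \<le> c * nrm V (S x)" "d * nrm V (S x) \<le> d * (b * nrm U x)"
      using 1[OF x] cd by auto
    then show ?thesis using 2[OF s] by auto
  qed
  moreover have "c * a > 0" "d * b > 0" using ab cd by auto
  moreover have "linear_map U W (T \<circ> S)" "bij_betw (T \<circ> S) (carr U) (carr W)"
    using assms linear_map_compose[of U V S W T] bij_betw_trans[of S "carr U" "carr V" T "carr W"]
    unfolding isomorphism_def by blast+
  ultimately show ?thesis unfolding isomorphism_def by blast
qed

lemma isomorphism_of_isometry:
  "normed_space V \<Longrightarrow> normed_space W \<Longrightarrow> surjective_isometry V W T \<Longrightarrow> isomorphism V W T"
  using surjective_isometry_bij[of V W T] unfolding isomorphism_def surjective_isometry_def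
  by (metis mult_1 order_refl zero_less_one)

lemma surjective_isometry_inv:
  assumes V: "normed_space V" and W: "normed_space W" and T: "surjective_isometry V W T"
  shows "surjective_isometry W V (inv_into (carr V) T)"
proof -
  have b: "bij_betw T (carr V) (carr W)" using surjective_isometry_bij[OF assms] .
  have "nrm V (inv_into (carr V) T y) = nrm W y" if "y \<in> carr W" for y
    using T that b unfolding surjective_isometry_def bij_betw_def
    by (metis f_inv_into_f inv_into_into)
  then show ?thesis using linear_map_inv[OF _ _ _ b] T bij_betw_inv_into[OF b] V W
    by (auto simp: surjective_isometry_def normed_space_def bij_betw_def)
qed

lemma surjective_isometry_compose:
  "surjective_isometry U V S \<Longrightarrow> surjective_isometry V W T \<Longrightarrow> surjective_isometry U W (T \<circ> S)"
  unfolding surjective_isometry_def using linear_map_compose[of U V S W T] linear_map_carr[of U V S]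
  by (metis comp_apply image_comp)

lemma surjective_isometry_cong:
  assumes "\<And>x. x \<in> carr V \<Longrightarrow> T x = T' x" "linear_space V"
  shows "surjective_isometry V W T \<longleftrightarrow> surjective_isometry V W T'"
proof -
  have "linear_map V W T \<longleftrightarrow> linear_map V W T'"
    using assms by (auto simp: linear_map_def Pi_iff linear_space_add linear_space_scal)
  moreover have "T ` carr V = T' ` carr V" using assms by (auto intro: image_cong)
  ultimately show ?thesis using assms by (auto simp: surjective_isometry_def)
qed

lemma restrict_in_Isom:
  assumes "linear_space V" "surjective_isometry V V T"
  shows "restrict T (carr V) \<in> Isom V"
proof -
  have "surjective_isometry V V (restrict T (carr V)) \<longleftrightarrow> surjective_isometry V V T"
    by (rule surjective_isometry_cong) (simp_all add: assms(1))
  then show ?thesis using assms(2) by (simp add: Isom_def)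
qed

text \<open>The parameter is real over both scalar fields and takes both signs, so the condition
  controls \<open>A\<close> and \<open>- A\<close> at once. The range
  \<open>\<bar>t\<bar> \<le> 1\<close> is a normalization; \<open>skew_half\<close> allows any
  smaller interval for bounded maps.\<close>

definition skew :: "('k::real_or_complex, 'v::ab_group_add) nspace \<Rightarrow> ('v \<Rightarrow> 'v) \<Rightarrow> bool" where
  "skew V A \<longleftrightarrow> linear_map V V A \<and>
     (\<exists>K\<ge>0. \<forall>x\<in>carr V. \<forall>t. \<bar>t\<bar> \<le> 1 \<longrightarrow> nrm V (x + scal V (of_real t) (A x)) \<le> (1 + K * t\<^sup>2) * nrm V x)"

lemma skew_linear_map: "skew V A \<Longrightarrow> linear_map V V A"
  by (simp add: skew_def)

text \<open>The case \<open>t = 1\<close> of the definition already bounds \<open>A\<close>, because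
  \<open>A x = (x + A x) - x\<close>.\<close>

lemma skew_bounded:
  assumes V: "normed_space V" and A: "skew V A"
  obtains K where "K \<ge> 0" "\<And>x. x \<in> carr V \<Longrightarrow> nrm V (A x) \<le> K * nrm V x"
proof -
  obtain K where K: "K \<ge> 0" "\<And>x t. x \<in> carr V \<Longrightarrow> \<bar>t\<bar> \<le> 1 \<Longrightarrow> nrm V (x + scal V (of_real t) (A x)) \<le> (1 + K * t\<^sup>2) * nrm V x"
    using A by (auto simp: skew_def)
  have L: "linear_space V" using V by (simp add: normed_space_def)
  have "nrm V (A x) \<le> (2 + K) * nrm V x" if x: "x \<in> carr V" for x
  proof -
    have a: "A x \<in> carr V" using A x by (auto simp: skew_def linear_map_def)
    have "nrm V (A x) = nrm V ((x + A x) - x)" by simp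
    also have "\<dots> \<le> nrm V (x + A x) + nrm V x"
      by (rule nrm_diff[OF V linear_space_add[OF L x a] x])
    also have "\<dots> \<le> (2 + K) * nrm V x" using K(2)[OF x, of 1] scal_one[OF L a] by (simp add: algebra_simps)
    finally show ?thesis .
  qed
  then show ?thesis using that[of "2 + K"] K(1) by auto
qed

text \<open>Only small parameters matter: once \<open>\<bar>t\<bar> > d\<close>, the linear term is
  dominated by \<open>t\<^sup>2 / d\<close>, so boundedness of \<open>A\<close> supplies the
  quadratic estimate. This absorbs the change of parameter range caused by adding or rescaling skew
  maps.\<close>

lemma skew_half:
  assumes V: "normed_space V" and A: "linear_map V V A" and K: "K \<ge> 0" and "0 < d"
    and *: "\<And>x t. x \<in> carr V \<Longrightarrow> \<bar>t\<bar> \<le> d \<Longrightarrow> nrm V (x + scal V (of_real t) (A x)) \<le> (1 + K * t\<^sup>2) * nrm V x"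
    and B: "K' \<ge> 0" "\<And>x. x \<in> carr V \<Longrightarrow> nrm V (A x) \<le> K' * nrm V x"
  shows "skew V A"
proof -
  have L: "linear_space V" using V by (simp add: normed_space_def)
  \<comment> \<open>The summand \<open>K\<close> serves the parameters up to \<open>d\<close>, the
    summand \<open>K' / d\<close> the larger ones.\<close>
  define M where "M = K + K' / d"
  have "nrm V (x + scal V (of_real t) (A x)) \<le> (1 + M * t\<^sup>2) * nrm V x" if x: "x \<in> carr V" for x t
  proof (cases "\<bar>t\<bar> \<le> d")
    case True
    have "K * t\<^sup>2 \<le> M * t\<^sup>2" using B(1) \<open>0 < d\<close> by (auto simp: M_def intro!: mult_right_mono)
    then have "(1 + K * t\<^sup>2) * nrm V x \<le> (1 + M * t\<^sup>2) * nrm V x"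
      using nrm_nonneg[OF V x] by (intro mult_right_mono) auto
    then show ?thesis using *[OF x True] by simp
  next
    case False
    have a: "A x \<in> carr V" using linear_map_carr[OF A x] .
    have "nrm V (x + scal V (of_real t) (A x)) \<le> nrm V x + nrm V (scal V (of_real t) (A x))"
      by (rule nrm_add[OF V x linear_space_scal[OF L a]])
    also have "nrm V (scal V (of_real t) (A x)) = \<bar>t\<bar> * nrm V (A x)" using nrm_scal[OF V a] by simp
    also have "\<dots> \<le> \<bar>t\<bar> * (K' * nrm V x)" using B(2)[OF x] by (intro mult_left_mono) auto
    also have "\<dots> \<le> (M * t\<^sup>2) * nrm V x"
    proof -
      have "d * \<bar>t\<bar> \<le> t\<^sup>2" using False by (simp add: power2_eq_square abs_mult_self_eq mult_right_mono[of d "\<bar>t\<bar>" "\<bar>t\<bar>", simplified])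
      then have "\<bar>t\<bar> \<le> t\<^sup>2 / d" using \<open>0 < d\<close> by (simp add: field_simps)
      then have "\<bar>t\<bar> * K' \<le> t\<^sup>2 / d * K'" using B(1) by (rule mult_right_mono)
      also have "\<dots> \<le> M * t\<^sup>2" using K by (simp add: M_def field_simps)
      finally show ?thesis using nrm_nonneg[OF V x] mult_right_mono[of "\<bar>t\<bar> * K'" "M * t\<^sup>2" "nrm V x"]
        by (simp add: mult.assoc)
    qed
    finally show ?thesis by (simp add: algebra_simps)
  qed
  moreover have "M \<ge> 0" using K B(1) \<open>0 < d\<close> by (simp add: M_def)
  ultimately show ?thesis using A unfolding skew_def by blast
qed

text \<open>The perturbation by the sum is the average of the two perturbations with doubled parameter.\<close>

lemma skew_add:
  assumes V: "normed_space V" and A: "skew V A" and B: "skew V B"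
  shows "skew V (\<lambda>x. A x + B x)"
proof -
  have L: "linear_space V" using V by (simp add: normed_space_def)
  obtain K where K: "K \<ge> 0" "\<And>x t. x \<in> carr V \<Longrightarrow> \<bar>t\<bar> \<le> 1 \<Longrightarrow> nrm V (x + scal V (of_real t) (A x)) \<le> (1 + K * t\<^sup>2) * nrm V x"
    using A by (auto simp: skew_def)
  obtain M where M: "M \<ge> 0" "\<And>x t. x \<in> carr V \<Longrightarrow> \<bar>t\<bar> \<le> 1 \<Longrightarrow> nrm V (x + scal V (of_real t) (B x)) \<le> (1 + M * t\<^sup>2) * nrm V x"
    using B by (auto simp: skew_def)
  obtain a where a: "a \<ge> 0" "\<And>x. x \<in> carr V \<Longrightarrow> nrm V (A x) \<le> a * nrm V x" using skew_bounded[OF V A] by blast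
  obtain b where b: "b \<ge> 0" "\<And>x. x \<in> carr V \<Longrightarrow> nrm V (B x) \<le> b * nrm V x" using skew_bounded[OF V B] by blast
  note cA = linear_map_carr[OF skew_linear_map[OF A]] and cB = linear_map_carr[OF skew_linear_map[OF B]]
  have lin: "linear_map V V (\<lambda>x. A x + B x)"
    using skew_linear_map[OF A] skew_linear_map[OF B] cA cB L
    by (auto simp: linear_map_def Pi_iff linear_space_add scal_add_right algebra_simps)
  show ?thesis
  \<comment> \<open>Using the hypotheses at \<open>2 * t\<close> restricts \<open>t\<close> to
    \<open>1/2\<close>, and half of \<open>K * (2*t)\<^sup>2 + M * (2*t)\<^sup>2\<close> is
    \<open>2 * (K + M) * t\<^sup>2\<close>.\<close>
  proof (rule skew_half[OF V lin, of "2 * (K + M)" "1/2" "a + b"])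
    fix x t assume x: "x \<in> carr V" and t: "\<bar>t::real\<bar> \<le> 1/2"
    let ?p = "x + scal V (of_real (2*t)) (A x)" and ?q = "x + scal V (of_real (2*t)) (B x)"
    have pq: "?p \<in> carr V" "?q \<in> carr V" using x cA cB L by (auto simp: linear_space_add linear_space_scal)
    have h: "scal V (1/2) (scal V (of_real (2*t)) y) = scal V (of_real t) y" if "y \<in> carr V" for y
      using scal_scal[OF L that, of "1/2" "of_real (2*t)"] by simp
    have h2: "scal V (1/2) x + scal V (1/2) x = x"
      using scal_add_left[OF L x, of "1/2" "1/2"] scal_one[OF L x] by simp
    have "scal V (1/2) (?p + ?q) = (scal V (1/2) x + scal V (of_real t) (A x)) + (scal V (1/2) x + scal V (of_real t) (B x))"
      using x cA[OF x] cB[OF x] L by (simp add: scal_add_right linear_space_add linear_space_scal h h[simplified])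
    also have "\<dots> = (scal V (1/2) x + scal V (1/2) x) + (scal V (of_real t) (A x) + scal V (of_real t) (B x))"
      by (simp add: algebra_simps)
    also have "\<dots> = x + scal V (of_real t) (A x + B x)"
      using x cA[OF x] cB[OF x] L h2 by (simp add: scal_add_right)
    finally have "nrm V (x + scal V (of_real t) (A x + B x)) = nrm V (?p + ?q) / 2"
      using nrm_scal[OF V linear_space_add[OF L pq], of "1/2"] by (simp add: norm_divide)
    also have "\<dots> \<le> (nrm V ?p + nrm V ?q) / 2" using nrm_add[OF V pq] by simp
    also have "\<dots> \<le> ((1 + K * (2*t)\<^sup>2) * nrm V x + (1 + M * (2*t)\<^sup>2) * nrm V x) / 2"
      using K(2)[OF x, of "2*t"] M(2)[OF x, of "2*t"] t by (intro divide_right_mono add_mono) auto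
    also have "\<dots> = (1 + 2 * (K + M) * t\<^sup>2) * nrm V x"
      by (simp add: algebra_simps power_mult_distrib)
    finally show "nrm V (x + scal V (of_real t) (A x + B x)) \<le> (1 + 2 * (K + M) * t\<^sup>2) * nrm V x" .
  next
    fix x assume x: "x \<in> carr V"
    show "nrm V (A x + B x) \<le> (a + b) * nrm V x"
      using nrm_add[OF V cA[OF x] cB[OF x]] a(2)[OF x] b(2)[OF x] by (simp add: algebra_simps)
  qed (use K M a b in auto)
qed

lemma skew_scale:
  assumes V: "normed_space V" and A: "skew V A"
  shows "skew V (\<lambda>x. scal V (of_real r) (A x))"
proof -
  have L: "linear_space V" using V by (simp add: normed_space_def)
  obtain K where K: "K \<ge> 0" "\<And>x t. x \<in> carr V \<Longrightarrow> \<bar>t\<bar> \<le> 1 \<Longrightarrow> nrm V (x + scal V (of_real t) (A x)) \<le> (1 + K * t\<^sup>2) * nrm V x"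
    using A by (auto simp: skew_def)
  obtain a where a: "a \<ge> 0" "\<And>x. x \<in> carr V \<Longrightarrow> nrm V (A x) \<le> a * nrm V x" using skew_bounded[OF V A] by blast
  note cA = linear_map_carr[OF skew_linear_map[OF A]]
  have lin: "linear_map V V (\<lambda>x. scal V (of_real r) (A x))"
    using skew_linear_map[OF A] cA L
    by (auto simp: linear_map_def Pi_iff linear_space_scal scal_add_right scal_scal mult.commute)
  show ?thesis
  \<comment> \<open>The bound \<open>1 / (1 + \<bar>r\<bar>)\<close> instead of
    \<open>1 / \<bar>r\<bar>\<close> covers \<open>r = 0\<close> without a case distinction.\<close>
  proof (rule skew_half[OF V lin, of "K * r\<^sup>2" "1 / (1 + \<bar>r\<bar>)" "\<bar>r\<bar> * a"])
    fix x t assume x: "x \<in> carr V" and t: "\<bar>t::real\<bar> \<le> 1 / (1 + \<bar>r\<bar>)"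
    have "\<bar>t * r\<bar> \<le> 1"
    proof -
      have "\<bar>t\<bar> * (1 + \<bar>r\<bar>) \<le> 1" using t by (simp add: pos_le_divide_eq)
      moreover have "\<bar>t\<bar> * \<bar>r\<bar> \<le> \<bar>t\<bar> * (1 + \<bar>r\<bar>)" by (rule mult_left_mono) auto
      ultimately show ?thesis by (simp add: abs_mult)
    qed
    then show "nrm V (x + scal V (of_real t) (scal V (of_real r) (A x))) \<le> (1 + K * r\<^sup>2 * t\<^sup>2) * nrm V x"
      using K(2)[OF x, of "t * r"] scal_scal[OF L cA[OF x]] by (simp add: power_mult_distrib algebra_simps)
  next
    fix x assume x: "x \<in> carr V"
    show "nrm V (scal V (of_real r) (A x)) \<le> (\<bar>r\<bar> * a) * nrm V x"
      using nrm_scal[OF V cA[OF x]] a(2)[OF x] by (simp add: mult.assoc mult_left_mono)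
  qed (use K a in auto)
qed

lemma linear_map_cong:
  assumes "\<And>x. x \<in> carr V \<Longrightarrow> T x = T' x" "linear_space V"
  shows "linear_map V W T \<longleftrightarrow> linear_map V W T'"
    using assms by (auto simp: linear_map_def Pi_iff linear_space_add linear_space_scal)

lemma skew_cong:
  assumes "\<And>x. x \<in> carr V \<Longrightarrow> A x = B x" "linear_space V"
  shows "skew V A \<longleftrightarrow> skew V B"
proof -
  have "linear_map V V A \<longleftrightarrow> linear_map V V B" using assms by (rule linear_map_cong)
  then show ?thesis using assms(1) by (simp add: skew_def)
qed

lemma skew_diff:
  assumes V: "normed_space V" and A: "skew V A" and B: "skew V B"
  shows "skew V (\<lambda>x. A x - B x)"
proof -
  have "skew V (\<lambda>x. A x + scal V (of_real (-1)) (B x))"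
    by (rule skew_add[OF V A skew_scale[OF V B]])
  moreover have "scal V (of_real (-1)) (B x) = - B x" if "x \<in> carr V" for x
    using scal_minus_one[OF normed_space_linear[OF V] linear_map_carr[OF skew_linear_map[OF B] that]] by simp
  ultimately show ?thesis using skew_cong[of V "\<lambda>x. A x + scal V (of_real (-1)) (B x)" "\<lambda>x. A x - B x"] normed_space_linear[OF V] by auto
qed

text \<open>The perturbation of \<open>y\<close> by \<open>T A S\<close> is the image under
  \<open>T\<close> of the perturbation of \<open>S y\<close> by \<open>A\<close>, so the same
  constant serves. The two spaces may differ, which allows sums with different block dimensions to
  be compared.\<close>

lemma skew_conj:
  assumes V: "normed_space V" and W: "normed_space W" and A: "skew V A"
    and T: "surjective_isometry V W T" and S: "surjective_isometry W V S"
    and TS: "\<And>y. y \<in> carr W \<Longrightarrow> T (S y) = y"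
  shows "skew W (\<lambda>y. T (A (S y)))"
proof -
  have L: "linear_space V" using V by (simp add: normed_space_def)
  obtain K where K: "K \<ge> 0" "\<And>x t. x \<in> carr V \<Longrightarrow> \<bar>t\<bar> \<le> 1 \<Longrightarrow> nrm V (x + scal V (of_real t) (A x)) \<le> (1 + K * t\<^sup>2) * nrm V x"
    using A by (auto simp: skew_def)
  have lT: "linear_map V W T" and lS: "linear_map W V S" using S T by (auto simp: surjective_isometry_def)
  have lin: "linear_map W W (\<lambda>y. T (A (S y)))"
    using linear_map_compose[OF linear_map_compose[OF lS skew_linear_map[OF A]] lT] by (simp add: comp_def)
  have "nrm W (y + scal W (of_real t) (T (A (S y)))) \<le> (1 + K * t\<^sup>2) * nrm W y" if y: "y \<in> carr W" and t: "\<bar>t\<bar> \<le> 1" for y t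
  proof -
    have s: "S y \<in> carr V" using linear_map_carr[OF lS y] .
    have as: "A (S y) \<in> carr V" using linear_map_carr[OF skew_linear_map[OF A] s] .
    have "y + scal W (of_real t) (T (A (S y))) = T (S y + scal V (of_real t) (A (S y)))"
      using linear_map_add[OF lT s linear_space_scal[OF L as]] linear_map_scal[OF lT as] TS[OF y] by simp
    then have "nrm W (y + scal W (of_real t) (T (A (S y)))) = nrm V (S y + scal V (of_real t) (A (S y)))"
      using T linear_space_add[OF L s linear_space_scal[OF L as]] by (simp add: surjective_isometry_def)
    also have "\<dots> \<le> (1 + K * t\<^sup>2) * nrm V (S y)" by (rule K(2)[OF s t])
    finally show ?thesis using S y by (simp add: surjective_isometry_def)
  qed
  then show ?thesis using lin K(1) unfolding skew_def by blast
qed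

section \<open>Scalars seen in the complex plane, and eigenvalues of skew maps\<close>

lemma inj_to_complex: "inj (to_complex :: 'k::real_or_complex \<Rightarrow> complex)"
proof (rule injI)
  fix x y :: 'k assume xy: "to_complex x = to_complex y"
  have "to_complex (x + (-1) *\<^sub>R y) = 0" using xy by (simp only: to_complex_add to_complex_scaleR) simp
  then have "norm (x - y) = 0" using norm_to_complex[of "x - y"] by simp
  then show "x = y" by simp
qed

lemma to_complex_of_real: "to_complex (of_real r :: 'k::real_or_complex) = of_real r"
  using to_complex_scaleR[of r "1::'k"] by (simp add: of_real_def to_complex_one)

lemma to_complex_minus: "to_complex (- x :: 'k::real_or_complex) = - to_complex x"
  using to_complex_scaleR[of "-1" x] by simp

lemma to_complex_diff: "to_complex (x - y :: 'k::real_or_complex) = to_complex x - to_complex y"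
  using to_complex_add[of x "- y"] to_complex_minus[of y] by simp

text \<open>On an eigenvector the estimate becomes
  \<open>norm (1 + t c) \<le> 1 + K t\<^sup>2\<close>. Its real part gives
  \<open>t * Re c \<le> K * t\<^sup>2\<close> for small \<open>t\<close> of either sign, which is
  impossible unless \<open>Re c = 0\<close>.\<close>

lemma skew_eigenvalue:
  assumes V: "normed_space V" and A: "skew V A" and x: "x \<in> carr V" "x \<noteq> 0" and Ax: "A x = scal V c x"
  shows "Re (to_complex c) = 0"
proof (rule ccontr)
  assume ne: "Re (to_complex c) \<noteq> 0"
  have L: "linear_space V" using V by (simp add: normed_space_def)
  obtain K where K: "K \<ge> 0" "\<And>x t. x \<in> carr V \<Longrightarrow> \<bar>t\<bar> \<le> 1 \<Longrightarrow> nrm V (x + scal V (of_real t) (A x)) \<le> (1 + K * t\<^sup>2) * nrm V x"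
    using A by (auto simp: skew_def)
  have pos: "nrm V x > 0" using nrm_nonneg[OF V x(1)] nrm_eq_zero[OF V x(1)] x(2) by auto
  define r where "r = Re (to_complex c)"
  have bound: "1 + t * r \<le> 1 + K * t\<^sup>2" if t: "\<bar>t\<bar> \<le> 1" for t
  proof -
    have "x + scal V (of_real t) (A x) = scal V (1 + of_real t * c) x"
      using scal_add_left[OF L x(1), of 1 "of_real t * c"] scal_one[OF L x(1)] scal_scal[OF L x(1)] Ax by simp
    then have "norm (1 + of_real t * c) * nrm V x \<le> (1 + K * t\<^sup>2) * nrm V x"
      using K(2)[OF x(1) t] nrm_scal[OF V x(1)] by simp
    then have "norm (1 + of_real t * c) \<le> 1 + K * t\<^sup>2" using pos by simp
    moreover have "norm (1 + of_real t * c) = norm (to_complex (1 + of_real t * c))" by (simp add: norm_to_complex)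
    moreover have "\<dots> \<ge> Re (to_complex (1 + of_real t * c))" by (rule complex_Re_le_cmod)
    moreover have "Re (to_complex (1 + of_real t * c)) = 1 + t * r"
      by (simp add: to_complex_add to_complex_mult to_complex_one to_complex_of_real r_def)
    ultimately show ?thesis by linarith
  qed
  \<comment> \<open>This \<open>t\<close> has the sign of \<open>r\<close>, so \<open>t * r\<close>
    equals \<open>t\<^sup>2\<close> times the denominator, which exceeds \<open>K\<close>. The
    factor \<open>1 + \<bar>r\<bar>\<close> keeps \<open>\<bar>t\<bar> \<le> 1\<close>.\<close>
  define t where "t = r / ((1 + \<bar>r\<bar>) * (1 + K))"
  have d: "(1 + \<bar>r\<bar>) * (1 + K) > 0" "(1 + \<bar>r\<bar>) * (1 + K) \<ge> 1 + \<bar>r\<bar>" using K(1)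
    by (simp_all add: mult_left_mono[of 1 "1 + K" "1 + \<bar>r\<bar>", simplified])
  have "\<bar>t\<bar> = \<bar>r\<bar> / ((1 + \<bar>r\<bar>) * (1 + K))" using d(1) by (simp only: t_def abs_divide abs_of_pos)
  then have "\<bar>t\<bar> \<le> 1" using d by (simp only: divide_le_eq_1_pos)
  have "t * r \<le> K * t\<^sup>2" using bound[OF \<open>\<bar>t\<bar> \<le> 1\<close>] by simp
  have "t * r = t\<^sup>2 * ((1 + \<bar>r\<bar>) * (1 + K))" using d by (simp add: t_def power2_eq_square)
  moreover have "t\<^sup>2 > 0" using ne d(1) unfolding t_def r_def by (metis divide_eq_0_iff less_irrefl zero_less_power2)
  ultimately have "(1 + \<bar>r\<bar>) * (1 + K) \<le> K" using \<open>t * r \<le> K * t\<^sup>2\<close>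
    by (metis mult.commute mult_le_cancel_left_pos)
  moreover have "(1 + \<bar>r\<bar>) * (1 + K) \<ge> 1 + K" using K(1) by (simp add: algebra_simps)
  ultimately show False by simp
qed

section \<open>One-symmetric bases and Hilbert sums\<close>

lemma nrm_ell2: "nrm (ell2 n) v = L2_set (\<lambda>i. norm (v i)) {..<n}"
  and carr_ell2: "v \<in> carr (ell2 n) \<longleftrightarrow> (\<forall>i\<ge>n. v i = 0)"
  and scal_ell2: "scal (ell2 n) c v = (\<lambda>i. c * v i)"
  by (auto simp: ell2_def)

lemma normed_space_ell2: "normed_space (ell2 n :: ('k::real_or_complex, nat \<Rightarrow> 'k) nspace)"
proof -
  have "linear_space (ell2 n :: ('k, nat \<Rightarrow> 'k) nspace)"
    by (auto simp: linear_space_def carr_ell2 scal_ell2 fun_eq_iff algebra_simps)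
  moreover have "L2_set (\<lambda>i. norm (x i)) {..<n} = 0 \<longleftrightarrow> x = 0" if "\<forall>i\<ge>n. x i = 0" for x :: "nat \<Rightarrow> 'k"
  proof -
    have "x = 0 \<longleftrightarrow> (\<forall>i<n. x i = 0)" using that by (metis ext not_le zero_fun_apply)
    then show ?thesis by (simp add: L2_set_eq_0_iff Ball_def)
  qed
  moreover have "L2_set (\<lambda>i. norm (c * x i)) {..<n} = norm c * L2_set (\<lambda>i. norm (x i)) {..<n}" for c and x :: "nat \<Rightarrow> 'k"
    by (simp add: norm_mult L2_set_right_distrib)
  moreover have "L2_set (\<lambda>i. norm (x i + y i)) {..<n} \<le> L2_set (\<lambda>i. norm (x i)) {..<n} + L2_set (\<lambda>i. norm (y i)) {..<n}" for x y :: "nat \<Rightarrow> 'k"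
    by (rule order_trans[OF L2_set_mono L2_set_triangle_ineq]) (auto intro: norm_triangle_ineq)
  ultimately show ?thesis
    by (auto simp: normed_space_def norm_on_def carr_ell2 scal_ell2 nrm_ell2 L2_set_nonneg)
qed

lemma inj_on_finite_extends_to_bij:
  fixes f :: "'a \<Rightarrow> 'a"
  assumes "finite A" "inj_on f A"
  obtains \<pi> where "bij \<pi>" "\<And>x. x \<in> A \<Longrightarrow> \<pi> x = f x"
proof -
  let ?B = "A \<union> f ` A"
  have "card (?B - A) = card (?B - f ` A)"
    using assms by (simp add: card_Diff_subset card_image)
  then obtain g where g: "bij_betw g (?B - A) (?B - f ` A)"
    using assms(1) by (meson bij_betw_iff_card finite_Diff finite_UnI finite_imageI)
  let ?h = "\<lambda>x. if x \<in> A then f x else g x"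
  have "bij_betw (\<lambda>x. if x \<in> A then f x else g x) (A \<union> (?B - A)) (f ` A \<union> (?B - f ` A))"
    by (rule bij_betw_disjoint_Un) (use assms g in \<open>auto simp: bij_betw_def\<close>)
  moreover have "A \<union> (?B - A) = ?B" "f ` A \<union> (?B - f ` A) = ?B" by auto
  ultimately have "bij_betw ?h ?B ?B" by simp
  then have "bij_betw (\<lambda>x. if x \<in> ?B then ?h x else x) (?B \<union> - ?B) (?B \<union> - ?B)"
    by (rule bij_betw_disjoint_Un) (auto simp: bij_betw_def inj_on_def)
  then have "bij (\<lambda>x. if x \<in> ?B then ?h x else x)" by (simp only: Compl_partition)
  then show ?thesis using that[of "\<lambda>x. if x \<in> ?B then ?h x else x"] by auto
qed

locale symmetric_basis = banach_space_over smul
  for smul :: "'k::real_or_complex \<Rightarrow> 'x::banach \<Rightarrow> 'x" +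
  fixes e :: "nat \<Rightarrow> 'x"
  assumes one_symmetric: "one_symmetric_basis smul e"
begin

lemma basis: "schauder_basis smul e"
  and norm_e: "norm (e k) = 1"
  and unconditional: "(\<And>k. norm (\<theta> k) = 1) \<Longrightarrow>
        norm (\<Sum>k<N. smul (\<theta> k * a k) (e k)) = norm (\<Sum>k<N. smul (a k) (e k))"
  and permute: "bij \<pi> \<Longrightarrow> norm (\<Sum>k<N. smul (a k) (e (\<pi> k))) = norm (\<Sum>k<N. smul (a k) (e k))"
  using one_symmetric
  by (auto simp: one_symmetric_basis_def normalized_def one_unconditional_def isometrically_equivalent_def)

section \<open>Monotonicity and rearrangement for sums over the basis\<close>

lemma flip_coordinate:
  "norm (\<Sum>k<N. (if k = j then - b k else b k) *\<^sub>R e k) = norm (\<Sum>k<N. b k *\<^sub>R e k)"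
  using unconditional[of "\<lambda>k. if k = j then -1 else 1" "\<lambda>k. of_real (b k)" N]
  by (simp add: smul_of_real[symmetric] if_distrib[of "\<lambda>r. r * _"] if_distrib[of of_real] cong: if_cong)

text \<open>Multiplying one coefficient by \<open>s\<close> is a convex combination of keeping it
  and flipping its sign, with weights \<open>(1 + s)/2\<close> and \<open>(1 - s)/2\<close>; both
  vectors have the same norm.\<close>

lemma shrink_coordinate:
  assumes "\<bar>s\<bar> \<le> 1"
  shows "norm (\<Sum>k<N. (if k = j then s * b k else b k) *\<^sub>R e k) \<le> norm (\<Sum>k<N. b k *\<^sub>R e k)"
proof -
  have "(\<Sum>k<N. (if k = j then s * b k else b k) *\<^sub>R e k) =
     (\<Sum>k<N. ((1 + s)/2) *\<^sub>R (b k *\<^sub>R e k) + ((1 - s)/2) *\<^sub>R ((if k = j then - b k else b k) *\<^sub>R e k))"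
  proof (rule sum.cong[OF refl])
    fix k
    have "(if k = j then s * b k else b k) = (1 + s)/2 * b k + (1 - s)/2 * (if k = j then - b k else b k)"
      by (simp add: field_simps)
    then show "(if k = j then s * b k else b k) *\<^sub>R e k = ((1 + s)/2) *\<^sub>R (b k *\<^sub>R e k) + ((1 - s)/2) *\<^sub>R ((if k = j then - b k else b k) *\<^sub>R e k)"
      by (simp only: scaleR_scaleR scaleR_left_distrib)
  qed
  also have "\<dots> = ((1 + s)/2) *\<^sub>R (\<Sum>k<N. b k *\<^sub>R e k) + ((1 - s)/2) *\<^sub>R (\<Sum>k<N. (if k = j then - b k else b k) *\<^sub>R e k)"
    by (simp only: sum.distrib scaleR_sum_right)
  also have "norm \<dots> \<le> \<bar>(1 + s)/2\<bar> * norm (\<Sum>k<N. b k *\<^sub>R e k) + \<bar>(1 - s)/2\<bar> * norm (\<Sum>k<N. (if k = j then - b k else b k) *\<^sub>R e k)"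
    by (rule order_trans[OF norm_triangle_ineq]) simp
  also have "\<dots> = (\<bar>(1 + s)/2\<bar> + \<bar>(1 - s)/2\<bar>) * norm (\<Sum>k<N. b k *\<^sub>R e k)"
    by (simp only: flip_coordinate distrib_right)
  also have "\<bar>(1 + s)/2\<bar> + \<bar>(1 - s)/2\<bar> = 1" using assms by (simp add: field_simps)
  finally show ?thesis by simp
qed

text \<open>The coefficients \<open>b k\<close> are replaced by \<open>a k\<close> one at a time,
  each replacement being a multiplication by a factor in \<open>[-1, 1]\<close>.\<close>

lemma norm_sum_mono_lessThan:
  assumes "\<And>k. k < N \<Longrightarrow> \<bar>a k\<bar> \<le> \<bar>b k\<bar>"
  shows "norm (\<Sum>k<N. a k *\<^sub>R e k) \<le> norm (\<Sum>k<N. b k *\<^sub>R e k)"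
proof -
  have "norm (\<Sum>k<N. (if k < j then a k else b k) *\<^sub>R e k) \<le> norm (\<Sum>k<N. b k *\<^sub>R e k)" if "j \<le> N" for j
    using that
  proof (induction j)
    case (Suc j)
    let ?b = "\<lambda>k. if k < j then a k else b k"
    \<comment> \<open>When \<open>b j = 0\<close> the hypothesis makes \<open>a j = 0\<close> too,
      so the default value keeps \<open>a j = s * b j\<close> true.\<close>
    define s where "s = (if b j = 0 then 0 else a j / b j)"
    have s: "\<bar>s\<bar> \<le> 1" "a j = s * b j" using assms[of j] Suc.prems by (auto simp: s_def divide_le_eq)
    have "(\<lambda>k. if k < Suc j then a k else b k) = (\<lambda>k. if k = j then s * ?b k else ?b k)"
      using s by (auto simp: fun_eq_iff less_Suc_eq)
    then have "norm (\<Sum>k<N. (if k < Suc j then a k else b k) *\<^sub>R e k) = norm (\<Sum>k<N. (if k = j then s * ?b k else ?b k) *\<^sub>R e k)"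
      by metis
    also have "\<dots> \<le> norm (\<Sum>k<N. ?b k *\<^sub>R e k)" by (rule shrink_coordinate[OF s(1)])
    finally show ?case using Suc by simp
  qed simp
  from this[of N] show ?thesis by simp
qed

lemma norm_sum_mono:
  assumes "finite B" "A \<subseteq> B" "\<And>k. k \<in> A \<Longrightarrow> \<bar>a k\<bar> \<le> \<bar>b k\<bar>"
  shows "norm (\<Sum>k\<in>A. a k *\<^sub>R e k) \<le> norm (\<Sum>k\<in>B. b k *\<^sub>R e k)"
proof -
  obtain N where N: "B \<subseteq> {..<N}" using assms(1) finite_nat_bounded by blast
  have "(\<Sum>k\<in>A. a k *\<^sub>R e k) = (\<Sum>k<N. (if k \<in> A then a k else 0) *\<^sub>R e k)"
    using N assms(2) by (intro sum.mono_neutral_cong_left) auto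
  moreover have "(\<Sum>k\<in>B. b k *\<^sub>R e k) = (\<Sum>k<N. (if k \<in> B then b k else 0) *\<^sub>R e k)"
    using N by (intro sum.mono_neutral_cong_left) auto
  moreover have "norm (\<Sum>k<N. (if k \<in> A then a k else 0) *\<^sub>R e k) \<le> norm (\<Sum>k<N. (if k \<in> B then b k else 0) *\<^sub>R e k)"
    using assms by (intro norm_sum_mono_lessThan) auto
  ultimately show ?thesis by simp
qed

text \<open>Unimodular multipliers turn every coefficient into its modulus. From here on norms of
  sums can be estimated with nonnegative real coefficients.\<close>

lemma norm_sum_smul:
  assumes "finite A"
  shows "norm (\<Sum>k\<in>A. smul (c k) (e k)) = norm (\<Sum>k\<in>A. norm (c k) *\<^sub>R e k)"
proof -
  obtain N where N: "A \<subseteq> {..<N}" using assms finite_nat_bounded by blast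
  let ?c = "\<lambda>k. if k \<in> A then c k else 0"
  \<comment> \<open>The value 1 at vanishing coefficients keeps every multiplier unimodular.\<close>
  define \<theta> where "\<theta> k = (if ?c k = 0 then 1 else of_real (norm (?c k)) / ?c k)" for k
  have "norm (\<theta> k) = 1" for k by (simp add: \<theta>_def norm_divide)
  then have "norm (\<Sum>k<N. smul (\<theta> k * ?c k) (e k)) = norm (\<Sum>k<N. smul (?c k) (e k))"
    by (rule unconditional)
  moreover have "\<theta> k * ?c k = of_real (norm (?c k))" for k by (simp add: \<theta>_def)
  moreover have "(\<Sum>k\<in>A. smul (c k) (e k)) = (\<Sum>k<N. smul (?c k) (e k))"
    using N by (intro sum.mono_neutral_cong_left) auto
  moreover have "(\<Sum>k\<in>A. norm (c k) *\<^sub>R e k) = (\<Sum>k<N. norm (?c k) *\<^sub>R e k)"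
    using N by (intro sum.mono_neutral_cong_left) auto
  ultimately show ?thesis by (simp only: smul_of_real)
qed

lemma norm_sum_inj:
  assumes "finite A" "inj_on f A"
  shows "norm (\<Sum>k\<in>A. a k *\<^sub>R e (f k)) = norm (\<Sum>k\<in>A. a k *\<^sub>R e k)"
proof -
  obtain N where N: "A \<subseteq> {..<N}" using assms finite_nat_bounded by blast
  obtain \<pi> where \<pi>: "bij \<pi>" "\<And>x. x \<in> A \<Longrightarrow> \<pi> x = f x" using inj_on_finite_extends_to_bij[OF assms] by blast
  let ?a = "\<lambda>k. if k \<in> A then a k else 0"
  have "(\<Sum>k\<in>A. a k *\<^sub>R e (f k)) = (\<Sum>k<N. ?a k *\<^sub>R e (\<pi> k))"
    using N \<pi>(2) by (intro sum.mono_neutral_cong_left) auto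
  moreover have "(\<Sum>k\<in>A. a k *\<^sub>R e k) = (\<Sum>k<N. ?a k *\<^sub>R e k)"
    using N by (intro sum.mono_neutral_cong_left) auto
  moreover have "norm (\<Sum>k<N. ?a k *\<^sub>R e (\<pi> k)) = norm (\<Sum>k<N. ?a k *\<^sub>R e k)"
    using permute[OF \<pi>(1), of "\<lambda>k. of_real (?a k)" N] by (simp only: smul_of_real)
  ultimately show ?thesis by simp
qed

text \<open>Monotonicity applied to the stretches \<open>{m..<n}\<close> transfers the Cauchy
  criterion.\<close>

lemma summable_dominated:
  assumes "summable (\<lambda>k. b k *\<^sub>R e k)" "\<And>k. \<bar>a k\<bar> \<le> \<bar>b k\<bar>"
  shows "summable (\<lambda>k. a k *\<^sub>R e k)"
proof -
  have "norm (\<Sum>k=m..<n. a k *\<^sub>R e k) \<le> norm (\<Sum>k=m..<n. b k *\<^sub>R e k)" for m n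
    using assms(2) by (intro norm_sum_mono) auto
  then show ?thesis using assms(1) unfolding summable_Cauchy by (meson le_less_trans)
qed

lemma summable_smul_iff: "summable (\<lambda>k. smul (c k) (e k)) \<longleftrightarrow> summable (\<lambda>k. norm (c k) *\<^sub>R e k)"
  by (simp add: summable_Cauchy norm_sum_smul)

lemma norm_partial_sums_tendsto:
  assumes "summable (\<lambda>k. b k *\<^sub>R e k)"
  shows "(\<lambda>N. norm (\<Sum>k<N. b k *\<^sub>R e k)) \<longlonglongrightarrow> norm (\<Sum>k. b k *\<^sub>R e k)"
  using assms by (intro tendsto_norm summable_LIMSEQ)

lemma norm_suminf_smul:
  assumes "summable (\<lambda>k. smul (c k) (e k))"
  shows "norm (\<Sum>k. smul (c k) (e k)) = norm (\<Sum>k. norm (c k) *\<^sub>R e k)"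
proof (rule LIMSEQ_unique)
  show "(\<lambda>N. norm (\<Sum>k<N. smul (c k) (e k))) \<longlonglongrightarrow> norm (\<Sum>k. smul (c k) (e k))"
    using assms by (intro tendsto_norm summable_LIMSEQ)
  show "(\<lambda>N. norm (\<Sum>k<N. smul (c k) (e k))) \<longlonglongrightarrow> norm (\<Sum>k. norm (c k) *\<^sub>R e k)"
    using norm_partial_sums_tendsto[of "\<lambda>k. norm (c k)"] assms by (simp add: summable_smul_iff norm_sum_smul)
qed

lemma norm_sum_le_suminf:
  assumes "summable (\<lambda>k. b k *\<^sub>R e k)" "finite A" "\<And>k. k \<in> A \<Longrightarrow> \<bar>a k\<bar> \<le> \<bar>b k\<bar>"
  shows "norm (\<Sum>k\<in>A. a k *\<^sub>R e k) \<le> norm (\<Sum>k. b k *\<^sub>R e k)"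
proof -
  obtain N where N: "A \<subseteq> {..<N}" using assms finite_nat_bounded by blast
  show ?thesis
  proof (rule LIMSEQ_le_const[OF norm_partial_sums_tendsto[OF assms(1)]], intro exI allI impI)
    fix M assume "N \<le> M"
    then have "A \<subseteq> {..<M}" using N by auto
    then show "norm (\<Sum>k\<in>A. a k *\<^sub>R e k) \<le> norm (\<Sum>k<M. b k *\<^sub>R e k)"
      using assms(3) by (intro norm_sum_mono) auto
  qed
qed

lemma norm_suminf_mono:
  assumes "summable (\<lambda>k. b k *\<^sub>R e k)" "\<And>k. \<bar>a k\<bar> \<le> \<bar>b k\<bar>"
  shows "norm (\<Sum>k. a k *\<^sub>R e k) \<le> norm (\<Sum>k. b k *\<^sub>R e k)"
  by (rule LIMSEQ_le_const2[OF norm_partial_sums_tendsto[OF summable_dominated[OF assms]]])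
     (use assms in \<open>auto intro: norm_sum_le_suminf\<close>)

lemma coordinate_le_norm_suminf:
  assumes "summable (\<lambda>k. b k *\<^sub>R e k)"
  shows "\<bar>b k\<bar> \<le> norm (\<Sum>k. b k *\<^sub>R e k)"
  using norm_sum_le_suminf[OF assms, of "{k}" b] by (simp add: norm_e)

text \<open>Only two terms change, and every initial segment reaching beyond both indices is merely
  permuted; the norms of the partial sums are therefore eventually equal.\<close>

lemma summable_transpose:
  assumes "summable (\<lambda>k. b k *\<^sub>R e k)"
  shows "summable (\<lambda>k. b (Transposition.transpose i j k) *\<^sub>R e k)"
    and "norm (\<Sum>k. b (Transposition.transpose i j k) *\<^sub>R e k) = norm (\<Sum>k. b k *\<^sub>R e k)"
proof -
  let ?t = "Transposition.transpose i j"
  have "eventually (\<lambda>k. b (?t k) *\<^sub>R e k = b k *\<^sub>R e k) sequentially"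
    by (rule eventually_sequentiallyI[of "Suc (max i j)"]) (auto simp: Transposition.transpose_def)
  from summable_cong[OF this] show *: "summable (\<lambda>k. b (?t k) *\<^sub>R e k)" using assms by simp
  have "norm (\<Sum>k<N. b (?t k) *\<^sub>R e k) = norm (\<Sum>k<N. b k *\<^sub>R e k)" if "N \<ge> Suc (max i j)" for N
  proof -
    have b: "bij_betw ?t {..<N} {..<N}" using that
      by (intro bij_betwI[of _ _ _ ?t]) (auto simp: Transposition.transpose_def)
    have "(\<Sum>k<N. b (?t k) *\<^sub>R e k) = (\<Sum>k<N. b (?t (?t k)) *\<^sub>R e (?t k))"
      by (rule sum.reindex_bij_betw[OF b, symmetric])
    then show ?thesis using norm_sum_inj[of "{..<N}" ?t b] b by (simp add: bij_betw_def)
  qed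
  then have "eventually (\<lambda>N. norm (\<Sum>k<N. b (?t k) *\<^sub>R e k) = norm (\<Sum>k<N. b k *\<^sub>R e k)) sequentially"
    by (rule eventually_sequentiallyI)
  then have "(\<lambda>N. norm (\<Sum>k<N. b k *\<^sub>R e k)) \<longlonglongrightarrow> norm (\<Sum>k. b (?t k) *\<^sub>R e k)"
    using norm_partial_sums_tendsto[OF *] by (rule Lim_transform_eventually[rotated])
  then show "norm (\<Sum>k. b (?t k) *\<^sub>R e k) = norm (\<Sum>k. b k *\<^sub>R e k)"
    using norm_partial_sums_tendsto[OF assms] LIMSEQ_unique by blast
qed

section \<open>Hilbert sums and their evident isometries\<close>

lemma nrm_hilbert_sum: "nrm (hilbert_sum e H) z = norm (\<Sum>k. nrm (H k) (z k) *\<^sub>R e k)"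
  and carr_hilbert_sum: "z \<in> carr (hilbert_sum e H) \<longleftrightarrow> (\<forall>k. z k \<in> carr (H k)) \<and> summable (\<lambda>k. nrm (H k) (z k) *\<^sub>R e k)"
  and scal_hilbert_sum: "scal (hilbert_sum e H) c z = (\<lambda>k. scal (H k) c (z k))"
  by (auto simp: hilbert_sum_def)

lemma nrm_component_le:
  assumes "z \<in> carr (hilbert_sum e H)" "\<And>k. normed_space (H k)"
  shows "nrm (H k) (z k) \<le> nrm (hilbert_sum e H) z"
  using coordinate_le_norm_suminf[of "\<lambda>k. nrm (H k) (z k)" k] assms
  by (auto simp: carr_hilbert_sum nrm_hilbert_sum nrm_nonneg)

text \<open>The triangle inequality holds blockwise for the coefficients, and monotonicity of the
  basis norm lifts it; this is where unconditionality enters the definition of the space.\<close>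

lemma normed_space_hilbert_sum:
  fixes H :: "nat \<Rightarrow> ('k, 'h::ab_group_add) nspace"
  assumes H: "\<And>k. normed_space (H k)"
  shows "normed_space (hilbert_sum e H)"
proof -
  note L = normed_space_linear[OF H]
  let ?V = "hilbert_sum e H"
  have add: "summable (\<lambda>k. nrm (H k) (x k + y k) *\<^sub>R e k)"
      "norm (\<Sum>k. nrm (H k) (x k + y k) *\<^sub>R e k) \<le> nrm ?V x + nrm ?V y" if x: "x \<in> carr ?V" and y: "y \<in> carr ?V" for x y
  proof -
    have le: "\<bar>nrm (H k) (x k + y k)\<bar> \<le> \<bar>nrm (H k) (x k) + nrm (H k) (y k)\<bar>" for k
      using x y nrm_add[OF H, of "x k" k "y k"] nrm_nonneg[OF H, of "x k + y k" k] linear_space_add[OF L, of "x k" k "y k"]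
      by (auto simp: carr_hilbert_sum)
    have s: "summable (\<lambda>k. (nrm (H k) (x k) + nrm (H k) (y k)) *\<^sub>R e k)"
      using x y by (simp add: carr_hilbert_sum scaleR_left_distrib summable_add)
    show "summable (\<lambda>k. nrm (H k) (x k + y k) *\<^sub>R e k)" by (rule summable_dominated[OF s le])
    have "norm (\<Sum>k. nrm (H k) (x k + y k) *\<^sub>R e k) \<le> norm (\<Sum>k. (nrm (H k) (x k) + nrm (H k) (y k)) *\<^sub>R e k)"
      by (rule norm_suminf_mono[OF s le])
    also have "(\<Sum>k. (nrm (H k) (x k) + nrm (H k) (y k)) *\<^sub>R e k) = (\<Sum>k. nrm (H k) (x k) *\<^sub>R e k) + (\<Sum>k. nrm (H k) (y k) *\<^sub>R e k)"
      using x y by (simp add: carr_hilbert_sum scaleR_left_distrib suminf_add)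
    finally show "norm (\<Sum>k. nrm (H k) (x k + y k) *\<^sub>R e k) \<le> nrm ?V x + nrm ?V y"
      using norm_triangle_ineq order_trans by (fastforce simp: nrm_hilbert_sum)
  qed
  have sc: "(\<lambda>k. nrm (H k) (scal (H k) c (x k)) *\<^sub>R e k) = (\<lambda>k. norm c *\<^sub>R (nrm (H k) (x k) *\<^sub>R e k))" if "x \<in> carr ?V" for c x
    using that by (simp add: carr_hilbert_sum nrm_scal[OF H])
  have sc': "summable (\<lambda>k. nrm (H k) (scal (H k) c (x k)) *\<^sub>R e k)" if "x \<in> carr ?V" for c x
    unfolding sc[OF that] using that by (intro summable_scaleR_right) (simp add: carr_hilbert_sum)
  have lin: "linear_space ?V"
    unfolding linear_space_def
    using add(1) sc' by (auto simp: carr_hilbert_sum scal_hilbert_sum fun_eq_iff linear_space_zero[OF L] linear_space_add[OF L]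
       linear_space_scal[OF L] scal_add_right[OF L] scal_add_left[OF L] scal_scal[OF L] scal_one[OF L] nrm_zero[OF H])
  have "nrm ?V x = 0 \<longleftrightarrow> x = 0" if x: "x \<in> carr ?V" for x
  proof
    assume z: "nrm ?V x = 0"
    have "nrm (H k) (x k) = 0" for k
      using nrm_component_le[OF x H, of k] nrm_nonneg[OF H, of "x k" k] x z by (auto simp: carr_hilbert_sum)
    then show "x = 0" using x nrm_eq_zero[OF H] by (auto simp: carr_hilbert_sum fun_eq_iff)
  next
    show "x = 0 \<Longrightarrow> nrm ?V x = 0" by (simp add: nrm_hilbert_sum nrm_zero[OF H])
  qed
  moreover have "nrm ?V (scal ?V c x) = norm c * nrm ?V x" if x: "x \<in> carr ?V" for c x
    using x unfolding nrm_hilbert_sum scal_hilbert_sum sc[OF x]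
    by (subst suminf_scaleR_right[symmetric]) (auto simp: carr_hilbert_sum)
  moreover have "nrm ?V (x + y) \<le> nrm ?V x + nrm ?V y" if "x \<in> carr ?V" "y \<in> carr ?V" for x y
    using add(2)[OF that] by (simp add: nrm_hilbert_sum)
  ultimately show ?thesis using lin by (auto simp: normed_space_def norm_on_def nrm_hilbert_sum)
qed

text \<open>The sequence of block norms is unchanged. This serves both to replace the abstract
  blocks by \<open>ell2 n\<close> and to produce isometries of the resulting model.\<close>

lemma surjective_isometry_hilbert_sum:
  fixes H :: "nat \<Rightarrow> ('k, 'h::ab_group_add) nspace" and H' :: "nat \<Rightarrow> ('k, 'g::ab_group_add) nspace"
  assumes T: "\<And>k. surjective_isometry (H k) (H' k) (\<tau> k)"
  shows "surjective_isometry (hilbert_sum e H) (hilbert_sum e H') (\<lambda>z k. \<tau> k (z k))"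
proof -
  have l: "linear_map (H k) (H' k) (\<tau> k)" for k using T by (auto simp: surjective_isometry_def)
  have n: "nrm (H' k) (\<tau> k x) = nrm (H k) x" if "x \<in> carr (H k)" for k x
    using T that by (auto simp: surjective_isometry_def)
  have lin: "linear_map (hilbert_sum e H) (hilbert_sum e H') (\<lambda>z k. \<tau> k (z k))"
    by (auto simp: linear_map_def carr_hilbert_sum scal_hilbert_sum linear_map_carr[OF l] linear_map_add[OF l] linear_map_scal[OF l] n fun_eq_iff)
  have "\<exists>z\<in>carr (hilbert_sum e H). w = (\<lambda>k. \<tau> k (z k))" if w: "w \<in> carr (hilbert_sum e H')" for w
  proof -
    have "\<forall>k. \<exists>x. x \<in> carr (H k) \<and> \<tau> k x = w k"
      using w T by (auto simp: carr_hilbert_sum surjective_isometry_def) (metis imageE)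
    then obtain z where z: "\<And>k. z k \<in> carr (H k) \<and> \<tau> k (z k) = w k" by metis
    then have "nrm (H k) (z k) = nrm (H' k) (w k)" for k using n by metis
    then have "z \<in> carr (hilbert_sum e H)" using w z by (auto simp: carr_hilbert_sum)
    moreover have "w = (\<lambda>k. \<tau> k (z k))" using z by (simp add: fun_eq_iff)
    ultimately show ?thesis by blast
  qed
  moreover have "nrm (hilbert_sum e H') (\<lambda>k. \<tau> k (z k)) = nrm (hilbert_sum e H) z" if "z \<in> carr (hilbert_sum e H)" for z
    using that by (auto simp: carr_hilbert_sum nrm_hilbert_sum n)
  ultimately show ?thesis using lin unfolding surjective_isometry_def by (auto simp: linear_map_def)
qed

lemma surjective_isometry_transpose:
  fixes H :: "('k, 'h::ab_group_add) nspace"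
  shows "surjective_isometry (hilbert_sum e (\<lambda>_. H)) (hilbert_sum e (\<lambda>_. H)) (\<lambda>z. z \<circ> Transposition.transpose i j)"
proof -
  let ?V = "hilbert_sum e (\<lambda>_. H)" and ?t = "Transposition.transpose i j"
  have c: "z \<circ> ?t \<in> carr ?V" "nrm ?V (z \<circ> ?t) = nrm ?V z" if "z \<in> carr ?V" for z
    using that summable_transpose[of "\<lambda>k. nrm H (z k)" i j] by (auto simp: carr_hilbert_sum nrm_hilbert_sum)
  have "z \<in> (\<lambda>z. z \<circ> ?t) ` carr ?V" if "z \<in> carr ?V" for z
    by (rule image_eqI[of _ _ "z \<circ> ?t"]) (use c[OF that] in \<open>auto simp: fun_eq_iff\<close>)
  then show ?thesis using c unfolding surjective_isometry_def linear_map_def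
    by (auto simp: scal_hilbert_sum fun_eq_iff)
qed

end

section \<open>Skew maps on sums of Euclidean blocks\<close>

definition single :: "nat \<times> nat \<Rightarrow> 'a::zero \<Rightarrow> nat \<Rightarrow> nat \<Rightarrow> 'a" where
  "single a c = (\<lambda>k m. if (k, m) = a then c else 0)"

definition entry :: "(nat \<Rightarrow> nat \<Rightarrow> 'a) \<Rightarrow> nat \<times> nat \<Rightarrow> 'a" where
  "entry z a = z (fst a) (snd a)"

definition cut :: "nat set \<Rightarrow> (nat \<Rightarrow> 'v::zero) \<Rightarrow> nat \<Rightarrow> 'v" where
  "cut F z = (\<lambda>k. if k \<in> F then z k else 0)"

text \<open>The derivative at angle 0 of the rotations in the plane of the positions
  \<open>a\<close> and \<open>b\<close>: it sends the unit vector at \<open>a\<close> to the one at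
  \<open>b\<close>, and the one at \<open>b\<close> to minus the one at \<open>a\<close>.\<close>

definition rotation_generator :: "nat \<times> nat \<Rightarrow> nat \<times> nat \<Rightarrow> (nat \<Rightarrow> nat \<Rightarrow> 'a::ab_group_add) \<Rightarrow> nat \<Rightarrow> nat \<Rightarrow> 'a" where
  "rotation_generator a b z = single b (entry z a) - single a (entry z b)"

text \<open>The operator with only two matrix entries, \<open>\<alpha>\<close> leading from
  \<open>a\<close> to \<open>b\<close> and \<open>\<beta>\<close> leading back. It is what survives
  of a skew map after the sign changes.\<close>

definition plane_map :: "nat \<times> nat \<Rightarrow> nat \<times> nat \<Rightarrow> 'a::comm_ring_1 \<Rightarrow> 'a \<Rightarrow> (nat \<Rightarrow> nat \<Rightarrow> 'a) \<Rightarrow> nat \<Rightarrow> nat \<Rightarrow> 'a" where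
  "plane_map a b \<alpha> \<beta> z = single b (\<alpha> * entry z a) + single a (\<beta> * entry z b)"

lemma rotation_generator_eq: "rotation_generator a b = plane_map a b 1 (-1)"
  by (auto simp: rotation_generator_def plane_map_def single_def fun_eq_iff)

lemma entry_add: "entry (x + y) a = entry x a + entry y a"
  and entry_diff: "entry (x - y) a = entry x a - entry y a"
  for x y :: "nat \<Rightarrow> nat \<Rightarrow> 'a::ab_group_add"
  by (simp_all add: entry_def)

lemma entry_single: "entry (single a c) b = (if a = b then c else 0)"
  by (auto simp: entry_def single_def)

lemma sum_apply2: "(\<Sum>i\<in>I. f i) k m = (\<Sum>i\<in>I. f i k m)"
  for f :: "'i \<Rightarrow> nat \<Rightarrow> nat \<Rightarrow> 'a::ab_group_add"
  by (induction I rule: infinite_finite_induct) auto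

lemma surjective_isometryI:
  assumes "linear_map V W T" "\<And>x. x \<in> carr V \<Longrightarrow> nrm W (T x) = nrm V x"
    and "\<And>y. y \<in> carr W \<Longrightarrow> S y \<in> carr V" "\<And>y. y \<in> carr W \<Longrightarrow> T (S y) = y"
  shows "surjective_isometry V W T"
  unfolding surjective_isometry_def
proof (intro conjI ballI assms(1,2))
  show "T ` carr V = carr W"
  proof
    show "T ` carr V \<subseteq> carr W" using linear_map_carr[OF assms(1)] by auto
    show "carr W \<subseteq> T ` carr V"
    proof
      fix y assume "y \<in> carr W"
      then show "y \<in> T ` carr V" using assms(3,4)[of y] by (intro image_eqI[of _ _ "S y"]) auto
    qed
  qed
qed

section \<open>Isometries of a single Euclidean block\<close>

lemma ell2_phases:
  fixes \<theta> :: "nat \<Rightarrow> 'k::real_or_complex"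
  assumes "\<And>m. norm (\<theta> m) = 1"
  shows "surjective_isometry (ell2 n) (ell2 n) (\<lambda>v m. \<theta> m * v m)"
proof (rule surjective_isometryI[where S = "\<lambda>v m. v m / \<theta> m"])
  have "\<theta> m \<noteq> 0" for m using assms[of m] by auto
  then show "(\<lambda>m. \<theta> m * (y m / \<theta> m)) = y" for y by simp
qed (auto simp: linear_map_def carr_ell2 scal_ell2 nrm_ell2 norm_mult assms algebra_simps fun_eq_iff)

lemma ell2_transpose:
  assumes "l < n" "l' < n"
  shows "surjective_isometry (ell2 n) (ell2 n :: ('k::real_or_complex, nat \<Rightarrow> 'k) nspace) (\<lambda>v. v \<circ> Transposition.transpose l l')"
proof (rule surjective_isometryI[where S = "\<lambda>v. v \<circ> Transposition.transpose l l'"])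
  have fix_ge: "Transposition.transpose l l' m = m" if "m \<ge> n" for m
    using that assms by (intro transpose_apply_other) auto
  then show "linear_map (ell2 n) (ell2 n :: ('k, nat \<Rightarrow> 'k) nspace) (\<lambda>v. v \<circ> Transposition.transpose l l')"
    by (simp add: linear_map_def Pi_iff carr_ell2 scal_ell2 fun_eq_iff)
  show "y \<circ> Transposition.transpose l l' \<in> carr (ell2 n)" if "y \<in> carr (ell2 n)" for y :: "nat \<Rightarrow> 'k"
    using that fix_ge by (simp add: carr_ell2)
  let ?t = "Transposition.transpose l l'"
  have b: "bij_betw ?t {..<n} {..<n}"
    using assms by (intro bij_betwI[of _ _ _ ?t]) (auto simp: Transposition.transpose_def)
  show "nrm (ell2 n) (x \<circ> ?t) = nrm (ell2 n) x" for x :: "nat \<Rightarrow> 'k"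
    unfolding nrm_ell2 L2_set_def comp_apply
    using sum.reindex_bij_betw[OF b, of "\<lambda>m. (norm (x m))\<^sup>2"] by simp
qed (simp add: fun_eq_iff)

text \<open>Since \<open>c\<close> and \<open>s\<close> are real, the rotation acts separately on
  the real and the imaginary parts.\<close>

lemma norm_rotation:
  fixes x y :: "'k::real_or_complex"
  assumes "c\<^sup>2 + s\<^sup>2 = 1"
  shows "(norm (of_real c * x - of_real s * y))\<^sup>2 + (norm (of_real s * x + of_real c * y))\<^sup>2 = (norm x)\<^sup>2 + (norm y)\<^sup>2"
proof -
  obtain x1 x2 where x: "to_complex x = Complex x1 x2" by (cases "to_complex x")
  obtain y1 y2 where y: "to_complex y = Complex y1 y2" by (cases "to_complex y")
  have c: "complex_of_real r * Complex u v = Complex (r * u) (r * v)" for r u v by (simp add: complex_eq_iff)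
  have "(c * x1 - s * y1)\<^sup>2 + (s * x1 + c * y1)\<^sup>2 = (c\<^sup>2 + s\<^sup>2) * (x1\<^sup>2 + y1\<^sup>2)"
    "(c * x2 - s * y2)\<^sup>2 + (s * x2 + c * y2)\<^sup>2 = (c\<^sup>2 + s\<^sup>2) * (x2\<^sup>2 + y2\<^sup>2)"
    by (simp_all add: power2_eq_square algebra_simps)
  then show ?thesis
    unfolding norm_to_complex[where 'a = 'k, symmetric] to_complex_diff to_complex_add to_complex_mult to_complex_of_real x y c
    by (simp add: cmod_power2 assms)
qed

lemma ell2_rotation:
  assumes "l < n" "l' < n" "l \<noteq> l'" "c\<^sup>2 + s\<^sup>2 = 1"
  shows "surjective_isometry (ell2 n) (ell2 n :: ('k::real_or_complex, nat \<Rightarrow> 'k) nspace)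
    (\<lambda>v m. if m = l then of_real c * v l - of_real s * v l' else if m = l' then of_real s * v l + of_real c * v l' else v m)"
    (is "surjective_isometry _ _ (?R s)")
proof (rule surjective_isometryI[where S = "?R (- s)"])
  have split: "(\<Sum>m<n. f m) = f l + f l' + (\<Sum>m\<in>{..<n} - {l, l'}. f m)" for f :: "nat \<Rightarrow> real"
    using assms sum.subset_diff[of "{l, l'}" "{..<n}" f] by (simp add: add.commute)
  show "nrm (ell2 n) (?R s x) = nrm (ell2 n) x" for x
  proof -
    have "(\<Sum>m\<in>{..<n} - {l, l'}. (norm (?R s x m))\<^sup>2) = (\<Sum>m\<in>{..<n} - {l, l'}. (norm (x m))\<^sup>2)"
      by (rule sum.cong) auto
    moreover have "(norm (?R s x l))\<^sup>2 + (norm (?R s x l'))\<^sup>2 = (norm (x l))\<^sup>2 + (norm (x l'))\<^sup>2"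
      using norm_rotation[OF assms(4), of "x l" "x l'"] assms(3) by simp
    ultimately have "(\<Sum>m<n. (norm (?R s x m))\<^sup>2) = (\<Sum>m<n. (norm (x m))\<^sup>2)"
      using split[of "\<lambda>m. (norm (?R s x m))\<^sup>2"] split[of "\<lambda>m. (norm (x m))\<^sup>2"] by linarith
    then show ?thesis by (simp only: nrm_ell2 L2_set_def)
  qed
  have cs: "of_real c * (of_real c * x) + of_real s * (of_real s * x) = x" for x :: 'k
  proof -
    have "of_real c * of_real c + of_real s * of_real s = (1::'k)"
      using arg_cong[OF assms(4), of "of_real :: real \<Rightarrow> 'k"] by (simp add: power2_eq_square)
    then have "(of_real c * of_real c + of_real s * of_real s) * x = x" by simp
    then show ?thesis by (simp only: distrib_right mult.assoc)
  qed
  show "?R s (?R (- s) y) = y" for y using assms(3) by (auto simp: fun_eq_iff algebra_simps cs)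
qed (use assms in \<open>auto simp: linear_map_def carr_ell2 scal_ell2 fun_eq_iff algebra_simps\<close>)

context symmetric_basis
begin

text \<open>The concrete model of the sum: sums whose blocks are isometric to \<open>ell2 n\<close>
  are isometric to it, so the analysis is carried out here and transferred at the end.\<close>

abbreviation W :: "nat \<Rightarrow> ('k, nat \<Rightarrow> nat \<Rightarrow> 'k) nspace" where
  "W n \<equiv> hilbert_sum e (\<lambda>_. ell2 n)"

abbreviation blk :: "nat \<Rightarrow> (nat \<Rightarrow> 'k) \<Rightarrow> real" where
  "blk n v \<equiv> L2_set (\<lambda>m. norm (v m)) {..<n}"

lemma normed_space_W: "normed_space (W n)"
  by (rule normed_space_hilbert_sum) (rule normed_space_ell2)

lemmas linear_space_W = normed_space_linear[OF normed_space_W]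

lemma scal_W: "scal (W n) c z = (\<lambda>k m. c * z k m)"
  by (simp add: scal_hilbert_sum scal_ell2)

lemma nrm_W: "nrm (W n) z = norm (\<Sum>k. blk n (z k) *\<^sub>R e k)"
  by (simp add: nrm_hilbert_sum nrm_ell2)

lemma carr_W: "z \<in> carr (W n) \<longleftrightarrow> (\<forall>k. \<forall>m\<ge>n. z k m = 0) \<and> summable (\<lambda>k. blk n (z k) *\<^sub>R e k)"
  by (simp add: carr_hilbert_sum nrm_ell2 carr_ell2)

lemma entry_scal: "entry (scal (W n) c z) a = c * entry z a"
  by (simp add: entry_def scal_W)

lemma scal_single: "scal (W n) c (single a d) = single a (c * d)"
  by (auto simp: scal_W single_def fun_eq_iff)

lemma norm_entry_le:
  assumes "z \<in> carr (W n)"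
  shows "norm (entry z a) \<le> nrm (W n) z"
proof (cases "snd a < n")
  case True
  have "norm (z (fst a) (snd a)) \<le> blk n (z (fst a))"
    using True by (intro member_le_L2_set[of _ _ "\<lambda>m. norm (z (fst a) m)"]) auto
  also have "\<dots> \<le> nrm (W n) z" using nrm_component_le[OF assms normed_space_ell2, of "fst a"] by (simp add: nrm_ell2)
  finally show ?thesis by (simp add: entry_def)
next
  case False
  then show ?thesis using assms nrm_nonneg[OF normed_space_W assms] by (simp add: entry_def carr_W)
qed

lemma finite_support_carr:
  assumes "finite F" "\<And>k. k \<notin> F \<Longrightarrow> z k = 0" "\<And>k m. m \<ge> n \<Longrightarrow> z k m = 0"
  shows "z \<in> carr (W n)" "nrm (W n) z = norm (\<Sum>k\<in>F. blk n (z k) *\<^sub>R e k)"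
proof -
  have "(\<lambda>k. blk n (z k) *\<^sub>R e k) sums (\<Sum>k\<in>F. blk n (z k) *\<^sub>R e k)"
    using assms(1,2) by (intro sums_finite) (auto simp: L2_set_def)
  then show "z \<in> carr (W n)" "nrm (W n) z = norm (\<Sum>k\<in>F. blk n (z k) *\<^sub>R e k)"
    using assms(3) by (auto simp: carr_W nrm_W sums_iff)
qed

lemma single_carr: "snd a < n \<Longrightarrow> single a c \<in> carr (W n)"
  by (rule finite_support_carr(1)[of "{fst a}"]) (auto simp: single_def fun_eq_iff)

lemma cut_carr:
  assumes "z \<in> carr (W n)"
  shows "cut F z \<in> carr (W n)" "nrm (W n) (cut F z) \<le> nrm (W n) z"
proof -
  have s: "summable (\<lambda>k. blk n (z k) *\<^sub>R e k)" using assms by (simp add: carr_W)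
  have le: "\<bar>blk n (cut F z k)\<bar> \<le> \<bar>blk n (z k)\<bar>" for k by (auto simp: cut_def L2_set_def)
  show "cut F z \<in> carr (W n)" using summable_dominated[OF s le] assms by (auto simp: carr_W cut_def)
  show "nrm (W n) (cut F z) \<le> nrm (W n) z" using norm_suminf_mono[OF s le] by (simp add: nrm_W)
qed

lemma cut_linear: "linear_map (W n) (W n) (cut F)"
  using cut_carr(1) by (auto simp: linear_map_def scal_W) (auto simp: cut_def fun_eq_iff)

text \<open>The difference is the tail of a convergent series. Vectors with finitely many nonzero
  blocks are thus dense, and bounded maps can be compared on them.\<close>

lemma cut_tendsto:
  assumes "z \<in> carr (W n)"
  shows "(\<lambda>M. nrm (W n) (z - cut {..<M} z)) \<longlonglongrightarrow> 0"
proof -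
  let ?f = "\<lambda>k. blk n (z k) *\<^sub>R e k"
  have s: "summable ?f" using assms by (simp add: carr_W)
  have "nrm (W n) (z - cut {..<M} z) = norm (suminf ?f - sum ?f {..<M})" for M
  proof -
    have "(\<lambda>k. blk n ((z - cut {..<M} z) k) *\<^sub>R e k) = (\<lambda>k. if k < M then 0 else ?f k)"
      by (auto simp: fun_eq_iff cut_def L2_set_def)
    moreover have "(\<lambda>k. if k < M then 0 else ?f k) = (\<lambda>k. ?f k - (if k \<in> {..<M} then ?f k else 0))" by auto
    moreover have "(\<lambda>k. ?f k - (if k \<in> {..<M} then ?f k else 0)) sums (suminf ?f - sum ?f {..<M})"
      using s by (intro sums_diff summable_sums sums_If_finite_set) auto
    ultimately show ?thesis by (simp add: nrm_W sums_iff)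
  qed
  moreover have "(\<lambda>M. norm (suminf ?f - sum ?f {..<M})) \<longlonglongrightarrow> norm (suminf ?f - suminf ?f)"
    by (intro tendsto_norm tendsto_diff tendsto_const summable_LIMSEQ s)
  ultimately show ?thesis by simp
qed

lemma cut_eq_sum:
  assumes "z \<in> carr (W n)" "finite F"
  shows "cut F z = (\<Sum>k\<in>F. \<Sum>m<n. single (k, m) (z k m))"
proof (intro ext)
  fix p q
  have "(\<Sum>m<n. if q = m then z k m else 0) = z k q" for k
    using assms(1) by (auto simp: sum.delta carr_W)
  moreover have "(if p = k \<and> q = m then z k m else 0) = (if p = k then if q = m then z k m else 0 else 0)" for k m by simp
  ultimately have "(\<Sum>k\<in>F. \<Sum>m<n. single (k, m) (z k m) p q) = (\<Sum>k\<in>F. if p = k then z k q else 0)"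
    by (auto simp: single_def intro!: sum.cong)
  then show "cut F z p q = (\<Sum>k\<in>F. \<Sum>m<n. single (k, m) (z k m)) p q"
    using assms(2) by (simp add: sum_apply2 cut_def sum.delta)
qed

section \<open>Isometries of the model: phases, coordinate swaps, block swaps and block
  rotations\<close>

lemma phases_isometry:
  assumes "\<And>k m. norm (\<Theta> k m) = 1"
  shows "surjective_isometry (W n) (W n) (\<lambda>z k m. \<Theta> k m * z k m)"
  using assms by (intro surjective_isometry_hilbert_sum ell2_phases) auto

lemma coordinate_transpose_isometry:
  assumes "\<And>k. l k < n" "\<And>k. l' k < n"
  shows "surjective_isometry (W n) (W n) (\<lambda>z k. z k \<circ> Transposition.transpose (l k) (l' k))"
  using assms by (intro surjective_isometry_hilbert_sum ell2_transpose) auto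

lemma block_transpose_isometry:
  "surjective_isometry (W n) (W n) (\<lambda>z. z \<circ> Transposition.transpose i j)"
  by (rule surjective_isometry_transpose)

text \<open>Cosine and sine are the parameters, rather than the angle, so that the sine can be the
  perturbation parameter \<open>t\<close> itself and the cosine
  \<open>sqrt (1 - t\<^sup>2)\<close>.\<close>

definition block_rotation :: "nat \<Rightarrow> nat \<Rightarrow> nat \<Rightarrow> real \<Rightarrow> real \<Rightarrow> (nat \<Rightarrow> nat \<Rightarrow> 'k) \<Rightarrow> nat \<Rightarrow> nat \<Rightarrow> 'k" where
  "block_rotation i l l' c s z = (\<lambda>k. if k = i then
     (\<lambda>m. if m = l then of_real c * z k l - of_real s * z k l' else if m = l' then of_real s * z k l + of_real c * z k l' else z k m)
     else z k)"

lemma surjective_isometry_id: "surjective_isometry V V (\<lambda>x. x)"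
  by (auto simp: surjective_isometry_def linear_map_def)

lemma block_rotation_isometry:
  assumes "l < n" "l' < n" "l \<noteq> l'" "c\<^sup>2 + s\<^sup>2 = 1"
  shows "surjective_isometry (W n) (W n) (block_rotation i l l' c s)"
proof -
  let ?\<tau> = "\<lambda>k. if k = i then (\<lambda>v m. if m = l then of_real c * v l - of_real s * v l' else if m = l' then of_real s * v l + of_real c * v l' else v m) else (\<lambda>v. v)"
  have "surjective_isometry (W n) (W n) (\<lambda>z k. ?\<tau> k (z k))"
    by (rule surjective_isometry_hilbert_sum) (use ell2_rotation[OF assms] in \<open>auto intro: surjective_isometry_id\<close>)
  moreover have "(\<lambda>z k. ?\<tau> k (z k)) = block_rotation i l l' c s"
    by (auto simp: block_rotation_def fun_eq_iff)
  ultimately show ?thesis by simp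
qed

section \<open>Renormings invariant under all isometries, and their skew maps\<close>

abbreviation WN :: "nat \<Rightarrow> ((nat \<Rightarrow> nat \<Rightarrow> 'k) \<Rightarrow> real) \<Rightarrow> ('k, nat \<Rightarrow> nat \<Rightarrow> 'k) nspace" where
  "WN n N \<equiv> (W n)\<lparr>nrm := N\<rparr>"

text \<open>These are the competitors in the definition of maximality. Invariance is required for
  all surjective isometries, including functions that are not extensional, so no restriction to the
  carrier has to be carried along.\<close>

definition admissible :: "nat \<Rightarrow> ((nat \<Rightarrow> nat \<Rightarrow> 'k) \<Rightarrow> real) \<Rightarrow> bool" where
  "admissible n N \<longleftrightarrow> equivalent_norm (W n) N \<and> (\<forall>g. surjective_isometry (W n) (W n) g \<longrightarrow> (\<forall>z\<in>carr (W n). N (g z) = N z))"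

lemma admissible_normed_space:
  assumes "admissible n N" shows "normed_space (WN n N)"
proof -
  have "linear_space (WN n N)" using linear_space_W[of n] by (simp add: linear_space_def)
  moreover have "norm_on (WN n N) N" using assms by (simp add: admissible_def equivalent_norm_def norm_on_def)
  ultimately show ?thesis by (simp add: normed_space_def)
qed

lemma admissible_isometry:
  assumes "admissible n N" "surjective_isometry (W n) (W n) g" shows "surjective_isometry (WN n N) (WN n N) g"
  using assms by (auto simp: admissible_def surjective_isometry_def linear_map_def)

lemma admissible_lower:
  assumes "admissible n N" obtains a where "a > 0" "\<And>x. x \<in> carr (W n) \<Longrightarrow> a * nrm (W n) x \<le> N x"
  using assms unfolding admissible_def equivalent_norm_def by metis

lemma admissible_upper:
  assumes "admissible n N" obtains b where "b > 0" "\<And>x. x \<in> carr (W n) \<Longrightarrow> N x \<le> b * nrm (W n) x"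
  using assms unfolding admissible_def equivalent_norm_def by metis

lemma skew_conj_isometry:
  assumes N: "admissible n N" and A: "skew (WN n N) A"
    and g: "surjective_isometry (W n) (W n) g" and h: "surjective_isometry (W n) (W n) h"
    and gh: "\<And>y. g (h y) = y"
  shows "skew (WN n N) (\<lambda>y. g (A (h y)))"
  by (rule skew_conj[OF admissible_normed_space[OF N] admissible_normed_space[OF N] A
        admissible_isometry[OF N g] admissible_isometry[OF N h]]) (rule gh)

lemma plane_map_linear:
  assumes "snd a < n" "snd b < n"
  shows "linear_map (W n) (W n) (plane_map a b \<alpha> \<beta>)"
  unfolding linear_map_def plane_map_def
  using assms linear_space_add[OF linear_space_W single_carr single_carr]
  by (auto simp: scal_W single_def entry_def fun_eq_iff algebra_simps)

text \<open>The map \<open>z + t J z\<close> equals the true rotation with sine \<open>t\<close> and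
  cosine \<open>c\<close> plus \<open>1 - c\<close> times the projection onto the plane. The
  rotation preserves \<open>N\<close>, and the remaining term is of order
  \<open>t\<^sup>2\<close>.\<close>

lemma skew_block_rotation_generator:
  assumes N: "admissible n N" and l: "l < n" "l' < n" "l \<noteq> l'"
  shows "skew (WN n N) (rotation_generator (i, l) (i, l'))"
proof -
  let ?J = "rotation_generator (i, l) (i, l')"
  note V = admissible_normed_space[OF N]
  have sc: "single (i, l) c \<in> carr (W n)" "single (i, l') c \<in> carr (W n)" for c using l by (auto intro: single_carr)
  obtain a where a: "a > 0" "\<And>x. x \<in> carr (W n) \<Longrightarrow> a * nrm (W n) x \<le> N x" using admissible_lower[OF N] by blast
  \<comment> \<open>This bounds the plane projection in the norm \<open>N\<close>: each entry of
    \<open>z\<close> is at most \<open>N z / a\<close>.\<close>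
  define K where "K = (N (single (i, l) 1) + N (single (i, l') 1)) / a"
  have K: "K \<ge> 0" using nrm_nonneg[OF V, of "single (i, l) 1"] nrm_nonneg[OF V, of "single (i, l') 1"] sc a(1) by (simp add: K_def)
  have E: "N (single (i, l) (entry z (i, l)) + single (i, l') (entry z (i, l'))) \<le> K * N z" if z: "z \<in> carr (W n)" for z
  proof -
    have one: "N (single p (entry z p)) \<le> (N z / a) * N (single p 1)" if p: "snd p < n" for p
    proof -
      have "N (single p (entry z p)) = norm (entry z p) * N (single p 1)"
        using nrm_scal[OF V, of "single p 1" "entry z p"] single_carr[OF p] scal_single[of n "entry z p" p 1] by simp
      also have "norm (entry z p) \<le> N z / a"
      proof -
        have "a * norm (entry z p) \<le> a * nrm (W n) z" using norm_entry_le[OF z, of p] a(1) by (intro mult_left_mono) auto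
        then have "norm (entry z p) * a \<le> N z" using a(2)[OF z] by (simp only: mult.commute)
        then show ?thesis using a(1) by (simp only: pos_le_divide_eq)
      qed
      finally show ?thesis using nrm_nonneg[OF V, of "single p 1"] single_carr[OF p] by (simp add: mult_right_mono)
    qed
    have "K * N z = N z / a * N (single (i, l) 1) + N z / a * N (single (i, l') 1)"
      by (simp add: K_def add_divide_distrib algebra_simps)
    then have "N (single (i, l) (entry z (i, l))) + N (single (i, l') (entry z (i, l'))) \<le> K * N z"
      using one[of "(i, l)"] one[of "(i, l')"] l by simp
    then show ?thesis using nrm_add[OF V, of "single (i, l) (entry z (i, l))" "single (i, l') (entry z (i, l'))"] sc by simp
  qed
  have "N (z + scal (W n) (of_real t) (?J z)) \<le> (1 + K * t\<^sup>2) * N z" if z: "z \<in> carr (W n)" and t: "\<bar>t\<bar> \<le> 1" for z t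
  proof -
    define c where "c = sqrt (1 - t\<^sup>2)"
    have t2: "t\<^sup>2 \<le> 1" using t by (simp add: abs_square_le_1)
    have c: "c\<^sup>2 + t\<^sup>2 = 1" "0 \<le> c" "c \<le> 1" using t2 by (auto simp: c_def)
    \<comment> \<open>For \<open>0 \<le> c \<le> 1\<close> one has
      \<open>1 - c \<le> 1 - c\<^sup>2\<close>, which is \<open>t\<^sup>2\<close>.\<close>
    have c': "1 - c \<le> t\<^sup>2" using c mult_left_mono[of c 1 c] by (simp add: power2_eq_square)
    let ?R = "block_rotation i l l' c t"
    let ?E = "single (i, l) (entry z (i, l)) + single (i, l') (entry z (i, l'))"
    have R: "surjective_isometry (W n) (W n) ?R" using block_rotation_isometry[OF l c(1)] .
    have Rc: "?R z \<in> carr (W n)" using R z by (auto simp: surjective_isometry_def linear_map_def)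
    have Ec: "?E \<in> carr (W n)" using linear_space_add[OF linear_space_W sc(1) sc(2)] .
    have Ec': "scal (W n) (of_real (1 - c)) ?E \<in> carr (W n)" by (rule linear_space_scal[OF linear_space_W Ec])
    have "z + scal (W n) (of_real t) (?J z) = ?R z + scal (W n) (of_real (1 - c)) ?E"
      using l(3) by (auto simp: fun_eq_iff block_rotation_def rotation_generator_def scal_W single_def entry_def algebra_simps)
    then have "N (z + scal (W n) (of_real t) (?J z)) \<le> N (?R z) + N (scal (W n) (of_real (1 - c)) ?E)"
      using nrm_add[OF V, of "?R z" "scal (W n) (of_real (1 - c)) ?E"] Rc Ec' by simp
    moreover have "N (?R z) = N z" using N R z by (simp add: admissible_def)
    moreover have "N (scal (W n) (of_real (1 - c)) ?E) = (1 - c) * N ?E"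
      using nrm_scal[OF V, of ?E "of_real (1 - c)"] Ec c(3) by (simp del: of_real_diff)
    moreover have "(1 - c) * N ?E \<le> t\<^sup>2 * (K * N z)"
      using c' E[OF z] c(3) nrm_nonneg[OF V, of ?E] Ec by (intro mult_mono) auto
    moreover have "N z + t\<^sup>2 * (K * N z) = (1 + K * t\<^sup>2) * N z" by (simp add: algebra_simps)
    ultimately show ?thesis by linarith
  qed
  moreover have "linear_map (WN n N) (WN n N) ?J"
    using plane_map_linear[of "(i, l)" n "(i, l')" 1 "-1"] l by (simp add: rotation_generator_eq linear_map_def)
  ultimately show ?thesis using K unfolding skew_def by auto
qed

definition phase :: "nat \<times> nat \<Rightarrow> 'k \<Rightarrow> (nat \<Rightarrow> nat \<Rightarrow> 'k) \<Rightarrow> nat \<Rightarrow> nat \<Rightarrow> 'k" where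
  "phase a \<omega> z = (\<lambda>k m. (if (k, m) = a then \<omega> else 1) * z k m)"

lemma phase_isometry: "norm \<omega> = 1 \<Longrightarrow> surjective_isometry (W n) (W n) (phase a \<omega>)"
  unfolding phase_def by (rule phases_isometry) auto

lemma phase_inverse: "\<omega> * \<omega>' = 1 \<Longrightarrow> phase a \<omega> (phase a \<omega>' z) = z"
  by (auto simp: phase_def fun_eq_iff mult.assoc[symmetric])

text \<open>Conjugation by the sign change at \<open>a\<close> negates precisely the matrix entries
  with exactly one index equal to \<open>a\<close>. The difference keeps these, doubled, and cancels
  all others.\<close>

lemma skew_flip_diff:
  assumes N: "admissible n N" and A: "skew (WN n N) A"
  shows "skew (WN n N) (\<lambda>z. A z - phase a (-1) (A (phase a (-1) z)))"
  using skew_conj_isometry[OF N A phase_isometry phase_isometry, of "-1" "-1" a a]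
  by (intro skew_diff admissible_normed_space[OF N] A) (auto simp: phase_inverse)

text \<open>Averaging over sign changes isolates two matrix entries.\<close>

lemma skew_plane_map:
  assumes N: "admissible n N" and A: "skew (WN n N) A" and ab: "a \<noteq> b" "snd a < n" "snd b < n"
  shows "skew (WN n N) (plane_map a b (entry (A (single a 1)) b) (entry (A (single b 1)) a))"
proof -
  note V = admissible_normed_space[OF N]
  have L: "linear_space (WN n N)" using V by (simp add: normed_space_def)
  let ?B = "\<lambda>z. A z - phase a (-1) (A (phase a (-1) z))"
  let ?D = "\<lambda>z. ?B z - phase b (-1) (?B (phase b (-1) z))"
  let ?P = "plane_map a b (entry (A (single a 1)) b) (entry (A (single b 1)) a)"
  have D: "skew (WN n N) ?D" by (intro skew_flip_diff N A)
  \<comment> \<open>The sign change is the identity minus a rank-one map, so \<open>A\<close> only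
    has to be evaluated on one unit vector and no series expansion of \<open>A z\<close> is
    involved.\<close>
  have flip: "A (phase p (-1) z) = A z - scal (W n) (2 * entry z p) (A (single p 1))"
    if z: "z \<in> carr (W n)" and p: "snd p < n" for z p
  proof -
    have eq: "phase p (-1) z = z - scal (W n) (2 * entry z p) (single p 1)"
      by (auto simp: phase_def scal_W single_def entry_def fun_eq_iff)
    have "scal (W n) (2 * entry z p) (single p 1) \<in> carr (W n)"
      by (intro linear_space_scal[OF linear_space_W] single_carr p)
    then have "A (phase p (-1) z) = A z - A (scal (W n) (2 * entry z p) (single p 1))"
      using linear_map_diff[OF L skew_linear_map[OF A], of z "scal (W n) (2 * entry z p) (single p 1)"] z eq by simp
    then show ?thesis
      using linear_map_scal[OF skew_linear_map[OF A], of "single p 1" "2 * entry z p"] single_carr[OF p] by simp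
  qed
  \<comment> \<open>Each of the two differences doubles the surviving entries, hence the factor
    4.\<close>
  have "scal (WN n N) (of_real (1/4)) (?D z) = ?P z" if z: "z \<in> carr (W n)" for z
  proof -
    have zb: "phase b (-1) z \<in> carr (W n)"
      using phase_isometry[of "-1" n b] z by (auto simp: surjective_isometry_def linear_map_def)
    have e: "entry (phase b (-1) z) a = entry z a" using ab by (auto simp: entry_def phase_def)
    have "?D z = scal (W n) 4 (?P z)"
      unfolding flip[OF z ab(2)] flip[OF zb ab(2)] flip[OF z ab(3)] e
      using ab(1) by (auto simp: fun_eq_iff scal_W phase_def plane_map_def single_def entry_def algebra_simps)
    moreover have "?P z \<in> carr (W n)" using linear_map_carr[OF plane_map_linear[OF ab(2,3)] z] .
    ultimately show ?thesis using scal_scal[OF linear_space_W, of "?P z" n "of_real (1/4)" 4] scal_one[OF linear_space_W, of "?P z" n]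
      by simp
  qed
  then show ?thesis
    using skew_cong[of "WN n N" "\<lambda>z. scal (WN n N) (of_real (1/4)) (?D z)" ?P] skew_scale[OF V D, of "1/4"] L by auto
qed

text \<open>Block index and coordinate index are transposed independently, which is an isometry of
  the sum. Other positions move as well, but never onto \<open>a\<close> or \<open>b\<close>, so the
  effect on a \<open>plane_map\<close> is the exchange of the two entries.\<close>

definition position_swap :: "nat \<times> nat \<Rightarrow> nat \<times> nat \<Rightarrow> (nat \<Rightarrow> nat \<Rightarrow> 'k) \<Rightarrow> nat \<Rightarrow> nat \<Rightarrow> 'k" where
  "position_swap a b z = (\<lambda>k m. z (Transposition.transpose (fst a) (fst b) k) (Transposition.transpose (snd a) (snd b) m))"

lemma position_swap_isometry:
  assumes "snd a < n" "snd b < n"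
  shows "surjective_isometry (W n) (W n) (position_swap a b)"
proof -
  have "surjective_isometry (W n) (W n) ((\<lambda>z k. z k \<circ> Transposition.transpose (snd a) (snd b)) \<circ> (\<lambda>z. z \<circ> Transposition.transpose (fst a) (fst b)))"
    using assms by (intro surjective_isometry_compose[OF block_transpose_isometry] coordinate_transpose_isometry)
  moreover have "(\<lambda>z k. z k \<circ> Transposition.transpose (snd a) (snd b)) \<circ> (\<lambda>z. z \<circ> Transposition.transpose (fst a) (fst b)) = position_swap a b"
    by (auto simp: position_swap_def fun_eq_iff)
  ultimately show ?thesis by simp
qed

lemma position_swap_plane_map:
  "position_swap a b (plane_map a b \<alpha> \<beta> (position_swap a b z)) = plane_map a b \<beta> \<alpha> z"
  by (cases a; cases b)
     (auto simp: position_swap_def plane_map_def single_def entry_def fun_eq_iff Transposition.transpose_def)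

text \<open>The eigenvalues of a skew map are purely imaginary, which forces \<open>\<beta> = - cnj \<alpha>\<close>.\<close>

lemma skew_rotation_generator:
  assumes N: "admissible n N" and P: "skew (WN n N) (plane_map a b \<alpha> \<beta>)" and "\<alpha> \<noteq> 0"
    and ab: "a \<noteq> b" "snd a < n" "snd b < n"
  shows "skew (WN n N) (rotation_generator a b)"
proof -
  note V = admissible_normed_space[OF N]
  have sc: "single a c + single b d \<in> carr (W n)" for c d :: 'k
    using ab by (intro linear_space_add[OF linear_space_W] single_carr)
  have ne: "single a 1 + single b d \<noteq> 0" for d :: 'k
  proof
    assume "single a 1 + single b d = 0"
    then have "entry (single a 1 + single b d) a = 0" by (simp add: entry_def)
    then show False using ab by (simp add: entry_add entry_single)
  qed
  \<comment> \<open>Conjugating with this phase at \<open>b\<close> makes the entry from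
    \<open>a\<close> to \<open>b\<close> equal to \<open>norm \<alpha>\<close>; after division by
    \<open>norm \<alpha>\<close> the two entries are 1 and \<open>\<gamma>\<close>.\<close>
  define \<omega> where "\<omega> = of_real (norm \<alpha>) / \<alpha>"
  have \<omega>: "norm \<omega> = 1" "\<omega> \<noteq> 0" "norm (1 / \<omega>) = 1" using \<open>\<alpha> \<noteq> 0\<close> by (auto simp: \<omega>_def norm_divide)
  have "skew (WN n N) (\<lambda>z. phase b \<omega> (plane_map a b \<alpha> \<beta> (phase b (1 / \<omega>) z)))"
    using \<omega> by (intro skew_conj_isometry[OF N P] phase_isometry phase_inverse) auto
  then have "skew (WN n N) (\<lambda>z. scal (WN n N) (of_real (1 / norm \<alpha>)) (phase b \<omega> (plane_map a b \<alpha> \<beta> (phase b (1 / \<omega>) z))))"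
    by (rule skew_scale[OF V])
  moreover define \<gamma> where "\<gamma> = \<beta> / (\<omega> * of_real (norm \<alpha>))"
  have "(\<lambda>z. scal (WN n N) (of_real (1 / norm \<alpha>)) (phase b \<omega> (plane_map a b \<alpha> \<beta> (phase b (1 / \<omega>) z)))) = plane_map a b 1 \<gamma>"
    using ab(1) \<open>\<alpha> \<noteq> 0\<close> by (auto simp: fun_eq_iff scal_W phase_def plane_map_def single_def entry_def \<gamma>_def \<omega>_def)
  ultimately have G: "skew (WN n N) (plane_map a b 1 \<gamma>)" by simp
  have G': "skew (WN n N) (plane_map a b \<gamma> 1)"
    using skew_conj_isometry[OF N G position_swap_isometry position_swap_isometry, of a b a b] ab
    by (simp add: position_swap_plane_map) (simp add: position_swap_def fun_eq_iff)
  have sum: "skew (WN n N) (\<lambda>z. plane_map a b 1 \<gamma> z + plane_map a b \<gamma> 1 z)" by (rule skew_add[OF V G G'])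
  have diff: "skew (WN n N) (\<lambda>z. plane_map a b 1 \<gamma> z - plane_map a b \<gamma> 1 z)" by (rule skew_diff[OF V G G'])
  \<comment> \<open>Adding the map with exchanged entries makes the matrix symmetric; the vector
    with equal entries at \<open>a\<close> and \<open>b\<close> is then an eigenvector, which yields
    \<open>Re \<gamma> = -1\<close>.\<close>
  have "Re (to_complex (1 + \<gamma>)) = 0"
  proof (rule skew_eigenvalue[OF V sum])
    show "single a 1 + single b 1 \<in> carr (WN n N)" using sc by simp
    show "single a 1 + single b 1 \<noteq> (0 :: nat \<Rightarrow> nat \<Rightarrow> 'k)" by (rule ne)
    show "plane_map a b 1 \<gamma> (single a 1 + single b 1) + plane_map a b \<gamma> 1 (single a 1 + single b 1) = scal (WN n N) (1 + \<gamma>) (single a 1 + single b 1)"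
      using ab(1) unfolding plane_map_def entry_add entry_single by (auto simp: scal_W fun_eq_iff single_def algebra_simps)
  qed
  \<comment> \<open>Over the complex field the difference of the two maps is antisymmetric, with
    eigenvector entries 1 and \<open>\<iota>\<close> and eigenvalue
    \<open>(\<gamma> - 1) * \<iota>\<close>. Its real part is minus the imaginary part of
    \<open>\<gamma>\<close>.\<close>
  moreover have "Im (to_complex \<gamma>) = 0"
  proof (cases "range (to_complex :: 'k \<Rightarrow> complex) = UNIV")
    case True
    then obtain \<iota> :: 'k where \<iota>: "to_complex \<iota> = \<i>" by (metis rangeE UNIV_I)
    have "to_complex (\<iota> * \<iota>) = to_complex (-1)" by (simp add: to_complex_mult to_complex_minus to_complex_one \<iota>)
    then have \<iota>2: "\<iota> * \<iota> = -1" using inj_to_complex by (auto simp: inj_def)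
    have "Re (to_complex ((\<gamma> - 1) * \<iota>)) = 0"
    proof (rule skew_eigenvalue[OF V diff])
      show "single a 1 + single b \<iota> \<in> carr (WN n N)" using sc by simp
      show "single a 1 + single b \<iota> \<noteq> 0" by (rule ne)
      show "plane_map a b 1 \<gamma> (single a 1 + single b \<iota>) - plane_map a b \<gamma> 1 (single a 1 + single b \<iota>) = scal (WN n N) ((\<gamma> - 1) * \<iota>) (single a 1 + single b \<iota>)"
        using ab(1) unfolding plane_map_def entry_add entry_single by (auto simp: scal_W fun_eq_iff single_def algebra_simps \<iota>2)
    qed
    then show ?thesis by (simp add: to_complex_mult to_complex_diff to_complex_one \<iota>)
  next
    case False
    then have "to_complex \<gamma> \<in> \<real>" using range_to_complex[where 'a = 'k] by blast
    then show ?thesis by (rule complex_is_Real_iff[THEN iffD1])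
  qed
  ultimately have "to_complex \<gamma> = to_complex (-1)"
    by (simp add: complex_eq_iff to_complex_add to_complex_one to_complex_minus)
  then have "\<gamma> = -1" using inj_to_complex by (auto simp: inj_def)
  then show ?thesis using G by (simp add: rotation_generator_eq)
qed

end

section \<open>Rotations between blocks force a Hilbert space\<close>

text \<open>Applying the one-sided bound also backwards, from \<open>x + h\<close> to
  \<open>x\<close>, makes it two-sided; the difference quotients are then at most
  \<open>C * \<bar>h\<bar>\<close> and the derivative vanishes everywhere.\<close>

lemma constant_if_quadratic_increments:
  fixes g :: "real \<Rightarrow> real"
  assumes "C \<ge> 0" "\<And>x t. \<bar>t\<bar> \<le> 1 \<Longrightarrow> g (x + t) \<le> g x + C * t\<^sup>2"
  shows "g x = g y"
proof -
  have "(g has_real_derivative 0) (at x)" for x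
  proof -
    have "norm ((g (x + h) - g x) / h) \<le> C * \<bar>h\<bar>" if "\<bar>h\<bar> \<le> 1" for h
    proof (cases "h = 0")
      case False
      have "\<bar>g (x + h) - g x\<bar> \<le> C * h\<^sup>2" using assms(2)[OF that, of x] assms(2)[of "- h" "x + h"] that by simp
      then have "\<bar>g (x + h) - g x\<bar> / \<bar>h\<bar> \<le> C * h\<^sup>2 / \<bar>h\<bar>" by (rule divide_right_mono) simp
      also have "C * h\<^sup>2 / \<bar>h\<bar> = C * \<bar>h\<bar>" using False by (simp add: power2_eq_square abs_if)
      finally show ?thesis by (simp add: abs_divide)
    qed (use assms(1) in simp)
    moreover have "eventually (\<lambda>h::real. \<bar>h\<bar> \<le> 1) (at 0)"
      unfolding eventually_at by (intro exI[of _ 1]) (auto simp: dist_real_def)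
    ultimately have "eventually (\<lambda>h. norm ((g (x + h) - g x) / h) \<le> C * \<bar>h\<bar>) (at 0)"
      by (auto elim: eventually_mono)
    moreover have "((\<lambda>h. C * \<bar>h\<bar>) \<longlongrightarrow> 0) (at (0::real))" by (auto intro!: tendsto_eq_intros)
    ultimately have "((\<lambda>h. (g (x + h) - g x) / h) \<longlongrightarrow> 0) (at 0)" by (rule Lim_null_comparison)
    then show ?thesis by (simp add: DERIV_def)
  qed
  then show ?thesis using DERIV_isconst_all by blast
qed

text \<open>These are the errors of replacing a rotation by its linearization. The addition formulas
  reduce both to \<open>cos t - 1\<close> and \<open>sin t - t\<close>, each at most
  \<open>t\<^sup>2 / 2\<close> in absolute value.\<close>

lemma abs_cos_add_le:
  fixes t \<theta> :: real
  shows "\<bar>cos (\<theta> + t) - cos \<theta> + t * sin \<theta>\<bar> \<le> t\<^sup>2" "\<bar>sin (\<theta> + t) - sin \<theta> - t * cos \<theta>\<bar> \<le> t\<^sup>2"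
proof -
  have s: "\<bar>sin t - t\<bar> \<le> t\<^sup>2 / 2" using Maclaurin_sin_bound[of t 2] by (simp add: numeral_2_eq_2 sin_coeff_def)
  have "\<bar>sin (t / 2)\<bar>\<^sup>2 \<le> \<bar>t / 2\<bar>\<^sup>2" by (intro power_mono abs_sin_x_le_abs_x) simp
  then have c: "\<bar>cos t - 1\<bar> \<le> t\<^sup>2 / 2" using cos_double_sin[of "t / 2"] by (simp add: power_divide)
  have b: "\<bar>u * (cos t - 1) + v * (sin t - t)\<bar> \<le> t\<^sup>2" if "\<bar>u\<bar> \<le> 1" "\<bar>v\<bar> \<le> 1" for u v
  proof -
    have "\<bar>u\<bar> * \<bar>cos t - 1\<bar> \<le> 1 * (t\<^sup>2 / 2)" "\<bar>v\<bar> * \<bar>sin t - t\<bar> \<le> 1 * (t\<^sup>2 / 2)"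
      using that s c by (intro mult_mono; simp)+
    then show ?thesis using abs_triangle_ineq[of "u * (cos t - 1)" "v * (sin t - t)"] by (simp add: abs_mult)
  qed
  show "\<bar>cos (\<theta> + t) - cos \<theta> + t * sin \<theta>\<bar> \<le> t\<^sup>2"
    using b[of "cos \<theta>" "- sin \<theta>"] by (simp add: cos_add algebra_simps)
  show "\<bar>sin (\<theta> + t) - sin \<theta> - t * cos \<theta>\<bar> \<le> t\<^sup>2"
    using b[of "sin \<theta>" "cos \<theta>"] by (simp add: sin_add algebra_simps)
qed

lemma entry_sum_single:
  fixes c :: "'i \<Rightarrow> 'a::ab_group_add"
  assumes "finite I" "inj_on a I"
  shows "j \<in> I \<Longrightarrow> entry (\<Sum>i\<in>I. single (a i) (c i)) (a j) = c j"
    and "p \<notin> a ` I \<Longrightarrow> entry (\<Sum>i\<in>I. single (a i) (c i)) p = 0"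
proof -
  have e: "entry (\<Sum>i\<in>I. single (a i) (c i)) p = (\<Sum>i\<in>I. if a i = p then c i else 0)" for p
    by (simp add: entry_def sum_apply2 single_def eq_commute[of p])
  show "entry (\<Sum>i\<in>I. single (a i) (c i)) (a j) = c j" if "j \<in> I"
  proof -
    have "(\<Sum>i\<in>I. if a i = a j then c i else 0) = (\<Sum>i\<in>I. if i = j then c i else 0)"
      using assms that by (intro sum.cong) (auto dest: inj_onD)
    then show ?thesis using e that assms(1) by simp
  qed
  show "entry (\<Sum>i\<in>I. single (a i) (c i)) p = 0" if "p \<notin> a ` I"
    unfolding e using that by (intro sum.neutral) auto
qed

context symmetric_basis
begin

lemma nrm_single:
  assumes "admissible n N" "snd a < n"
  shows "N (single a c) = norm c * N (single a 1)"
  using nrm_scal[OF admissible_normed_space[OF assms(1)], of "single a 1" c] single_carr[OF assms(2)] scal_single[of n c a 1] by simp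

text \<open>This replaces integration of the generator. Along the circle through the given point, a
  step of angle \<open>t\<close> is the linear step controlled by skewness plus an error of order
  \<open>t\<^sup>2\<close>, so \<open>N\<close> has quadratic increments and is constant on the
  circle.\<close>

lemma rotation_invariant:
  assumes N: "admissible n N" and J: "skew (WN n N) (rotation_generator a b)"
    and ab: "a \<noteq> b" "snd a < n" "snd b < n" and w: "w \<in> carr (W n)" "entry w a = 0" "entry w b = 0"
  shows "N (w + single a (of_real p) + single b (of_real q)) = N (w + single a (of_real (sqrt (p\<^sup>2 + q\<^sup>2))))"
proof -
  note V = admissible_normed_space[OF N]
  have L: "linear_space (WN n N)" using V by (simp add: normed_space_def)
  have sc: "single a c \<in> carr (W n)" "single b c \<in> carr (W n)" for c using ab by (auto intro: single_carr)
  obtain r \<theta>\<^sub>0 where r: "p = r * cos \<theta>\<^sub>0" "q = r * sin \<theta>\<^sub>0" using polar_Ex by metis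
  define \<gamma> where "\<gamma> \<theta> = w + single a (of_real (r * cos \<theta>)) + single b (of_real (r * sin \<theta>))" for \<theta>
  define g where "g \<theta> = N (\<gamma> \<theta>)" for \<theta>
  define B where "B = \<bar>r\<bar> * (N (single a 1) + N (single b 1))"
  have sum_le: "N (single a (of_real u) + single b (of_real v)) \<le> s * (N (single a 1) + N (single b 1))" if "\<bar>u\<bar> \<le> s" "\<bar>v\<bar> \<le> s" for u v s
  proof -
    have "N (single a (of_real u) + single b (of_real v)) \<le> N (single a (of_real u)) + N (single b (of_real v))"
      using nrm_add[OF V, of "single a (of_real u)" "single b (of_real v)"] sc by simp
    also have "\<dots> = \<bar>u\<bar> * N (single a 1) + \<bar>v\<bar> * N (single b 1)"
      using nrm_single[OF N ab(2), of "of_real u"] nrm_single[OF N ab(3), of "of_real v"] by simp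
    also have "\<dots> \<le> s * N (single a 1) + s * N (single b 1)"
      using that nrm_nonneg[OF V, of "single a 1"] nrm_nonneg[OF V, of "single b 1"] sc by (intro add_mono mult_right_mono) auto
    finally show ?thesis by (simp add: distrib_left)
  qed
  obtain K where K: "K \<ge> 0" "\<And>x t. x \<in> carr (W n) \<Longrightarrow> \<bar>t\<bar> \<le> 1 \<Longrightarrow> N (x + scal (W n) (of_real t) (rotation_generator a b x)) \<le> (1 + K * t\<^sup>2) * N x"
    using J unfolding skew_def by auto
  have \<gamma>c: "\<gamma> \<theta> \<in> carr (W n)" for \<theta> unfolding \<gamma>_def by (intro linear_space_add[OF linear_space_W] w sc)
  have gB: "g \<theta> \<le> N w + B" for \<theta>
  proof -
    have "N (w + (single a (of_real (r * cos \<theta>)) + single b (of_real (r * sin \<theta>)))) \<le> N w + N (single a (of_real (r * cos \<theta>)) + single b (of_real (r * sin \<theta>)))"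
      using nrm_add[OF V, of w "single a (of_real (r * cos \<theta>)) + single b (of_real (r * sin \<theta>))"] w sc linear_space_add[OF linear_space_W] by simp
    also have "N (single a (of_real (r * cos \<theta>)) + single b (of_real (r * sin \<theta>))) \<le> B"
      unfolding B_def by (intro sum_le) (simp_all add: abs_mult mult_left_le)
    finally show ?thesis by (simp add: g_def \<gamma>_def add.assoc)
  qed
  have "g (\<theta> + t) \<le> g \<theta> + (K * (N w + B) + B) * t\<^sup>2" if t: "\<bar>t\<bar> \<le> 1" for \<theta> t
  proof -
    \<comment> \<open>The numbers \<open>u\<close> and \<open>v\<close> are the second-order
      remainders at \<open>a\<close> and \<open>b\<close> left over by the linear step.\<close>
    define u where "u = r * (cos (\<theta> + t) - cos \<theta> + t * sin \<theta>)"
    define v where "v = r * (sin (\<theta> + t) - sin \<theta> - t * cos \<theta>)"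
    have uv: "\<bar>u\<bar> \<le> \<bar>r\<bar> * t\<^sup>2" "\<bar>v\<bar> \<le> \<bar>r\<bar> * t\<^sup>2"
      unfolding u_def v_def abs_mult by (intro mult_left_mono abs_cos_add_le; simp)+
    let ?x = "\<gamma> \<theta> + scal (W n) (of_real t) (rotation_generator a b (\<gamma> \<theta>))"
    let ?y = "single a (of_real u) + single b (of_real v)"
    have e: "entry (\<gamma> \<theta>) a = of_real (r * cos \<theta>)" "entry (\<gamma> \<theta>) b = of_real (r * sin \<theta>)"
      using ab w by (auto simp: \<gamma>_def entry_add entry_single)
    have xc: "?x \<in> carr (W n)"
      using linear_map_carr[OF skew_linear_map[OF J]] \<gamma>c by (intro linear_space_add[OF linear_space_W] linear_space_scal[OF linear_space_W]) auto
    have yc: "?y \<in> carr (W n)" by (intro linear_space_add[OF linear_space_W] sc)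
    have "\<gamma> (\<theta> + t) = ?x + ?y"
      unfolding rotation_generator_def e using ab(1)
      by (auto simp: fun_eq_iff \<gamma>_def u_def v_def scal_W single_def algebra_simps)
    then have "g (\<theta> + t) \<le> N ?x + N ?y" using nrm_add[OF V, of ?x ?y] xc yc by (simp add: g_def)
    also have "N ?x \<le> (1 + K * t\<^sup>2) * g \<theta>" using K(2)[OF \<gamma>c t] by (simp add: g_def)
    also have "(1 + K * t\<^sup>2) * g \<theta> \<le> g \<theta> + K * t\<^sup>2 * (N w + B)"
      using mult_left_mono[OF gB, of "K * t\<^sup>2"] K(1) by (simp add: distrib_right)
    also have "N ?y \<le> B * t\<^sup>2" using sum_le[OF uv] by (simp add: B_def mult_ac)
    finally show ?thesis by (simp add: algebra_simps)
  qed
  moreover have "K * (N w + B) + B \<ge> 0"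
    using K(1) nrm_nonneg[OF V, of w] nrm_nonneg[OF V, of "single a 1"] nrm_nonneg[OF V, of "single b 1"] w sc by (simp add: B_def)
  ultimately have const: "g x = g y" for x y by (intro constant_if_quadratic_increments[of "K * (N w + B) + B" g])
  have "sqrt (p\<^sup>2 + q\<^sup>2) = \<bar>r\<bar>"
    unfolding r power_mult_distrib by (simp flip: distrib_left)
  moreover have "single b 0 = (0 :: nat \<Rightarrow> nat \<Rightarrow> 'k)" by (auto simp: single_def fun_eq_iff)
  moreover have "N (w + single a (of_real p) + single b (of_real q)) = g \<theta>\<^sub>0" by (simp add: g_def \<gamma>_def r)
  \<comment> \<open>The radius from \<open>polar_Ex\<close> may be negative; in that case the angle
    \<open>pi\<close> instead of 0 gives the entry \<open>\<bar>r\<bar>\<close> at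
    \<open>a\<close>.\<close>
  ultimately show ?thesis using const[of \<theta>\<^sub>0 0] const[of \<theta>\<^sub>0 pi] by (cases "r \<ge> 0") (auto simp: g_def \<gamma>_def)
qed

lemma admissible_abs:
  assumes N: "admissible n N" and z: "z \<in> carr (W n)"
  shows "N (\<lambda>k m. of_real (norm (z k m))) = N z"
proof -
  define \<Theta> where "\<Theta> k m = (if z k m = 0 then 1 else of_real (norm (z k m)) / z k m)" for k m
  have "norm (\<Theta> k m) = 1" for k m by (simp add: \<Theta>_def norm_divide)
  then have "N (\<lambda>k m. \<Theta> k m * z k m) = N z" using N phases_isometry[of \<Theta> n] z unfolding admissible_def by blast
  moreover have "(\<lambda>k m. \<Theta> k m * z k m) = (\<lambda>k m. of_real (norm (z k m)))" by (auto simp: \<Theta>_def fun_eq_iff)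
  ultimately show ?thesis by simp
qed

text \<open>A rotation merges the last coordinate into position \<open>a 0\<close>, replacing two
  coefficients by the root of the sum of their squares; induction collects everything there.
  Arbitrary scalars reduce to their moduli. The positions are left general because they are taken
  both in different blocks and within one block.\<close>

lemma nrm_rotatable_span:
  fixes a :: "nat \<Rightarrow> nat \<times> nat"
  assumes N: "admissible n N" and a: "inj_on a {..M}" "\<And>i. i \<le> M \<Longrightarrow> snd (a i) < n"
    and J: "\<And>i. i \<in> {1..M} \<Longrightarrow> skew (WN n N) (rotation_generator (a 0) (a i))"
  shows "N (\<Sum>i\<le>M. single (a i) (c i)) = L2_set (\<lambda>i. norm (c i)) {..M} * N (single (a 0) 1)"
proof -
  note V = admissible_normed_space[OF N]
  have real: "N (\<Sum>i\<le>M. single (a i) (of_real (t i))) = sqrt (\<Sum>i\<le>M. (t i)\<^sup>2) * N (single (a 0) 1)" for t :: "nat \<Rightarrow> real"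
    using a J
  proof (induction M arbitrary: t)
    case 0
    then show ?case using nrm_single[OF N, of "a 0" "of_real (t 0)"] by simp
  next
    case (Suc M)
    let ?w = "\<Sum>i\<in>{1..M}. single (a i) (of_real (t i) :: 'k)"
    let ?r = "sqrt ((t 0)\<^sup>2 + (t (Suc M))\<^sup>2)"
    \<comment> \<open>The coefficient at \<open>a 0\<close> absorbs the one at
      \<open>a (Suc M)\<close>.\<close>
    define t' where "t' = t(0 := ?r)"
    have split: "(\<Sum>i\<le>M. f i) = (\<Sum>i\<in>{1..M}. f i) + f 0" for f :: "nat \<Rightarrow> 'b::comm_monoid_add"
      by (simp add: atMost_atLeast0 sum.atLeast_Suc_atMost add.commute)
    have wc: "?w \<in> carr (W n)" using Suc.prems by (intro linear_space_sum[OF linear_space_W] single_carr) auto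
    have inj: "inj_on a {1..M}" using Suc.prems(1) by (rule inj_on_subset) auto
    have "a 0 \<notin> a ` {1..M}" "a (Suc M) \<notin> a ` {1..M}" "a 0 \<noteq> a (Suc M)"
      using inj_onD[OF Suc.prems(1)] by fastforce+
    then have "N (?w + single (a 0) (of_real (t 0)) + single (a (Suc M)) (of_real (t (Suc M)))) = N (?w + single (a 0) (of_real ?r))"
      using Suc.prems wc by (intro rotation_invariant[OF N] entry_sum_single(2)[OF _ inj]) auto
    moreover have "?w + single (a 0) (of_real (t 0)) + single (a (Suc M)) (of_real (t (Suc M))) = (\<Sum>i\<le>Suc M. single (a i) (of_real (t i)))"
      by (simp add: split)
    moreover have "?w = (\<Sum>i\<in>{1..M}. single (a i) (of_real (t' i)))" by (rule sum.cong) (auto simp: t'_def)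
    then have "?w + single (a 0) (of_real ?r) = (\<Sum>i\<le>M. single (a i) (of_real (t' i)))"
      unfolding split[of "\<lambda>i. single (a i) (of_real (t' i))"] by (simp add: t'_def)
    moreover have "N (\<Sum>i\<le>M. single (a i) (of_real (t' i))) = sqrt (\<Sum>i\<le>M. (t' i)\<^sup>2) * N (single (a 0) 1)"
      using Suc.prems by (intro Suc.IH) (auto intro: inj_on_subset)
    moreover have "(\<Sum>i\<in>{1..M}. (t' i)\<^sup>2) = (\<Sum>i\<in>{1..M}. (t i)\<^sup>2)" by (rule sum.cong) (auto simp: t'_def)
    then have "(\<Sum>i\<le>M. (t' i)\<^sup>2) = (\<Sum>i\<le>Suc M. (t i)\<^sup>2)"
      unfolding split[of "\<lambda>i. (t' i)\<^sup>2"] by (simp add: split[of "\<lambda>i. (t i)\<^sup>2"] t'_def)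
    ultimately show ?case by (simp only:)
  qed
  let ?z = "\<Sum>i\<le>M. single (a i) (c i)"
  have zc: "?z \<in> carr (W n)" using a by (intro linear_space_sum[OF linear_space_W] single_carr) auto
  have "entry (\<lambda>k m. of_real (norm (?z k m))) p = entry (\<Sum>i\<le>M. single (a i) (of_real (norm (c i)) :: 'k)) p" for p
  proof (cases "p \<in> a ` {..M}")
    case True
    then obtain j where j: "j \<in> {..M}" "p = a j" by auto
    then show ?thesis using entry_sum_single(1)[OF _ a(1), of j c] entry_sum_single(1)[OF _ a(1), of j "\<lambda>i. of_real (norm (c i)) :: 'k"]
      by (simp add: entry_def)
  next
    case False
    then show ?thesis using entry_sum_single(2)[OF _ a(1), of p c] entry_sum_single(2)[OF _ a(1), of p "\<lambda>i. of_real (norm (c i)) :: 'k"]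
      by (simp add: entry_def)
  qed
  from this[of "(_, _)"] have "(\<lambda>k m. of_real (norm (?z k m))) = (\<Sum>i\<le>M. single (a i) (of_real (norm (c i)) :: 'k))"
    by (auto simp: entry_def fun_eq_iff)
  then show ?thesis using admissible_abs[OF N zc] real[of "\<lambda>i. norm (c i)"] by (simp add: L2_set_def)
qed

text \<open>Coordinate swaps bring both positions to coordinate 0 of their blocks, and block swaps
  carry the pair of blocks to any other pair; all of these are isometries, so skewness is kept under
  conjugation.\<close>

lemma skew_rotation_generator_first_coordinates:
  assumes N: "admissible n N" and J: "skew (WN n N) (rotation_generator (i, l) (j, l'))"
    and ij: "i \<noteq> j" "l < n" "l' < n" and k: "k \<noteq> k'"
  shows "skew (WN n N) (rotation_generator (k, 0) (k', 0))"
proof -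
  let ?g = "\<lambda>(z :: nat \<Rightarrow> nat \<Rightarrow> 'k) k. z k \<circ> Transposition.transpose (if k = i then l else if k = j then l' else 0) 0"
  have g: "surjective_isometry (W n) (W n) ?g" using ij by (intro coordinate_transpose_isometry) auto
  have 1: "skew (WN n N) (rotation_generator (i, 0) (j, 0))"
  proof -
    have "skew (WN n N) (\<lambda>y. ?g (rotation_generator (i, l) (j, l') (?g y)))"
      by (rule skew_conj_isometry[OF N J g g]) (auto simp: fun_eq_iff)
    moreover have "(\<lambda>y. ?g (rotation_generator (i, l) (j, l') (?g y))) = rotation_generator (i, 0) (j, 0)"
      using ij(1) by (auto simp: fun_eq_iff rotation_generator_def single_def entry_def Transposition.transpose_def)
    ultimately show ?thesis by simp
  qed
  have move: "skew (WN n N) (rotation_generator (Transposition.transpose r s p, 0) (Transposition.transpose r s q, 0))"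
    if "skew (WN n N) (rotation_generator (p, 0) (q, 0))" for p q r s
  proof -
    let ?t = "\<lambda>z :: nat \<Rightarrow> nat \<Rightarrow> 'k. z \<circ> Transposition.transpose r s"
    have "skew (WN n N) (\<lambda>y. ?t (rotation_generator (p, 0) (q, 0) (?t y)))"
      by (rule skew_conj_isometry[OF N that block_transpose_isometry block_transpose_isometry]) (auto simp: fun_eq_iff)
    moreover have "(\<lambda>y. ?t (rotation_generator (p, 0) (q, 0) (?t y))) = rotation_generator (Transposition.transpose r s p, 0) (Transposition.transpose r s q, 0)"
      by (auto simp: fun_eq_iff rotation_generator_def single_def entry_def Transposition.transpose_def)
    ultimately show ?thesis by simp
  qed
  \<comment> \<open>Moving \<open>i\<close> to \<open>k\<close> sends \<open>j\<close> to
    \<open>j'\<close>, which differs from \<open>k\<close>. The second swap, of \<open>j'\<close>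
    and \<open>k'\<close>, therefore leaves \<open>k\<close> in place.\<close>
  define j' where "j' = Transposition.transpose i k j"
  have "skew (WN n N) (rotation_generator (k, 0) (j', 0))" using move[OF 1, of i k] by (simp add: j'_def)
  then have "skew (WN n N) (rotation_generator (Transposition.transpose j' k' k, 0) (k', 0))" using move[of k j' j' k'] by simp
  moreover have "Transposition.transpose j' k' k = k"
    using k ij(1) by (auto simp: j'_def Transposition.transpose_def)
  ultimately show ?thesis by simp
qed

definition coef :: "'x \<Rightarrow> nat \<Rightarrow> 'k" where
  "coef x = (THE a. (\<lambda>k. smul (a k) (e k)) sums x)"

lemma coef_sums: "(\<lambda>k. smul (coef x k) (e k)) sums x"
proof -
  have "\<exists>!a. (\<lambda>k. smul (a k) (e k)) sums x" using basis by (simp add: schauder_basis_def)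
  from theI'[OF this] show ?thesis unfolding coef_def .
qed

lemma coef_unique: "(\<lambda>k. smul (a k) (e k)) sums x \<Longrightarrow> coef x = a"
  using basis coef_sums unfolding schauder_basis_def by blast

lemma bounded_linear_smul: "bounded_linear (smul c)"
  by (rule bounded_linear_intro[of _ "norm c"])
     (auto simp: scale_right_distrib norm_smul smul_of_real[symmetric] scale_scale mult.commute)

lemma coef_add: "coef (x + y) k = coef x k + coef y k"
  using coef_unique[of "\<lambda>k. coef x k + coef y k" "x + y"] sums_add[OF coef_sums coef_sums, of x y]
  by (simp add: scale_left_distrib)

lemma coef_smul: "coef (smul c x) k = c * coef x k"
  using coef_unique[of "\<lambda>k. c * coef x k" "smul c x"] bounded_linear.sums[OF bounded_linear_smul coef_sums, of c x]
  by (simp add: scale_scale)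

lemma linear_space_whole: "carr V = UNIV \<Longrightarrow> scal V = smul \<Longrightarrow> linear_space V"
  by (auto simp: linear_space_def scale_right_distrib scale_left_distrib)

text \<open>The inner product is the square-summable pairing of the coefficient sequences, placed on
  the same vector space, so the identity is the required isomorphism. Passing to the limit in the
  two bounds makes the new norm equivalent to the old one, and completeness is inherited.\<close>

lemma hilbertian_if_equivalent_to_l2:
  assumes pos: "lo > 0" "hi > 0"
    and lo: "\<And>c M. lo * L2_set (\<lambda>k. norm (c k)) {..<M} \<le> norm (\<Sum>k<M. smul (c k) (e k))"
    and hi: "\<And>c M. norm (\<Sum>k<M. smul (c k) (e k)) \<le> hi * L2_set (\<lambda>k. norm (c k)) {..<M}"
  shows "hilbertian (whole_space smul)"
proof -
  define h where "h x = sqrt (\<Sum>k. (norm (coef x k))\<^sup>2)" for x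
  have part: "norm (\<Sum>k<M. smul (coef x k) (e k)) \<le> norm x" for x M
  proof -
    have s: "summable (\<lambda>k. norm (coef x k) *\<^sub>R e k)" using coef_sums[of x] summable_smul_iff sums_summable by blast
    have "norm x = norm (\<Sum>k. norm (coef x k) *\<^sub>R e k)"
      using coef_sums[of x] norm_suminf_smul[of "coef x"] by (simp add: sums_iff)
    then show ?thesis using norm_sum_le_suminf[OF s, of "{..<M}" "\<lambda>k. norm (coef x k)"] by (simp add: norm_sum_smul)
  qed
  have summ: "summable (\<lambda>k. (norm (coef x k))\<^sup>2)" for x
  proof (rule summableI_nonneg_bounded)
    fix M
    have "lo * L2_set (\<lambda>k. norm (coef x k)) {..<M} \<le> norm x" using lo[of "coef x" M] part[of x M] by linarith
    then have "L2_set (\<lambda>k. norm (coef x k)) {..<M} \<le> norm x / lo" using pos by (simp add: pos_le_divide_eq mult.commute)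
    then show "(\<Sum>k<M. (norm (coef x k))\<^sup>2) \<le> (norm x / lo)\<^sup>2" unfolding L2_set_def by (rule sqrt_le_D)
  qed simp
  have lim: "(\<lambda>M. L2_set (\<lambda>k. norm (coef x k)) {..<M}) \<longlonglongrightarrow> h x" for x
    unfolding L2_set_def h_def by (intro tendsto_real_sqrt summable_LIMSEQ summ)
  have lim2: "(\<lambda>M. norm (\<Sum>k<M. smul (coef x k) (e k))) \<longlonglongrightarrow> norm x" for x
    using coef_sums[of x] unfolding sums_def by (rule tendsto_norm)
  have h_lo: "lo * h x \<le> norm x" for x
    by (rule LIMSEQ_le[OF tendsto_mult_left[OF lim] lim2]) (use lo in auto)
  have h_hi: "norm x \<le> hi * h x" for x
    by (rule LIMSEQ_le[OF lim2 tendsto_mult_left[OF lim]]) (use hi in auto)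
  have h_nonneg: "0 \<le> h x" for x by (simp add: h_def suminf_nonneg summ)
  have h0: "h x = 0 \<longleftrightarrow> x = 0" for x
  proof
    show "h x = 0 \<Longrightarrow> x = 0" using h_hi[of x] by simp
    show "x = 0 \<Longrightarrow> h x = 0" using h_lo[of x] pos(1) h_nonneg[of x] by (simp add: mult_le_0_iff)
  qed
  have h_smul: "h (smul c x) = norm c * h x" for c x
    by (simp add: h_def coef_smul norm_mult power_mult_distrib suminf_mult[OF summ] real_sqrt_mult)
  have h_add: "h (x + y) \<le> h x + h y" for x y
  proof (rule LIMSEQ_le[OF lim tendsto_add[OF lim lim]], intro exI allI impI)
    fix M
    have "L2_set (\<lambda>k. norm (coef (x + y) k)) {..<M} \<le> L2_set (\<lambda>k. norm (coef x k) + norm (coef y k)) {..<M}"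
      by (rule L2_set_mono) (auto simp: coef_add norm_triangle_ineq)
    then show "L2_set (\<lambda>k. norm (coef (x + y) k)) {..<M} \<le> L2_set (\<lambda>k. norm (coef x k)) {..<M} + L2_set (\<lambda>k. norm (coef y k)) {..<M}"
      by (rule order_trans) (rule L2_set_triangle_ineq)
  qed
  define H where "H = \<lparr>carr = UNIV, scal = smul, nrm = h\<rparr>"
  have normed: "normed_space H"
    using linear_space_whole[of H] h0 h_smul h_add h_nonneg by (auto simp: normed_space_def norm_on_def H_def)
  have hm: "h (x - y) = h (y - x)" for x y
    using nrm_minus_commute[OF normed, of x y] by (simp add: H_def)
  interpret M: Metric_space UNIV "\<lambda>x y. h (x - y)"
  proof
    show "h (x - y) = 0 \<longleftrightarrow> x = y" for x y using h0[of "x - y"] by simp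
    show "h (x - z) \<le> h (x - y) + h (y - z)" for x y z using h_add[of "x - y" "y - z"] by simp
  qed (use h_nonneg hm in auto)
  have complete: "M.mcomplete"
    unfolding M.mcomplete_def
  proof (intro allI impI)
    fix \<sigma> assume c: "M.MCauchy \<sigma>"
    have "Cauchy \<sigma>"
    proof (rule metric_CauchyI)
      fix \<epsilon> :: real assume "\<epsilon> > 0"
      then have "\<epsilon> / hi > 0" using pos by simp
      then obtain M0 where M0: "\<And>m k. M0 \<le> m \<Longrightarrow> M0 \<le> k \<Longrightarrow> h (\<sigma> m - \<sigma> k) < \<epsilon> / hi"
        using c unfolding M.MCauchy_def by metis
      have "dist (\<sigma> m) (\<sigma> k) < \<epsilon>" if "m \<ge> M0" "k \<ge> M0" for m k
        using M0[OF that] h_hi[of "\<sigma> m - \<sigma> k"] pos by (simp add: dist_norm pos_less_divide_eq mult.commute)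
      then show "\<exists>M. \<forall>m\<ge>M. \<forall>n\<ge>M. dist (\<sigma> m) (\<sigma> n) < \<epsilon>" by blast
    qed
    then obtain x where x: "\<sigma> \<longlonglongrightarrow> x" using Cauchy_convergent_iff convergent_def by blast
    have "limitin M.mtopology \<sigma> x sequentially"
      unfolding M.limit_metric_sequentially
    proof (intro conjI allI impI)
      fix \<epsilon> :: real assume "\<epsilon> > 0"
      then have "lo * \<epsilon> > 0" using pos by simp
      then obtain M0 where M0: "\<And>m. m \<ge> M0 \<Longrightarrow> norm (\<sigma> m - x) < lo * \<epsilon>" using LIMSEQ_D[OF x] by metis
      have "h (\<sigma> m - x) < \<epsilon>" if "m \<ge> M0" for m
      proof -
        have "lo * h (\<sigma> m - x) < lo * \<epsilon>" using M0[OF that] h_lo[of "\<sigma> m - x"] by linarith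
        then show ?thesis using pos by simp
      qed
      then show "\<exists>N. \<forall>n\<ge>N. \<sigma> n \<in> UNIV \<and> h (\<sigma> n - x) < \<epsilon>" by auto
    qed simp
    then show "\<exists>x. limitin M.mtopology \<sigma> x sequentially" by blast
  qed
  define ipc where "ipc x y = (\<Sum>k. to_complex (coef x k) * cnj (to_complex (coef y k)))" for x y
  have ipc_summable: "summable (\<lambda>k. to_complex (coef x k) * cnj (to_complex (coef y k)))" for x y
  proof -
    have le: "norm (to_complex (coef x k) * cnj (to_complex (coef y k))) \<le> (norm (coef x k))\<^sup>2 + (norm (coef y k))\<^sup>2" for k
    proof -
      have "norm (coef x k) * norm (coef y k) \<le> 2 * norm (coef x k) * norm (coef y k)" by (simp add: mult_nonneg_nonneg)
      also have "\<dots> \<le> (norm (coef x k))\<^sup>2 + (norm (coef y k))\<^sup>2" by (rule sum_squares_bound)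
      finally show ?thesis by (simp add: norm_mult norm_to_complex)
    qed
    show ?thesis
      by (rule summable_comparison_test'[OF summable_add[OF summ[of x] summ[of y]], where N = 0]) (rule le)
  qed
  \<comment> \<open>The series is summed in the complex numbers and pulled back; over the reals its
    imaginary part vanishes termwise, so it lies in the range of \<open>to_complex\<close>.\<close>
  define ip where "ip x y = inv (to_complex :: 'k \<Rightarrow> complex) (ipc x y)" for x y
  have ip: "to_complex (ip x y) = ipc x y" for x y
  proof -
    have "ipc x y \<in> range (to_complex :: 'k \<Rightarrow> complex)"
    proof (cases "range (to_complex :: 'k \<Rightarrow> complex) = UNIV")
      case False
      then have R: "range (to_complex :: 'k \<Rightarrow> complex) = \<real>" using range_to_complex by blast
      then have "to_complex (c :: 'k) \<in> \<real>" for c by blast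
      then have "Im (to_complex (coef x k) * cnj (to_complex (coef y k))) = 0" for k
        by (simp add: complex_is_Real_iff)
      then have "Im (ipc x y) = 0" unfolding ipc_def by (simp add: Im_suminf[OF ipc_summable] del: times_complex.sel)
      then show ?thesis using R by (simp add: complex_is_Real_iff)
    qed auto
    then show ?thesis by (simp add: ip_def f_inv_into_f)
  qed
  have ip_eqI: "u = v" if "to_complex u = to_complex v" for u v :: 'k using that inj_to_complex by (auto simp: inj_def)
  have ip1: "ip (x + y) z = ip x z + ip y z" for x y z
    by (rule ip_eqI) (simp add: ip to_complex_add ipc_def suminf_add[OF ipc_summable ipc_summable] coef_add distrib_right)
  have ip2: "ip (smul c x) y = c * ip x y" for c x y
    by (rule ip_eqI) (simp add: ip to_complex_mult ipc_def suminf_mult[OF ipc_summable, symmetric] coef_smul mult.assoc)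
  have ip3: "to_complex (ip y x) = cnj (to_complex (ip x y))" for x y
  proof -
    have "cnj (ipc x y) = (\<Sum>k. cnj (to_complex (coef x k) * cnj (to_complex (coef y k))))"
      unfolding ipc_def by (rule bounded_linear.suminf[OF bounded_linear_cnj ipc_summable, symmetric, THEN sym])
    then show ?thesis by (simp add: ip ipc_def mult.commute)
  qed
  have ip4: "ip x x = of_real ((h x)\<^sup>2)" for x
  proof (rule ip_eqI)
    have "ipc x x = (\<Sum>k. complex_of_real ((norm (coef x k))\<^sup>2))"
      unfolding ipc_def by (intro suminf_cong) (metis complex_norm_square norm_to_complex of_real_power)
    also have "\<dots> = of_real (\<Sum>k. (norm (coef x k))\<^sup>2)" by (rule suminf_of_real[OF summ, symmetric])
    finally show "to_complex (ip x x) = to_complex (of_real ((h x)\<^sup>2) :: 'k)"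
      unfolding to_complex_of_real by (simp add: ip h_def suminf_nonneg summ)
  qed
  have H_simps: "carr H = UNIV" "scal H = smul" "nrm H = h" by (simp_all add: H_def)
  have "hilbert_space H"
    unfolding hilbert_space_def
  proof (intro conjI exI[of _ ip])
    show "Metric_space.mcomplete (carr H) (\<lambda>x y. nrm H (x - y))" unfolding H_simps by (rule complete)
    show "\<forall>x\<in>carr H. \<forall>y\<in>carr H. \<forall>z\<in>carr H. ip (x + y) z = ip x z + ip y z" using ip1 by blast
    show "\<forall>c. \<forall>x\<in>carr H. \<forall>y\<in>carr H. ip (scal H c x) y = c * ip x y" unfolding H_simps using ip2 by blast
    show "\<forall>x\<in>carr H. \<forall>y\<in>carr H. to_complex (ip y x) = cnj (to_complex (ip x y))" using ip3 by blast
    show "\<forall>x\<in>carr H. ip x x = of_real ((nrm H x)\<^sup>2)" unfolding H_simps using ip4 by blast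
  qed (rule normed)
  moreover have "isomorphism (whole_space smul) H id"
  proof -
    have "1 / hi > 0" "1 / lo > 0" using pos by auto
    moreover have "1 / hi * norm x \<le> h x \<and> h x \<le> 1 / lo * norm x" for x
      using h_lo[of x] h_hi[of x] pos by (simp add: field_simps)
    ultimately have "\<exists>a>0. \<exists>b>0. \<forall>x. a * norm x \<le> h x \<and> h x \<le> b * norm x" by blast
    then show ?thesis by (simp add: isomorphism_def whole_space_def H_simps linear_map_def)
  qed
  ultimately show ?thesis unfolding hilbertian_def isomorphic_def by blast
qed

lemma skew_block_diagonal:
  assumes N: "admissible n N" and A: "skew (WN n N) A" and nh: "\<not> hilbertian (whole_space smul)"
    and ij: "i \<noteq> j" "l < n" "l' < n"
  shows "entry (A (single (i, l) 1)) (j, l') = 0"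
proof (rule ccontr)
  assume ne: "entry (A (single (i, l) 1)) (j, l') \<noteq> 0"
  note V = admissible_normed_space[OF N]
  have "skew (WN n N) (rotation_generator (i, l) (j, l'))"
    using ij by (intro skew_rotation_generator[OF N skew_plane_map[OF N A] ne]) auto
  then have J: "skew (WN n N) (rotation_generator (k, 0) (k', 0))" if "k \<noteq> k'" for k k'
    using skew_rotation_generator_first_coordinates[OF N _ ij that] by blast
  define \<kappa> where "\<kappa> = N (single (0, 0) 1)"
  have n: "n > 0" using ij by simp
  have "single (0, 0) 1 \<noteq> (0 :: nat \<Rightarrow> nat \<Rightarrow> 'k)" by (auto simp: single_def fun_eq_iff)
  then have \<kappa>: "\<kappa> > 0" using nrm_nonneg[OF V, of "single (0, 0) 1"] nrm_eq_zero[OF V, of "single (0, 0) 1"] single_carr[of "(0, 0)" n 1] n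
    by (simp add: \<kappa>_def)
  obtain a where a: "a > 0" "\<And>x. x \<in> carr (W n) \<Longrightarrow> a * nrm (W n) x \<le> N x" using admissible_lower[OF N] by blast
  obtain b where b: "b > 0" "\<And>x. x \<in> carr (W n) \<Longrightarrow> N x \<le> b * nrm (W n) x" using admissible_upper[OF N] by blast
  have zc: "(\<Sum>k<M. single (k, 0) (c k)) \<in> carr (W n)" for c M
    using n by (intro linear_space_sum[OF linear_space_W] single_carr) auto
  have Nz: "N (\<Sum>k<M. single (k, 0) (c k)) = L2_set (\<lambda>k. norm (c k)) {..<M} * \<kappa>" for c M
  proof (cases M)
    case 0
    then show ?thesis using nrm_zero[OF V] by simp
  next
    case (Suc M')
    then show ?thesis
      using nrm_rotatable_span[OF N, of "\<lambda>k. (k, 0)" M' c] n J by (auto simp: \<kappa>_def lessThan_Suc_atMost inj_on_def)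
  qed
  \<comment> \<open>A vector with a single nonzero coordinate in each block has block norms equal to
    the moduli of its coefficients; the first coordinates thus carry an isometric copy of the span
    of the basis.\<close>
  have Wz: "nrm (W n) (\<Sum>k<M. single (k, 0) (c k)) = norm (\<Sum>k<M. smul (c k) (e k))" for c M
  proof -
    have z: "(\<Sum>k<M. single (k, 0) (c k)) p m = (if p < M \<and> m = 0 then c p else 0)" for p m
      by (auto simp: sum_apply2 single_def)
    have "blk n (\<lambda>m. if p < M \<and> m = 0 then c p else 0) = norm (c p)" if "p < M" for p
      using that n by (simp add: L2_set_def if_distrib[of norm] if_distrib[of "\<lambda>x. x\<^sup>2"] cong: if_cong)
    then have "(\<Sum>k<M. blk n ((\<Sum>k<M. single (k, 0) (c k)) k) *\<^sub>R e k) = (\<Sum>k<M. norm (c k) *\<^sub>R e k)"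
      unfolding z[abs_def] by (intro sum.cong) (auto simp: z)
    then show ?thesis
      using finite_support_carr(2)[of "{..<M}" "\<Sum>k<M. single (k, 0) (c k)" n] n by (simp add: z fun_eq_iff norm_sum_smul)
  qed
  have "hilbertian (whole_space smul)"
  \<comment> \<open>On this copy \<open>N\<close> is \<open>\<kappa>\<close> times the square-sum
    norm; dividing by the equivalence constants \<open>b\<close> and \<open>a\<close> of
    \<open>N\<close> gives the two bounds.\<close>
  proof (rule hilbertian_if_equivalent_to_l2[of "\<kappa> / b" "\<kappa> / a"])
    fix c M
    show "\<kappa> / b * L2_set (\<lambda>k. norm (c k)) {..<M} \<le> norm (\<Sum>k<M. smul (c k) (e k))"
      using b(2)[OF zc, of c M] b(1) unfolding Nz Wz by (simp add: field_simps)
    show "norm (\<Sum>k<M. smul (c k) (e k)) \<le> \<kappa> / a * L2_set (\<lambda>k. norm (c k)) {..<M}"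
      using a(2)[OF zc, of c M] a(1) unfolding Nz Wz by (simp add: field_simps)
  qed (use \<kappa> a b in auto)
  then show False using nh by simp
qed

end

section \<open>Isometries permute the blocks\<close>

text \<open>The hypotheses say that \<open>a + b J\<close> is idempotent for some \<open>J\<close>
  with square -1. Apart from \<open>b = 0\<close> this leaves \<open>a = 1 / 2\<close> and
  \<open>2 * b\<close> a square root of -1.\<close>

lemma idempotent_complex_number:
  fixes a b :: "'k::real_or_complex"
  assumes "a * a - b * b = a" "a * b + b * a = b" "b \<noteq> 0"
  shows "(2 * b) * (2 * b) = -1" "norm (2 * b) = 1"
proof -
  have "(2 * a - 1) * b = 0" using assms(2) by (simp add: algebra_simps)
  then have a: "a = 1 / 2" using assms(3) by (simp add: field_simps)
  have "b * b = a * a - a" using assms(1) by (simp add: algebra_simps)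
  moreover have "(2 * b) * (2 * b) = 4 * (b * b)" by (simp add: algebra_simps)
  ultimately show 1: "(2 * b) * (2 * b) = -1" by (simp only: a) simp
  have "norm ((2 * b) * (2 * b)) = 1" unfolding 1 by simp
  then have "(norm (2 * b))\<^sup>2 = 1" unfolding norm_mult[of "2 * b"] by (simp add: power2_eq_square)
  then show "norm (2 * b) = 1" using norm_ge_zero[of "2 * b"] unfolding power2_eq_1_iff by linarith
qed

text \<open>The usual bound on the size of an independent set in the span of \<open>m\<close>
  vectors, phrased for a family and its coefficient sums, which is the form in which an injective
  linear map provides independence.\<close>

lemma independent_coordinates_le:
  fixes v :: "nat \<Rightarrow> nat \<Rightarrow> 'k::field"
  assumes supp: "\<And>l j. l < n \<Longrightarrow> j \<ge> m \<Longrightarrow> v l j = 0"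
    and ind: "\<And>c. (\<And>j. (\<Sum>l<n. c l * v l j) = 0) \<Longrightarrow> (\<And>l. l < n \<Longrightarrow> c l = 0)"
  shows "n \<le> m"
proof -
  interpret vs: vector_space "\<lambda>(c::'k) (v::nat \<Rightarrow> 'k) j. c * v j"
    by standard (auto simp: fun_eq_iff algebra_simps)
  have app: "(\<Sum>i\<in>I. f i) j = (\<Sum>i\<in>I. f i j)" for I :: "'i set" and f :: "'i \<Rightarrow> nat \<Rightarrow> 'k" and j
    by (induction I rule: infinite_finite_induct) auto
  have inj: "inj_on v {..<n}"
  proof (rule inj_onI)
    fix l l' assume l: "l \<in> {..<n}" "l' \<in> {..<n}" "v l = v l'"
    show "l = l'"
    proof (rule ccontr)
      assume ne: "l \<noteq> l'"
      \<comment> \<open>If two members of the family coincided, these coefficients would be a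
        nontrivial relation.\<close>
      let ?c = "\<lambda>i. (if i = l then 1 else 0) - (if i = l' then 1 else 0) :: 'k"
      have "?c i * v i j = (if i = l then v i j else 0) - (if i = l' then v i j else 0)" for i j by auto
      then have "(\<Sum>i<n. ?c i * v i j) = v l j - v l' j" for j using l by (simp add: sum_subtractf)
      then have "?c l = 0" using ind[of ?c l] l by simp
      then show False using ne by simp
    qed
  qed
  have "vs.independent (v ` {..<n})"
  proof
    assume "vs.dependent (v ` {..<n})"
    then obtain u x where u: "x \<in> v ` {..<n}" "u x \<noteq> 0" "(\<Sum>y\<in>v ` {..<n}. (\<lambda>j. u y * y j)) = 0"
      unfolding vs.dependent_finite[OF finite_imageI[OF finite_lessThan]] by blast
    then have "(\<Sum>l<n. (\<lambda>j. u (v l) * v l j)) = 0" by (simp add: sum.reindex[OF inj])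
    then have "(\<Sum>l<n. u (v l) * v l j) = 0" for j using app[of "\<lambda>l j. u (v l) * v l j" "{..<n}" j] by simp
    then have "u (v l) = 0" if "l < n" for l using ind[of "\<lambda>l. u (v l)" l] that by blast
    then show False using u by auto
  qed
  moreover define d where "d i = (\<lambda>j. if j = i then 1 else 0 :: 'k)" for i :: nat
  have "v ` {..<n} \<subseteq> vs.span (d ` {..<m})"
  proof
    fix x assume "x \<in> v ` {..<n}"
    then have x: "x j = 0" if "j \<ge> m" for j using supp that by auto
    have "x = (\<Sum>i<m. (\<lambda>j. x i * d i j))"
    proof
      fix j
      have "x i * d i j = (if i = j then x i else 0)" for i by (simp add: d_def)
      then show "x j = (\<Sum>i<m. (\<lambda>j. x i * d i j)) j" using x[of j] by (simp add: app)
    qed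
    moreover have "(\<Sum>i<m. (\<lambda>j. x i * d i j)) \<in> vs.span (d ` {..<m})"
      by (intro vs.span_sum vs.span_scale vs.span_base) auto
    ultimately show "x \<in> vs.span (d ` {..<m})" by simp
  qed
  ultimately have "card (v ` {..<n}) \<le> card (d ` {..<m})"
    using vs.independent_span_bound[of "d ` {..<m}" "v ` {..<n}"] by simp
  also have "\<dots> \<le> m" using card_image_le[of "{..<m}" d] by simp
  finally show ?thesis using card_image[OF inj] by simp
qed

context symmetric_basis
begin

text \<open>Each cut of \<open>z\<close> is a finite sum of singles and is annihilated by
  \<open>D\<close>; since the cuts converge to \<open>z\<close>, boundedness gives
  \<open>D z = 0\<close>.\<close>

lemma zero_if_zero_on_singles:
  assumes V: "normed_space V" and D: "linear_map (W n) V D"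
    and b: "\<And>z. z \<in> carr (W n) \<Longrightarrow> nrm V (D z) \<le> C * nrm (W n) z"
    and s: "\<And>p c. snd p < n \<Longrightarrow> D (single p c) = 0"
    and z: "z \<in> carr (W n)"
  shows "D z = 0"
proof -
  note L = linear_space_W
  have c0: "D (cut {..<M} z) = 0" for M
  proof -
    have "D (cut {..<M} z) = (\<Sum>k<M. D (\<Sum>l<n. single (k, l) (z k l)))"
      unfolding cut_eq_sum[OF z finite_lessThan]
      by (rule linear_map_sum[OF L D]) (auto intro!: linear_space_sum[OF L] single_carr)
    also have "\<dots> = (\<Sum>k<M. \<Sum>l<n. D (single (k, l) (z k l)))"
      by (intro sum.cong refl linear_map_sum[OF L D] single_carr) auto
    also have "\<dots> = 0" by (simp add: s)
    finally show ?thesis .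
  qed
  have le: "nrm V (D z) \<le> C * nrm (W n) (z - cut {..<M} z)" for M
  proof -
    have "D (z - cut {..<M} z) = D z" using linear_map_diff[OF L D z cut_carr(1)[OF z]] c0 by simp
    then show ?thesis using b[OF linear_space_diff[OF L z cut_carr(1)[OF z, of "{..<M}"]]] by simp
  qed
  have "(\<lambda>M. C * nrm (W n) (z - cut {..<M} z)) \<longlonglongrightarrow> C * 0"
    by (rule tendsto_mult_left[OF cut_tendsto[OF z]])
  then have "nrm V (D z) \<le> C * 0" by (rule LIMSEQ_le_const) (use le in auto)
  then have "nrm V (D z) = 0" using nrm_nonneg[OF V linear_map_carr[OF D z]] by simp
  then show ?thesis using nrm_eq_zero[OF V linear_map_carr[OF D z]] by simp
qed

text \<open>The commutator with a block projection is bounded, and block diagonality makes it vanish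
  on singles.\<close>

lemma skew_commutes_with_cut:
  assumes N: "admissible n N" and A: "skew (WN n N) A" and nh: "\<not> hilbertian (whole_space smul)"
    and z: "z \<in> carr (W n)"
  shows "A (cut {i} z) = cut {i} (A z)"
proof -
  note V = admissible_normed_space[OF N]
  have lA: "linear_map (W n) (W n) A" using skew_linear_map[OF A] by (simp add: linear_map_def)
  note lc = cut_linear[of n "{i}"]
  have ldiff: "linear_map (W n) (W n) (\<lambda>z. A (cut {i} z) - cut {i} (A z))"
    using linear_map_compose[OF lc lA] linear_map_compose[OF lA lc] linear_space_diff[OF linear_space_W[of n]]
    unfolding linear_map_def by (simp add: Pi_iff scal_W) (auto simp: fun_eq_iff algebra_simps)
  obtain K where K: "K \<ge> 0" "\<And>x. x \<in> carr (W n) \<Longrightarrow> N (A x) \<le> K * N x"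
    using skew_bounded[OF V A] by auto
  obtain a where a: "a > 0" "\<And>x. x \<in> carr (W n) \<Longrightarrow> a * nrm (W n) x \<le> N x" using admissible_lower[OF N] by blast
  obtain b where b: "b > 0" "\<And>x. x \<in> carr (W n) \<Longrightarrow> N x \<le> b * nrm (W n) x" using admissible_upper[OF N] by blast
  \<comment> \<open>Skewness bounds \<open>A\<close> for \<open>N\<close>; returning to the original
    norm costs the factor \<open>b / a\<close>.\<close>
  have A_bd: "nrm (W n) (A x) \<le> K * b / a * nrm (W n) x" if x: "x \<in> carr (W n)" for x
  proof -
    have "a * nrm (W n) (A x) \<le> N (A x)" using a(2) linear_map_carr[OF lA x] .
    also have "\<dots> \<le> K * N x" by (rule K(2)[OF x])
    also have "\<dots> \<le> K * (b * nrm (W n) x)" by (rule mult_left_mono[OF b(2)[OF x] K(1)])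
    finally show ?thesis using a(1) by (simp add: field_simps)
  qed
  have "nrm (W n) (A (cut {i} x) - cut {i} (A x)) \<le> (2 * (K * b / a)) * nrm (W n) x" if x: "x \<in> carr (W n)" for x
  proof -
    note cx = cut_carr[OF x, of "{i}"] and ax = linear_map_carr[OF lA x]
    have "nrm (W n) (A (cut {i} x) - cut {i} (A x)) \<le> nrm (W n) (A (cut {i} x)) + nrm (W n) (cut {i} (A x))"
      by (rule nrm_diff[OF normed_space_W linear_map_carr[OF lA cx(1)] cut_carr(1)[OF ax]])
    moreover have "nrm (W n) (A (cut {i} x)) \<le> K * b / a * nrm (W n) (cut {i} x)" by (rule A_bd[OF cx(1)])
    moreover have "K * b / a * nrm (W n) (cut {i} x) \<le> K * b / a * nrm (W n) x"
      by (rule mult_left_mono[OF cx(2)]) (use K a b in simp)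
    moreover have "nrm (W n) (cut {i} (A x)) \<le> nrm (W n) (A x)" by (rule cut_carr(2)[OF ax])
    ultimately show ?thesis using A_bd[OF x] by linarith
  qed
  moreover have "A (cut {i} (single p c)) - cut {i} (A (single p c)) = 0" if p: "snd p < n" for p c
  proof -
    have A0: "A 0 = 0" by (rule linear_map_zero[OF linear_space_W lA])
    have Ap: "A (single p c) = scal (W n) c (A (single p 1))"
      using linear_map_scal[OF lA single_carr[OF p], of c 1] by (simp add: scal_single)
    have Apc: "A (single p 1) \<in> carr (W n)" by (rule linear_map_carr[OF lA single_carr[OF p]])
    have off: "A (single p 1) j l' = 0" if "j \<noteq> fst p" for j l'
    proof (cases "l' < n")
      case True
      then show ?thesis using skew_block_diagonal[OF N A nh, of "fst p" j "snd p" l'] that p by (simp add: entry_def)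
    qed (use Apc in \<open>simp add: carr_W\<close>)
    show ?thesis
    proof (cases "fst p = i")
      case True
      have "cut {i} (single p c) = single p c" "cut {i} (A (single p c)) = A (single p c)"
        using off True unfolding Ap by (auto simp: cut_def single_def fun_eq_iff scal_W)
      then show ?thesis by simp
    next
      case False
      have "cut {i} (single p c) = 0" "cut {i} (A (single p c)) = 0"
        using off False unfolding Ap by (auto simp: cut_def single_def fun_eq_iff scal_W)
      then show ?thesis using A0 by simp
    qed
  qed
  ultimately have "A (cut {i} z) - cut {i} (A z) = 0"
    using zero_if_zero_on_singles[OF normed_space_W ldiff _ _ z] by blast
  then show ?thesis by simp
qed

lemma cut_idem: "cut F (cut F z) = cut F z"
  by (simp add: cut_def fun_eq_iff)

section \<open>An isometry between two admissible renormings, possibly with different block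
  dimensions\<close>

context
  fixes n m :: nat and N M :: "(nat \<Rightarrow> nat \<Rightarrow> 'k) \<Rightarrow> real" and T S :: "(nat \<Rightarrow> nat \<Rightarrow> 'k) \<Rightarrow> nat \<Rightarrow> nat \<Rightarrow> 'k"
  assumes nh: "\<not> hilbertian (whole_space smul)"
    and N: "admissible n N" and M: "admissible m M"
    and T: "surjective_isometry (WN n N) (WN m M) T" and S: "surjective_isometry (WN m M) (WN n N) S"
    and ST: "\<And>x. x \<in> carr (W n) \<Longrightarrow> S (T x) = x" and TS: "\<And>y. y \<in> carr (W m) \<Longrightarrow> T (S y) = y"
    and n2: "n \<ge> 2"
begin

lemma lT: "linear_map (W n) (W m) T" and lS: "linear_map (W m) (W n) S"
  using S T by (auto simp: surjective_isometry_def linear_map_def)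

text \<open>The transported map \<open>T J S\<close> is skew on the target and hence commutes with
  the block projections there; pulling this relation back gives the commutation on the
  source.\<close>

lemma conjugated_cut_commutes:
  assumes J: "skew (WN n N) J" and z: "z \<in> carr (W n)"
  shows "S (cut {i} (T (J z))) = J (S (cut {i} (T z)))"
proof -
  have A: "skew (WN m M) (\<lambda>y. T (J (S y)))"
    by (rule skew_conj[OF admissible_normed_space[OF N] admissible_normed_space[OF M] J T S]) (use TS in simp)
  have Tz: "T z \<in> carr (W m)" by (rule linear_map_carr[OF lT z])
  have "T (J (S (cut {i} (T z)))) = cut {i} (T (J (S (T z))))"
    by (rule skew_commutes_with_cut[OF M A nh Tz])
  moreover have "S (cut {i} (T z)) \<in> carr (W n)" by (rule linear_map_carr[OF lS cut_carr(1)[OF Tz]])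
  then have "J (S (cut {i} (T z))) \<in> carr (W n)" using linear_map_carr[OF skew_linear_map[OF J]] by simp
  ultimately show ?thesis using ST[of "J (S (cut {i} (T z)))"] ST[OF z] by simp
qed

text \<open>On a plane, the conjugated block projection commutes with a rotation generator, so it is an idempotent
  of the form \<open>a + b J\<close>. Over the reals this forces \<open>b = 0\<close>; over the complex numbers the generator
  rotated by a phase excludes the remaining idempotents.\<close>

lemma conjugated_cut_on_plane:
  assumes l: "l < n" "l' < n" "l \<noteq> l'"
  obtains a where "a = 0 \<or> a = 1"
    "S (cut {i} (T (single (k, l) 1))) = single (k, l) a" "S (cut {i} (T (single (k, l') 1))) = single (k, l') a"
proof -
  define p where "p = (k, l)"
  define q where "q = (k, l')"
  define Q where "Q z = S (cut {i} (T z))" for z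
  have pq: "p \<noteq> q" "snd p < n" "snd q < n" using l by (auto simp: p_def q_def)
  let ?J = "rotation_generator p q"
  have J: "skew (WN n N) ?J" unfolding p_def q_def by (rule skew_block_rotation_generator[OF N l])
  have lQ: "linear_map (W n) (W n) Q"
    using linear_map_compose[OF linear_map_compose[OF lT cut_linear[of m "{i}"]] lS] by (simp add: comp_def Q_def[abs_def])
  have QJ: "Q (A z) = A (Q z)" if "skew (WN n N) A" "z \<in> carr (W n)" for A z
    unfolding Q_def by (rule conjugated_cut_commutes[OF that])
  have sc: "single p c \<in> carr (W n)" "single q c \<in> carr (W n)" for c using pq by (auto intro: single_carr)
  define a where "a = entry (Q (single p 1)) p"
  define b where "b = entry (Q (single p 1)) q"
  have Jp: "?J (single p 1) = single q 1" and Jq: "?J (single q 1) = - single p 1"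
    using pq(1) unfolding rotation_generator_def entry_single by (auto simp: single_def fun_eq_iff)
  have Qq: "Q (single q 1) = single q a - single p b"
    using QJ[OF J sc(1), of 1] unfolding Jp by (simp add: rotation_generator_def a_def b_def)
  have eq: "entry (Q (single q 1)) p = - b" "entry (Q (single q 1)) q = a"
    unfolding Qq using pq(1) by (auto simp: entry_diff entry_single)
  \<comment> \<open>Writing minus the unit vector at \<open>p\<close> as \<open>?J\<close> of the
    one at \<open>q\<close> puts its image under \<open>Q\<close> into the range of
    \<open>?J\<close>. Hence \<open>Q\<close> has no component outside the plane.\<close>
  have "- Q (single p 1) = Q (- single p 1)"
    using linear_map_uminus[OF linear_space_W lQ sc(1), of 1] by simp
  also have "\<dots> = single q (- b) - single p a"
    using QJ[OF J sc(2), of 1] unfolding Jq by (simp add: rotation_generator_def eq)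
  finally have "Q (single p 1) = - (single q (- b) - single p a)" by (metis minus_minus)
  also have "\<dots> = single p a + single q b" by (auto simp: single_def fun_eq_iff)
  finally have Qp: "Q (single p 1) = single p a + single q b" .
  have Qs: "Q (single r c) = scal (W n) c (Q (single r 1))" if "snd r < n" for r c
    using linear_map_scal[OF lQ single_carr[OF that], of c 1] by (simp add: scal_single)
  have "Q (Q (single p 1)) = Q (single p 1)"
    unfolding Q_def using TS[of "cut {i} (T (single p 1))"] linear_map_carr[OF lT sc(1)] cut_carr(1) by (simp add: cut_idem)
  moreover have "Q (Q (single p 1)) = scal (W n) a (single p a + single q b) + scal (W n) b (single q a - single p b)"
    unfolding Qp linear_map_add[OF lQ sc(1) sc(2)] Qs[OF pq(2), of a] Qs[OF pq(3), of b] Qq ..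
  ultimately have I: "scal (W n) a (single p a + single q b) + scal (W n) b (single q a - single p b) = single p a + single q b"
    using Qp by simp
  have I1: "a * a - b * b = a" and I2: "a * b + b * a = b"
    using arg_cong[OF I, of "\<lambda>z. entry z p"] arg_cong[OF I, of "\<lambda>z. entry z q"] pq(1)
    by (auto simp: entry_add entry_diff entry_scal entry_single)
  have b: "b = 0"
  proof (rule ccontr)
    assume ne: "b \<noteq> 0"
    \<comment> \<open>With this square root of -1 the conjugate \<open>?J'\<close> has the entries
      \<open>\<iota>\<close> and \<open>- 1 / \<iota>\<close>. Commutation with it compares
      \<open>\<iota> * b\<close> with \<open>b / \<iota>\<close> and forces
      \<open>\<iota> * \<iota> = 1\<close>, a contradiction.\<close>
    define \<iota> where "\<iota> = 2 * b"
    have \<iota>: "\<iota> * \<iota> = -1" "norm \<iota> = 1" "\<iota> \<noteq> 0" using idempotent_complex_number[OF I1 I2 ne] ne by (auto simp: \<iota>_def)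
    let ?J' = "\<lambda>z. phase q \<iota> (?J (phase q (1 / \<iota>) z))"
    have J': "skew (WN n N) ?J'"
      using \<iota> by (intro skew_conj_isometry[OF N J] phase_isometry phase_inverse) (auto simp: norm_divide)
    have J'p: "?J' (single p 1) = single q \<iota>"
      using l(3) by (auto simp: phase_def rotation_generator_def single_def entry_def fun_eq_iff p_def q_def)
    have "entry (Q (single q \<iota>)) p = - (\<iota> * b)" using eq Qs[OF pq(3), of \<iota>] by (simp add: entry_scal)
    moreover have "entry (?J' (Q (single p 1))) p = - (1 / \<iota> * b)"
      unfolding Qp using l(3) by (auto simp: phase_def rotation_generator_def single_def entry_def p_def q_def)
    ultimately have "\<iota> * b = 1 / \<iota> * b" using QJ[OF J' sc(1), of 1] unfolding J'p by simp
    then have "\<iota> = 1 / \<iota>" by (rule mult_right_cancel[OF ne, THEN iffD1])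
    then have "\<iota> * \<iota> = 1 / \<iota> * \<iota>" by (rule arg_cong)
    then have "\<iota> * \<iota> = 1" using \<iota>(3) by simp
    then show False using \<iota>(1) by simp
  qed
  have "a * (a - 1) = 0" using I1 b by (simp add: algebra_simps)
  then have "a = 0 \<or> a = 1" by simp
  moreover have "single p (0 :: 'k) = 0" "single q (0 :: 'k) = 0" by (auto simp: single_def fun_eq_iff)
  ultimately show ?thesis using that[of a] Qp Qq b by (simp add: Q_def p_def q_def)
qed

text \<open>The target block is any block \<open>i\<close> in which the image of the first unit
  vector of block \<open>k\<close> is nonzero. All planes of block \<open>k\<close> through
  coordinate 0 share the value 0 or 1 of the conjugated projection, and 0 is excluded by the choice
  of \<open>i\<close>.\<close>

lemma isometry_maps_blocks: "\<exists>\<pi>. \<forall>k l. l < n \<longrightarrow> cut {\<pi> k} (T (single (k, l) 1)) = T (single (k, l) 1)"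
proof -
  have "\<exists>i. \<forall>l<n. cut {i} (T (single (k, l) 1)) = T (single (k, l) 1)" for k
  proof -
    have n0: "0 < n" using n2 by simp
    have sc: "single (k, l) c \<in> carr (W n)" if "l < n" for l c using that by (auto intro: single_carr)
    have "T (single (k, 0) 1) \<noteq> 0"
    proof
      assume "T (single (k, 0) 1) = 0"
      then have "single (k, 0) 1 = S 0" using ST[OF sc[OF n0, of 1]] by simp
      then have "single (k, 0) (1::'k) = 0" using linear_map_zero[OF linear_space_W lS] by simp
      then show False by (metis entry_single entry_def zero_fun_apply zero_neq_one)
    qed
    then obtain i where i: "T (single (k, 0) 1) i \<noteq> 0" by (auto simp: fun_eq_iff)
    have ne: "cut {i} (T (single (k, 0) 1)) \<noteq> 0"
      using i by (metis cut_def insertI1 zero_fun_apply)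
    have lift: "cut {i} (T (single (k, l) 1)) = T (S (cut {i} (T (single (k, l) 1))))" if "l < n" for l
      using TS[OF cut_carr(1)[OF linear_map_carr[OF lT sc[OF that, of 1]]]] by simp
    have Tz: "T 0 = 0" by (rule linear_map_zero[OF linear_space_W lT])
    have s0: "single p (0 :: 'k) = 0" for p by (auto simp: single_def fun_eq_iff)
    have one: "S (cut {i} (T (single (k, 0) 1))) = single (k, 0) 1 \<and> S (cut {i} (T (single (k, l) 1))) = single (k, l) 1" if l: "0 < l" "l < n" for l
    proof -
      obtain a where a: "a = 0 \<or> a = 1"
        "S (cut {i} (T (single (k, 0) 1))) = single (k, 0) a" "S (cut {i} (T (single (k, l) 1))) = single (k, l) a"
        using conjugated_cut_on_plane[OF n0 l(2), of i k] l(1) by blast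
      have "a \<noteq> 0"
      proof
        assume "a = 0"
        then have "cut {i} (T (single (k, 0) 1)) = 0" using lift[OF n0] a(2) s0 Tz by metis
        then show False using ne by simp
      qed
      then show ?thesis using a by auto
    qed
    \<comment> \<open>Coordinate 0 is settled by its plane with coordinate 1, which exists because
      \<open>n \<ge> 2\<close>.\<close>
    have "S (cut {i} (T (single (k, l) 1))) = single (k, l) 1" if "l < n" for l
      using one[of l] one[of 1] n2 that by (cases "l = 0") auto
    then have "\<forall>l<n. cut {i} (T (single (k, l) 1)) = T (single (k, l) 1)" using lift by metis
    then show ?thesis by blast
  qed
  then show ?thesis by metis
qed

text \<open>Block 0 is mapped injectively into one block of the target, and the images of its
  \<open>n\<close> unit vectors are independent vectors with \<open>m\<close> coordinates.\<close>

lemma isometry_block_dimension_le: "n \<le> m"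
proof -
  obtain \<pi> where \<pi>: "\<And>k l. l < n \<Longrightarrow> cut {\<pi> k} (T (single (k, l) 1)) = T (single (k, l) 1)"
    using isometry_maps_blocks by blast
  define v where "v l = T (single (0, l) 1) (\<pi> 0)" for l
  have sc: "single (0, l) c \<in> carr (W n)" if "l < n" for l c using that by (auto intro: single_carr)
  have Tc: "T (single (0, l) 1) \<in> carr (W m)" if "l < n" for l by (rule linear_map_carr[OF lT sc[OF that]])
  have off: "T (single (0, l) 1) j = 0" if "l < n" "j \<noteq> \<pi> 0" for l j
    using fun_cong[OF \<pi>[OF that(1), of 0], of j] that(2) by (simp add: cut_def)
  show ?thesis
  proof (rule independent_coordinates_le[where v = v])
    show "v l j = 0" if "l < n" "m \<le> j" for l j
      using Tc[OF that(1)] that(2) by (simp add: v_def carr_W)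
  next
    fix c :: "nat \<Rightarrow> 'k" and l assume c: "\<And>j. (\<Sum>l<n. c l * v l j) = 0" and l: "l < n"
    let ?z = "\<Sum>l<n. single (0, l) (c l)"
    have "T ?z = (\<Sum>l<n. T (single (0, l) (c l)))"
      by (rule linear_map_sum[OF linear_space_W lT]) (use sc in auto)
    also have "\<dots> = (\<Sum>l<n. scal (W m) (c l) (T (single (0, l) 1)))"
    proof (rule sum.cong[OF refl])
      fix i assume "i \<in> {..<n}"
      then show "T (single (0, i) (c i)) = scal (W m) (c i) (T (single (0, i) 1))"
        using linear_map_scal[OF lT sc[of i 1], of "c i"] by (simp add: scal_single)
    qed
    also have "\<dots> = 0"
    proof (intro ext)
      fix j q
      show "(\<Sum>l<n. scal (W m) (c l) (T (single (0, l) 1))) j q = 0 j q"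
        using c[of q] off by (cases "j = \<pi> 0") (auto simp: sum_apply2 scal_W v_def)
    qed
    finally have "T ?z = 0" .
    moreover have "?z \<in> carr (W n)" by (intro linear_space_sum[OF linear_space_W]) (use sc in auto)
    ultimately have "?z = 0" using ST[of ?z] linear_map_zero[OF linear_space_W lS] by simp
    then have "entry ?z (0, l) = 0" by (simp add: entry_def)
    moreover have "entry ?z (0, l) = c l"
      using l entry_sum_single(1)[of "{..<n}" "\<lambda>l. (0, l)" l c] by (simp add: inj_on_def)
    ultimately show "c l = 0" by simp
  qed
qed

end

end

section \<open>Maximality and the isomorphism with the base space\<close>

text \<open>Isometry is unaffected by values off the carrier, so inclusions between the sets of
  extensional isometries become implications for arbitrary functions, which can be composed without
  restricting.\<close>

lemma maximal_isometry_group_iff: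
  assumes V: "linear_space V"
  shows "maximal_isometry_group V \<longleftrightarrow>
    (\<forall>N. equivalent_norm V N \<and> (\<forall>g. surjective_isometry V V g \<longrightarrow> surjective_isometry (V\<lparr>nrm := N\<rparr>) (V\<lparr>nrm := N\<rparr>) g) \<longrightarrow>
       (\<forall>g. surjective_isometry (V\<lparr>nrm := N\<rparr>) (V\<lparr>nrm := N\<rparr>) g \<longrightarrow> surjective_isometry V V g))"
proof -
  have sub: "Isom A \<subseteq> Isom B \<longleftrightarrow> (\<forall>g. surjective_isometry A A g \<longrightarrow> surjective_isometry B B g)"
    if A: "linear_space A" and B: "linear_space B" and c: "carr A = carr B" for A B
  proof
    assume *: "Isom A \<subseteq> Isom B"
    show "\<forall>g. surjective_isometry A A g \<longrightarrow> surjective_isometry B B g"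
    proof (intro allI impI)
      fix g assume "surjective_isometry A A g"
      then have "restrict g (carr A) \<in> Isom B" using restrict_in_Isom[OF A] * by blast
      then have "surjective_isometry B B (restrict g (carr B))" by (simp add: Isom_def c)
      moreover have "surjective_isometry B B (restrict g (carr B)) \<longleftrightarrow> surjective_isometry B B g"
        by (rule surjective_isometry_cong) (simp_all add: B)
      ultimately show "surjective_isometry B B g" by simp
    qed
  qed (auto simp: Isom_def c)
  have V': "linear_space (V\<lparr>nrm := N\<rparr>)" for N using V by (simp add: linear_space_def)
  show ?thesis
    unfolding maximal_isometry_group_def set_eq_subset
    by (auto simp: sub[OF V V'] sub[OF V' V])
qed

text \<open>A renorming \<open>N\<close> of \<open>V\<close> becomes the renorming \<open>?M\<close>
  of \<open>W\<close> through the inverse of \<open>\<Theta>\<close>, and conjugation with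
  \<open>\<Theta>\<close> exchanges the isometries for all four norms.\<close>

lemma maximal_isometry_group_transfer:
  assumes V: "normed_space V" and W: "normed_space W" and \<Theta>: "surjective_isometry V W \<Theta>"
    and max: "maximal_isometry_group W"
  shows "maximal_isometry_group V"
  unfolding maximal_isometry_group_iff[OF normed_space_linear[OF V]]
proof (intro allI impI, elim conjE)
  fix N f
  assume N: "equivalent_norm V N"
    and inv: "\<forall>g. surjective_isometry V V g \<longrightarrow> surjective_isometry (V\<lparr>nrm := N\<rparr>) (V\<lparr>nrm := N\<rparr>) g"
    and f: "surjective_isometry (V\<lparr>nrm := N\<rparr>) (V\<lparr>nrm := N\<rparr>) f"
  let ?\<Phi> = "inv_into (carr V) \<Theta>"
  let ?M = "\<lambda>w. N (?\<Phi> w)"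
  let ?V = "V\<lparr>nrm := N\<rparr>" and ?W = "W\<lparr>nrm := ?M\<rparr>"
  have L: "linear_space V" "linear_space W" using V W by (auto simp: normed_space_def)
  have b: "bij_betw \<Theta> (carr V) (carr W)" by (rule surjective_isometry_bij[OF V W \<Theta>])
  have \<Phi>: "surjective_isometry W V ?\<Phi>" by (rule surjective_isometry_inv[OF V W \<Theta>])
  have l: "linear_map W V ?\<Phi>" "linear_map V W \<Theta>" using \<Phi> \<Theta> by (auto simp: surjective_isometry_def)
  have \<Phi>\<Theta>: "?\<Phi> (\<Theta> x) = x" if "x \<in> carr V" for x using b that by (simp add: bij_betw_def)
  have \<Theta>\<Phi>: "\<Theta> (?\<Phi> w) = w" if "w \<in> carr W" for w using b that by (simp add: bij_betw_def f_inv_into_f)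
  have \<Phi>c: "?\<Phi> w \<in> carr V" if "w \<in> carr W" for w using linear_map_carr[OF l(1) that] .
  have \<Theta>c: "\<Theta> x \<in> carr W" if "x \<in> carr V" for x using linear_map_carr[OF l(2) that] .
  have \<Phi>n: "nrm V (?\<Phi> w) = nrm W w" if "w \<in> carr W" for w using \<Phi> that by (simp add: surjective_isometry_def)
  have si\<Phi>: "surjective_isometry ?W ?V ?\<Phi>" using \<Phi> by (simp add: surjective_isometry_def linear_map_def)
  have si\<Theta>: "surjective_isometry ?V ?W \<Theta>" using \<Theta> \<Phi>\<Theta> by (simp add: surjective_isometry_def linear_map_def)
  have no: "norm_on V N" using N by (simp add: equivalent_norm_def)
  have "?\<Phi> w = 0 \<longleftrightarrow> w = 0" if w: "w \<in> carr W" for w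
    using nrm_eq_zero[OF W w] nrm_eq_zero[OF V \<Phi>c[OF w]] \<Phi>n[OF w] by simp
  then have "norm_on W ?M"
    using no \<Phi>c unfolding norm_on_def by (simp add: linear_map_add[OF l(1)] linear_map_scal[OF l(1)])
  moreover obtain a c where "a > 0" "c > 0" "\<And>x. x \<in> carr V \<Longrightarrow> a * nrm V x \<le> N x \<and> N x \<le> c * nrm V x"
    using N unfolding equivalent_norm_def by blast
  then have "\<exists>a>0. \<exists>b>0. \<forall>w\<in>carr W. a * nrm W w \<le> ?M w \<and> ?M w \<le> b * nrm W w"
    using \<Phi>c \<Phi>n by metis
  ultimately have "equivalent_norm W ?M" by (simp add: equivalent_norm_def)
  moreover have "surjective_isometry ?W ?W g" if g: "surjective_isometry W W g" for g
  proof -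
    have gc: "g w \<in> carr W" if "w \<in> carr W" for w using g that by (auto simp: surjective_isometry_def linear_map_def)
    have "surjective_isometry V V (?\<Phi> \<circ> (g \<circ> \<Theta>))"
      by (intro surjective_isometry_compose[OF surjective_isometry_compose[OF \<Theta> g] \<Phi>])
    then have "surjective_isometry ?V ?V (?\<Phi> \<circ> (g \<circ> \<Theta>))" using inv by blast
    then have "surjective_isometry ?W ?W (\<Theta> \<circ> ((?\<Phi> \<circ> (g \<circ> \<Theta>)) \<circ> ?\<Phi>))"
      by (intro surjective_isometry_compose[OF surjective_isometry_compose[OF si\<Phi>] si\<Theta>])
    moreover have "surjective_isometry ?W ?W (\<Theta> \<circ> ((?\<Phi> \<circ> (g \<circ> \<Theta>)) \<circ> ?\<Phi>)) \<longleftrightarrow> surjective_isometry ?W ?W g"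
    proof (rule surjective_isometry_cong)
      show "linear_space ?W" using L(2) by (simp add: linear_space_def)
    qed (simp add: \<Theta>\<Phi> gc)
    ultimately show ?thesis by simp
  qed
  ultimately have *: "\<And>g. surjective_isometry ?W ?W g \<Longrightarrow> surjective_isometry W W g"
    using max unfolding maximal_isometry_group_iff[OF L(2)] by blast
  have fc: "f x \<in> carr V" if "x \<in> carr V" for x using f that by (auto simp: surjective_isometry_def linear_map_def)
  have "surjective_isometry ?W ?W (\<Theta> \<circ> (f \<circ> ?\<Phi>))"
    by (intro surjective_isometry_compose[OF surjective_isometry_compose[OF si\<Phi> f] si\<Theta>])
  then have "surjective_isometry V V (?\<Phi> \<circ> ((\<Theta> \<circ> (f \<circ> ?\<Phi>)) \<circ> \<Theta>))"
    by (intro surjective_isometry_compose[OF surjective_isometry_compose[OF \<Theta> *] \<Phi>])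
  moreover have "surjective_isometry V V (?\<Phi> \<circ> ((\<Theta> \<circ> (f \<circ> ?\<Phi>)) \<circ> \<Theta>)) \<longleftrightarrow> surjective_isometry V V f"
    by (rule surjective_isometry_cong) (simp_all add: \<Phi>\<Theta> fc L)
  ultimately show "surjective_isometry V V f" by simp
qed

context symmetric_basis
begin

lemma admissible_nrm: "admissible n (nrm (W n))"
  using normed_space_W[of n] unfolding admissible_def equivalent_norm_def surjective_isometry_def normed_space_def
  by (metis mult_1 order_refl zero_less_one)

text \<open>Rotations within a block are always skew, so \<open>N\<close> is Euclidean there up to a
  factor; block swaps preserve \<open>N\<close> and make this factor the same for all
  blocks.\<close>

lemma nrm_block:
  assumes N: "admissible n N" and n: "0 < n" and z: "z \<in> carr (W n)"
  shows "N (cut {k} z) = blk n (z k) * N (single (0, 0) 1)"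
proof -
  have "N (single (0, 0) 1 \<circ> Transposition.transpose 0 k) = N (single (0, 0) 1)"
  proof -
    have "single (0, 0) 1 \<in> carr (W n)" using n by (intro single_carr) simp
    then show ?thesis using N block_transpose_isometry[of n 0 k] unfolding admissible_def by blast
  qed
  moreover have "single (0, 0) 1 \<circ> Transposition.transpose 0 k = single (k, 0) (1 :: 'k)"
    by (auto simp: single_def fun_eq_iff Transposition.transpose_def)
  ultimately have k: "N (single (k, 0) 1) = N (single (0, 0) 1)" by simp
  \<comment> \<open>The formula for the span counts positions from 0 up to and including its bound,
    here \<open>n - 1\<close>; \<open>0 < n\<close> keeps the subtraction honest.\<close>
  have n': "{..n - 1} = {..<n}" using n by auto
  have "N (\<Sum>i\<le>n - 1. single (k, i) (z k i)) = L2_set (\<lambda>i. norm (z k i)) {..n - 1} * N (single (k, 0) 1)"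
    by (rule nrm_rotatable_span[OF N, of "\<lambda>i. (k, i)"])
       (use n in \<open>auto simp: inj_on_def intro!: skew_block_rotation_generator[OF N]\<close>)
  then have "N (\<Sum>i<n. single (k, i) (z k i)) = blk n (z k) * N (single (0, 0) 1)"
    by (simp only: n' k)
  then show ?thesis using cut_eq_sum[OF z, of "{k}"] by simp
qed

lemma isometry_maps_block_cuts:
  assumes nh: "\<not> hilbertian (whole_space smul)" and N: "admissible n N" and M: "admissible m M"
    and T: "surjective_isometry (WN n N) (WN m M) T" and S: "surjective_isometry (WN m M) (WN n N) S"
    and ST: "\<And>x. x \<in> carr (W n) \<Longrightarrow> S (T x) = x" and TS: "\<And>y. y \<in> carr (W m) \<Longrightarrow> T (S y) = y"
    and n2: "n \<ge> 2"
  obtains \<pi> where "\<And>k z. z \<in> carr (W n) \<Longrightarrow> cut {\<pi> k} (T (cut {k} z)) = T (cut {k} z)"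
proof -
  have lT: "linear_map (W n) (W m) T" using T by (simp add: surjective_isometry_def linear_map_def)
  obtain \<pi> where \<pi>: "\<And>k l. l < n \<Longrightarrow> cut {\<pi> k} (T (single (k, l) 1)) = T (single (k, l) 1)"
    using isometry_maps_blocks[OF nh N M T S ST TS n2] by blast
  have sc: "single (k, l) c \<in> carr (W n)" if "l < n" for k l c using that by (auto intro: single_carr)
  have "cut {\<pi> k} (T (cut {k} z)) = T (cut {k} z)" if z: "z \<in> carr (W n)" for k z
  proof -
    have "T (cut {k} z) = T (\<Sum>l<n. single (k, l) (z k l))" using cut_eq_sum[OF z, of "{k}"] by simp
    also have "\<dots> = (\<Sum>l<n. T (single (k, l) (z k l)))"
      by (rule linear_map_sum[OF linear_space_W lT]) (use sc in auto)
    finally have T: "T (cut {k} z) = (\<Sum>l<n. T (single (k, l) (z k l)))" .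
    have "cut {\<pi> k} (T (single (k, l) c)) = T (single (k, l) c)" if "l < n" for l c
    proof -
      have "T (single (k, l) c) = scal (W m) c (T (single (k, l) 1))"
        using linear_map_scal[OF lT sc[OF that, of k 1], of c] by (simp add: scal_single)
      then show ?thesis
        using linear_map_scal[OF cut_linear linear_map_carr[OF lT sc[OF that, of k 1]], of "{\<pi> k}" c] \<pi>[OF that, of k] by simp
    qed
    moreover have "cut {\<pi> k} (\<Sum>l<n. T (single (k, l) (z k l))) = (\<Sum>l<n. cut {\<pi> k} (T (single (k, l) (z k l))))"
      by (rule linear_map_sum[OF linear_space_W cut_linear]) (use sc linear_map_carr[OF lT] in auto)
    ultimately show ?thesis unfolding T by (simp cong: sum.cong_simp)
  qed
  then show ?thesis using that by blast
qed

text \<open>For finitely many blocks \<open>T\<close> merely moves the block norms along an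
  injective map \<open>\<pi>\<close> of indices, and the symmetry of the basis makes the original
  norm insensitive to that. Density of such vectors completes the argument.\<close>

lemma isometry_preserves_nrm:
  assumes nh: "\<not> hilbertian (whole_space smul)" and N: "admissible n N" and n2: "n \<ge> 2"
    and T: "surjective_isometry (WN n N) (WN n N) T" and z: "z \<in> carr (W n)"
  shows "nrm (W n) (T z) = nrm (W n) z"
proof -
  note V = admissible_normed_space[OF N]
  note L = linear_space_W
  define S where "S = inv_into (carr (W n)) T"
  have S: "surjective_isometry (WN n N) (WN n N) S" using surjective_isometry_inv[OF V V T] by (simp add: S_def)
  have bij: "bij_betw T (carr (W n)) (carr (W n))" using surjective_isometry_bij[OF V V T] by simp
  have ST: "S (T x) = x" if "x \<in> carr (W n)" for x using bij that by (simp add: bij_betw_def S_def)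
  have TS: "T (S x) = x" if "x \<in> carr (W n)" for x using bij that by (simp add: bij_betw_def S_def f_inv_into_f)
  have lT: "linear_map (W n) (W n) T" using T by (simp add: surjective_isometry_def linear_map_def)
  have TN: "N (T x) = N x" if "x \<in> carr (W n)" for x using T that by (simp add: surjective_isometry_def)
  obtain \<pi> where \<pi>: "\<And>k z. z \<in> carr (W n) \<Longrightarrow> cut {\<pi> k} (T (cut {k} z)) = T (cut {k} z)"
    using isometry_maps_block_cuts[OF nh N N T S ST TS n2] by blast
  obtain \<rho> where \<rho>: "\<And>k z. z \<in> carr (W n) \<Longrightarrow> cut {\<rho> k} (S (cut {k} z)) = S (cut {k} z)"
    using isometry_maps_block_cuts[OF nh N N S T TS ST n2] by blast
  have n0: "0 < n" using n2 by simp
  \<comment> \<open>The block map \<open>\<rho>\<close> of the inverse undoes \<open>\<pi>\<close>,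
    so images of distinct blocks lie in distinct blocks and cannot interfere.\<close>
  have "\<rho> (\<pi> k) = k" for k
  proof -
    let ?w = "single (k, 0) 1 :: nat \<Rightarrow> nat \<Rightarrow> 'k"
    have w: "?w \<in> carr (W n)" using n0 by (auto intro: single_carr)
    have cw: "cut {k} ?w = ?w" by (auto simp: cut_def single_def fun_eq_iff)
    have "cut {\<pi> k} (T ?w) = T ?w" using \<pi>[OF w, of k] by (simp add: cw)
    then have "cut {\<rho> (\<pi> k)} ?w = ?w" using \<rho>[OF linear_map_carr[OF lT w], of "\<pi> k"] ST[OF w] by simp
    then have "cut {\<rho> (\<pi> k)} ?w k 0 = 1" by (simp add: single_def)
    then show ?thesis by (auto simp: cut_def split: if_splits)
  qed
  then have inj: "inj \<pi>" by (metis injI)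
  have "single (0, 0) 1 \<noteq> (0 :: nat \<Rightarrow> nat \<Rightarrow> 'k)" by (auto simp: single_def fun_eq_iff)
  then have \<kappa>: "N (single (0, 0) 1) \<noteq> 0" using nrm_eq_zero[OF V, of "single (0, 0) 1"] single_carr[of "(0, 0)" n 1] n0 by simp
  have blk: "blk n (T (cut {k} z) (\<pi> k)) = blk n (z k)" for k
  proof -
    have c: "cut {k} z \<in> carr (W n)" by (rule cut_carr(1)[OF z])
    have "blk n (T (cut {k} z) (\<pi> k)) * N (single (0, 0) 1) = N (cut {\<pi> k} (T (cut {k} z)))"
      by (rule nrm_block[OF N n0 linear_map_carr[OF lT c], symmetric])
    also have "\<dots> = N (cut {k} z)" using \<pi>[OF z] TN[OF c] by simp
    also have "\<dots> = blk n (z k) * N (single (0, 0) 1)" by (rule nrm_block[OF N n0 z])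
    finally show ?thesis using \<kappa> by simp
  qed
  have fin: "nrm (W n) (T (cut {..<K} z)) = nrm (W n) (cut {..<K} z)" for K
  proof -
    let ?y = "T (cut {..<K} z)"
    have "cut {..<K} z = (\<Sum>k<K. cut {k} z)"
      by (auto simp: fun_eq_iff sum_apply2 cut_def if_distrib[of "\<lambda>f. f _"] cong: if_cong)
    then have y: "?y = (\<Sum>k<K. T (cut {k} z))"
      using linear_map_sum[OF L lT, of "{..<K}" "\<lambda>k. cut {k} z"] cut_carr(1)[OF z] by simp
    have off: "T (cut {k} z) j = 0" if "j \<noteq> \<pi> k" for j k
      using fun_cong[OF \<pi>[OF z, of k], of j] that by (simp add: cut_def)
    have yc: "?y \<in> carr (W n)" by (rule linear_map_carr[OF lT cut_carr(1)[OF z]])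
    have ne: "\<pi> k \<noteq> \<pi> i" if "i \<noteq> k" for i k using inj that by (auto dest: injD)
    have on: "?y (\<pi> k) = T (cut {k} z) (\<pi> k)" if "k < K" for k
    proof
      fix l
      have "?y (\<pi> k) l = (\<Sum>i<K. if i = k then T (cut {k} z) (\<pi> k) l else 0)"
        unfolding y sum_apply2 by (intro sum.cong refl) (use off[OF ne] in auto)
      then show "?y (\<pi> k) l = T (cut {k} z) (\<pi> k) l" using that by simp
    qed
    have "?y j = 0" if "j \<notin> \<pi> ` {..<K}" for j
    proof -
      have "T (cut {i} z) j = 0" if "i < K" for i using off[of j i] \<open>j \<notin> \<pi> ` {..<K}\<close> that by blast
      then show ?thesis unfolding y by (simp add: fun_eq_iff sum_apply2)
    qed
    then have "nrm (W n) ?y = norm (\<Sum>j\<in>\<pi> ` {..<K}. blk n (?y j) *\<^sub>R e j)"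
      using yc by (intro finite_support_carr(2)) (auto simp: carr_W)
    also have "(\<Sum>j\<in>\<pi> ` {..<K}. blk n (?y j) *\<^sub>R e j) = (\<Sum>k<K. blk n (z k) *\<^sub>R e (\<pi> k))"
      using inj blk by (subst sum.reindex) (auto simp: inj_on_def inj_def on intro!: sum.cong)
    also have "norm \<dots> = norm (\<Sum>k<K. blk n (z k) *\<^sub>R e k)"
      using inj by (intro norm_sum_inj) (auto simp: inj_on_def inj_def)
    also have "(\<Sum>k<K. blk n (z k) *\<^sub>R e k) = (\<Sum>k<K. blk n (cut {..<K} z k) *\<^sub>R e k)"
      by (rule sum.cong) (auto simp: cut_def)
    also have "norm \<dots> = nrm (W n) (cut {..<K} z)"
      using z by (intro finite_support_carr(2)[symmetric]) (auto simp: cut_def carr_W)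
    finally show ?thesis .
  qed
  obtain a where a: "a > 0" "\<And>x. x \<in> carr (W n) \<Longrightarrow> a * nrm (W n) x \<le> N x" using admissible_lower[OF N] by blast
  obtain b where b: "b > 0" "\<And>x. x \<in> carr (W n) \<Longrightarrow> N x \<le> b * nrm (W n) x" using admissible_upper[OF N] by blast
  have T_bd: "nrm (W n) (T x) \<le> b / a * nrm (W n) x" if x: "x \<in> carr (W n)" for x
    using a(2)[OF linear_map_carr[OF lT x]] b(2)[OF x] TN[OF x] a(1) by (simp add: field_simps)
  \<comment> \<open>On cuts both norms agree. The error from replacing \<open>z\<close> by a cut is
    at most \<open>b / a\<close> times the tail on the image side and the tail itself on the
    other.\<close>
  have "\<bar>nrm (W n) (T z) - nrm (W n) z\<bar> \<le> (b / a + 1) * nrm (W n) (z - cut {..<K} z)" for K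
  proof -
    let ?c = "cut {..<K} z"
    have c: "?c \<in> carr (W n)" "z - ?c \<in> carr (W n)" using cut_carr(1)[OF z] linear_space_diff[OF L z] by auto
    have Tc: "T z \<in> carr (W n)" "T ?c \<in> carr (W n)" using linear_map_carr[OF lT] z c by auto
    have "nrm (W n) (T z - T ?c) \<le> b / a * nrm (W n) (z - ?c)"
      using T_bd[OF c(2)] linear_map_diff[OF L lT z c(1)] by simp
    moreover have "nrm (W n) (T z) \<le> nrm (W n) (T ?c) + nrm (W n) (T z - T ?c)" "nrm (W n) (T ?c) \<le> nrm (W n) (T z) + nrm (W n) (T z - T ?c)"
      using nrm_triangle3[OF normed_space_W Tc] nrm_triangle3[OF normed_space_W Tc(2,1)] nrm_minus_commute[OF normed_space_W Tc] by auto
    moreover have "nrm (W n) z \<le> nrm (W n) ?c + nrm (W n) (z - ?c)" "nrm (W n) ?c \<le> nrm (W n) z + nrm (W n) (z - ?c)"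
      using nrm_triangle3[OF normed_space_W z c(1)] nrm_triangle3[OF normed_space_W c(1) z] nrm_minus_commute[OF normed_space_W z c(1)] by auto
    ultimately show ?thesis using fin[of K] by (simp add: distrib_right abs_le_iff)
  qed
  moreover have "(\<lambda>K. (b / a + 1) * nrm (W n) (z - cut {..<K} z)) \<longlonglongrightarrow> (b / a + 1) * 0"
    by (rule tendsto_mult_left[OF cut_tendsto[OF z]])
  ultimately have "\<bar>nrm (W n) (T z) - nrm (W n) z\<bar> \<le> (b / a + 1) * 0"
    by (intro LIMSEQ_le_const) auto
  then show ?thesis by simp
qed

lemma maximal_isometry_group_W:
  assumes nh: "\<not> hilbertian (whole_space smul)" and n2: "n \<ge> 2"
  shows "maximal_isometry_group (W n)"
  unfolding maximal_isometry_group_iff[OF linear_space_W]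
proof (intro allI impI, elim conjE)
  fix N g
  assume N: "equivalent_norm (W n) N"
    and inv: "\<forall>g. surjective_isometry (W n) (W n) g \<longrightarrow> surjective_isometry (WN n N) (WN n N) g"
    and g: "surjective_isometry (WN n N) (WN n N) g"
  have "admissible n N" using N inv by (simp add: admissible_def surjective_isometry_def)
  then have "nrm (W n) (g z) = nrm (W n) z" if "z \<in> carr (W n)" for z
    using isometry_preserves_nrm[OF nh _ n2 g that] by blast
  then show "surjective_isometry (W n) (W n) g" using g by (simp add: surjective_isometry_def linear_map_def)
qed

section \<open>Regrouping the basis into blocks of length \<open>n\<close>\<close>

lemma sum_blocks:
  fixes f :: "nat \<Rightarrow> 'x"
  assumes "0 < n"
  shows "(\<Sum>j\<in>{K * n..<M * n}. f j) = (\<Sum>l<n. \<Sum>k\<in>{K..<M}. f (k * n + l))"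
proof -
  have "(\<Sum>l<n. \<Sum>k\<in>{K..<M}. f (k * n + l)) = (\<Sum>(l, k)\<in>{..<n} \<times> {K..<M}. f (k * n + l))"
    by (simp add: sum.cartesian_product)
  also have "\<dots> = (\<Sum>j\<in>{K * n..<M * n}. f j)"
  proof (rule sum.reindex_bij_witness[of _ "\<lambda>j. (j mod n, j div n)" "\<lambda>(l, k). k * n + l"])
    fix j assume j: "j \<in> {K * n..<M * n}"
    then have "K \<le> j div n" "j div n < M" using assms by (auto simp: less_eq_div_iff_mult_less_eq div_less_iff_less_mult)
    then show "(j mod n, j div n) \<in> {..<n} \<times> {K..<M}" using assms by simp
  next
    fix p assume "p \<in> {..<n} \<times> {K..<M}"
    then obtain l k where p: "p = (l, k)" "l < n" "K \<le> k" "k < M" by auto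
    have "k * n + l < (k + 1) * n" using p(2) by simp
    also have "\<dots> \<le> M * n" using p(4) by (intro mult_right_mono) auto
    finally have "k * n + l < M * n" .
    moreover have "K * n \<le> k * n + l" using mult_le_mono1[OF p(3), of n] by linarith
    ultimately show "(case p of (l, k) \<Rightarrow> k * n + l) \<in> {K * n..<M * n}" using p by simp
  qed (use assms in auto)
  finally show ?thesis by simp
qed

text \<open>For fixed \<open>l\<close> the indices \<open>k * n + l\<close> can be replaced by
  \<open>k\<close>, by symmetry. Each coordinate is at most the norm of its block, and the block
  norm is at most the sum of its \<open>n\<close> coordinates; the triangle inequality over
  \<open>l\<close> costs a factor \<open>n\<close> in both directions.\<close>

lemma flatten_bounds:
  assumes n: "0 < n" and w: "\<And>k l. l < n \<Longrightarrow> w (k * n + l) = norm (z k l)"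
  shows "norm (\<Sum>j\<in>{K * n..<M * n}. w j *\<^sub>R e j) \<le> n * norm (\<Sum>k\<in>{K..<M}. blk n (z k) *\<^sub>R e k)"
    and "norm (\<Sum>k\<in>{K..<M}. blk n (z k) *\<^sub>R e k) \<le> n * norm (\<Sum>j\<in>{K * n..<M * n}. w j *\<^sub>R e j)"
proof -
  have shift: "norm (\<Sum>k\<in>{K..<M}. norm (z k l) *\<^sub>R e (k * n + l)) = norm (\<Sum>k\<in>{K..<M}. norm (z k l) *\<^sub>R e k)" for l
    using n by (intro norm_sum_inj) (auto simp: inj_on_def)
  have sum: "(\<Sum>j\<in>{K * n..<M * n}. w j *\<^sub>R e j) = (\<Sum>l<n. \<Sum>k\<in>{K..<M}. norm (z k l) *\<^sub>R e (k * n + l))"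
    unfolding sum_blocks[OF n] by (simp add: w)
  have "norm (\<Sum>j\<in>{K * n..<M * n}. w j *\<^sub>R e j) \<le> (\<Sum>l<n. norm (\<Sum>k\<in>{K..<M}. norm (z k l) *\<^sub>R e (k * n + l)))"
    unfolding sum by (rule norm_sum)
  also have "\<dots> \<le> (\<Sum>l<n. norm (\<Sum>k\<in>{K..<M}. blk n (z k) *\<^sub>R e k))"
    unfolding shift
  proof (intro sum_mono norm_sum_mono)
    fix l k assume "l \<in> {..<n}"
    then show "\<bar>norm (z k l)\<bar> \<le> \<bar>blk n (z k)\<bar>"
      using member_le_L2_set[of "{..<n}" l "\<lambda>l. norm (z k l)"] by (simp add: L2_set_nonneg)
  qed auto
  finally show "norm (\<Sum>j\<in>{K * n..<M * n}. w j *\<^sub>R e j) \<le> n * norm (\<Sum>k\<in>{K..<M}. blk n (z k) *\<^sub>R e k)" by simp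
  have "norm (\<Sum>k\<in>{K..<M}. blk n (z k) *\<^sub>R e k) \<le> norm (\<Sum>k\<in>{K..<M}. (\<Sum>l<n. norm (z k l)) *\<^sub>R e k)"
    by (intro norm_sum_mono) (auto simp: L2_set_nonneg sum_nonneg L2_set_le_sum)
  also have "(\<Sum>k\<in>{K..<M}. (\<Sum>l<n. norm (z k l)) *\<^sub>R e k) = (\<Sum>l<n. \<Sum>k\<in>{K..<M}. norm (z k l) *\<^sub>R e k)"
    unfolding scaleR_sum_left by (rule sum.swap)
  also have "norm \<dots> \<le> (\<Sum>l<n. norm (\<Sum>k\<in>{K..<M}. norm (z k l) *\<^sub>R e k))" by (rule norm_sum)
  also have "\<dots> \<le> (\<Sum>l<n. norm (\<Sum>j\<in>{K * n..<M * n}. w j *\<^sub>R e j))"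
  proof (rule sum_mono)
    fix l assume l: "l \<in> {..<n}"
    let ?A = "(\<lambda>k. k * n + l) ` {K..<M}"
    have "(\<Sum>k\<in>{K..<M}. norm (z k l) *\<^sub>R e (k * n + l)) = (\<Sum>j\<in>?A. w j *\<^sub>R e j)"
      using n l by (subst sum.reindex) (auto simp: inj_on_def w)
    moreover have "?A \<subseteq> {K * n..<M * n}"
    proof
      fix j assume "j \<in> ?A"
      then obtain k where "j = k * n + l" "k \<in> {K..<M}" by blast
      then have k: "j = k * n + l" "K \<le> k" "k < M" by simp_all
      have "k * n + l < (k + 1) * n" using l by simp
      also have "\<dots> \<le> M * n" using k(3) by (intro mult_right_mono) auto
      finally have "k * n + l < M * n" .
      moreover have "K * n \<le> k * n + l" using mult_le_mono1[OF k(2), of n] by linarith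
      ultimately show "j \<in> {K * n..<M * n}" by (simp only: k(1) atLeastLessThan_iff)
    qed
    then have "norm (\<Sum>j\<in>?A. w j *\<^sub>R e j) \<le> norm (\<Sum>j\<in>{K * n..<M * n}. w j *\<^sub>R e j)"
      by (intro norm_sum_mono) auto
    ultimately show "norm (\<Sum>k\<in>{K..<M}. norm (z k l) *\<^sub>R e k) \<le> norm (\<Sum>j\<in>{K * n..<M * n}. w j *\<^sub>R e j)"
      using shift[of l] by simp
  qed
  finally show "norm (\<Sum>k\<in>{K..<M}. blk n (z k) *\<^sub>R e k) \<le> n * norm (\<Sum>j\<in>{K * n..<M * n}. w j *\<^sub>R e j)" by simp
qed

text \<open>The bounds hold for arbitrary stretches of blocks, so the Cauchy criterion passes in
  both directions.\<close>

lemma flatten_summable_iff: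
  assumes n: "0 < n" and w: "\<And>k l. l < n \<Longrightarrow> w (k * n + l) = norm (z k l)"
  shows "summable (\<lambda>j. w j *\<^sub>R e j) \<longleftrightarrow> summable (\<lambda>k. blk n (z k) *\<^sub>R e k)"
proof
  assume "summable (\<lambda>j. w j *\<^sub>R e j)"
  note C = this[unfolded summable_Cauchy, rule_format]
  show "summable (\<lambda>k. blk n (z k) *\<^sub>R e k)"
    unfolding summable_Cauchy
  proof (intro allI impI)
    fix \<epsilon> :: real assume "\<epsilon> > 0"
    then have "\<epsilon> / n > 0" using n by simp
    then obtain N0 where N0: "\<And>p q. p \<ge> N0 \<Longrightarrow> norm (\<Sum>j\<in>{p..<q}. w j *\<^sub>R e j) < \<epsilon> / n" using C by metis
    have "norm (\<Sum>k\<in>{p..<q}. blk n (z k) *\<^sub>R e k) < \<epsilon>" if p: "p \<ge> N0" for p q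
    proof -
      have "p \<le> p * n" using n by (cases n) auto
      with p have "N0 \<le> p * n" by (rule order_trans)
      then have "norm (\<Sum>j\<in>{p * n..<q * n}. w j *\<^sub>R e j) < \<epsilon> / n" by (rule N0)
      then have "n * norm (\<Sum>j\<in>{p * n..<q * n}. w j *\<^sub>R e j) < \<epsilon>" using n by (simp add: pos_less_divide_eq mult.commute)
      then show ?thesis using flatten_bounds(2)[of n w z, OF n w, of p q] by linarith
    qed
    then show "\<exists>N. \<forall>m\<ge>N. \<forall>q. norm (\<Sum>k\<in>{m..<q}. blk n (z k) *\<^sub>R e k) < \<epsilon>" by blast
  qed
next
  assume "summable (\<lambda>k. blk n (z k) *\<^sub>R e k)"
  note C = this[unfolded summable_Cauchy, rule_format]
  show "summable (\<lambda>j. w j *\<^sub>R e j)"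
    unfolding summable_Cauchy
  proof (intro allI impI)
    fix \<epsilon> :: real assume "\<epsilon> > 0"
    then have "\<epsilon> / n > 0" using n by simp
    then obtain N0 where N0: "\<And>p q. p \<ge> N0 \<Longrightarrow> norm (\<Sum>k\<in>{p..<q}. blk n (z k) *\<^sub>R e k) < \<epsilon> / n" using C by metis
    have "norm (\<Sum>j\<in>{p..<q}. w j *\<^sub>R e j) < \<epsilon>" if p: "p \<ge> N0 * n" for p q
    proof -
      \<comment> \<open>A stretch whose ends are not multiples of \<open>n\<close> is enlarged to
        one made of whole blocks, which does not decrease the norm.\<close>
      have "q \<le> q * n" using n by (cases n) auto
      then have "norm (\<Sum>j\<in>{p..<q}. w j *\<^sub>R e j) \<le> norm (\<Sum>j\<in>{N0 * n..<q * n}. w j *\<^sub>R e j)"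
        using p by (intro norm_sum_mono) auto
      also have "\<dots> \<le> n * norm (\<Sum>k\<in>{N0..<q}. blk n (z k) *\<^sub>R e k)"
        using flatten_bounds(1)[of n w z, OF n w] by simp
      also have "\<dots> < \<epsilon>" using N0[of N0 q] n by (simp add: pos_less_divide_eq mult.commute)
      finally show ?thesis .
    qed
    then show "\<exists>N. \<forall>m\<ge>N. \<forall>q. norm (\<Sum>j\<in>{m..<q}. w j *\<^sub>R e j) < \<epsilon>" by blast
  qed
qed

lemma flatten_norm_bounds:
  assumes n: "0 < n" and w: "\<And>k l. l < n \<Longrightarrow> w (k * n + l) = norm (z k l)"
    and s: "summable (\<lambda>j. w j *\<^sub>R e j)" "summable (\<lambda>k. blk n (z k) *\<^sub>R e k)"
  shows "norm (\<Sum>j. w j *\<^sub>R e j) \<le> n * norm (\<Sum>k. blk n (z k) *\<^sub>R e k)"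
    and "norm (\<Sum>k. blk n (z k) *\<^sub>R e k) \<le> n * norm (\<Sum>j. w j *\<^sub>R e j)"
proof -
  show "norm (\<Sum>j. w j *\<^sub>R e j) \<le> n * norm (\<Sum>k. blk n (z k) *\<^sub>R e k)"
  proof (rule LIMSEQ_le_const2[OF norm_partial_sums_tendsto[OF s(1)]], intro exI allI impI)
    fix J
    have "J \<le> J * n" using n by (cases n) auto
    then have "i \<in> {0 * n..<J * n}" if "i < J" for i using that by (simp only: atLeastLessThan_iff) linarith
    then have "norm (\<Sum>j<J. w j *\<^sub>R e j) \<le> norm (\<Sum>j\<in>{0 * n..<J * n}. w j *\<^sub>R e j)"
      by (intro norm_sum_mono) blast+
    also have "\<dots> \<le> n * norm (\<Sum>k\<in>{0..<J}. blk n (z k) *\<^sub>R e k)" by (rule flatten_bounds(1)[of n w z, OF n w])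
    also have "\<dots> \<le> n * norm (\<Sum>k. blk n (z k) *\<^sub>R e k)"
      by (intro mult_left_mono norm_sum_le_suminf s) auto
    finally show "norm (\<Sum>j<J. w j *\<^sub>R e j) \<le> n * norm (\<Sum>k. blk n (z k) *\<^sub>R e k)" .
  qed
  show "norm (\<Sum>k. blk n (z k) *\<^sub>R e k) \<le> n * norm (\<Sum>j. w j *\<^sub>R e j)"
  proof (rule LIMSEQ_le_const2[OF norm_partial_sums_tendsto[OF s(2)]], intro exI allI impI)
    fix J
    have "norm (\<Sum>k\<in>{0..<J}. blk n (z k) *\<^sub>R e k) \<le> n * norm (\<Sum>j\<in>{0 * n..<J * n}. w j *\<^sub>R e j)"
      by (rule flatten_bounds(2)[of n w z, OF n w])
    also have "\<dots> \<le> n * norm (\<Sum>j. w j *\<^sub>R e j)"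
      by (intro mult_left_mono norm_sum_le_suminf s) auto
    finally show "norm (\<Sum>k<J. blk n (z k) *\<^sub>R e k) \<le> n * norm (\<Sum>j. w j *\<^sub>R e j)" by (simp add: atLeast0LessThan)
  qed
qed

text \<open>Coordinate \<open>l\<close> of block \<open>k\<close> becomes the coefficient of the
  basis vector with index \<open>k * n + l\<close>. The factor \<open>n\<close> from the regrouping
  bounds gives the constants \<open>1 / n\<close> and \<open>n\<close>.\<close>

lemma isomorphic_W:
  assumes n: "0 < n"
  shows "isomorphic (W n) (whole_space smul)"
proof -
  define u where "u z j = z (j div n) (j mod n)" for z :: "nat \<Rightarrow> nat \<Rightarrow> 'k" and j
  define T where "T z = (\<Sum>j. smul (u z j) (e j))" for z
  have w: "norm (u z (k * n + l)) = norm (z k l)" if "l < n" for z k l using that by (simp add: u_def)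
  have si: "summable (\<lambda>j. smul (u z j) (e j)) \<longleftrightarrow> summable (\<lambda>k. blk n (z k) *\<^sub>R e k)" for z
    unfolding summable_smul_iff by (rule flatten_summable_iff[of n "\<lambda>j. norm (u z j)" z, OF n w])
  have s: "summable (\<lambda>j. smul (u z j) (e j))" if "z \<in> carr (W n)" for z using that si by (simp add: carr_W)
  have Tn: "norm (T z) \<le> n * nrm (W n) z" "nrm (W n) z \<le> n * norm (T z)" if z: "z \<in> carr (W n)" for z
  proof -
    have "norm (T z) = norm (\<Sum>j. norm (u z j) *\<^sub>R e j)" unfolding T_def by (rule norm_suminf_smul[OF s[OF z]])
    then show "norm (T z) \<le> n * nrm (W n) z" "nrm (W n) z \<le> n * norm (T z)"
      using flatten_norm_bounds[of n "\<lambda>j. norm (u z j)" z, OF n w] s[OF z] z by (auto simp: summable_smul_iff carr_W nrm_W)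
  qed
  have add: "T (x + y) = T x + T y" if "x \<in> carr (W n)" "y \<in> carr (W n)" for x y
    using suminf_add[OF s[OF that(1)] s[OF that(2)]] by (simp add: T_def u_def scale_left_distrib)
  have sc: "T (scal (W n) c x) = smul c (T x)" if "x \<in> carr (W n)" for c x
    using bounded_linear.suminf[OF bounded_linear_smul s[OF that], of c] by (simp add: T_def u_def scal_W scale_scale)
  have lin: "linear_map (W n) (whole_space smul) T"
    using add sc by (simp add: linear_map_def whole_space_def)
  have "inj_on T (carr (W n))"
  proof (rule inj_onI)
    fix x y assume xy: "x \<in> carr (W n)" "y \<in> carr (W n)" "T x = T y"
    have d: "x - y \<in> carr (W n)" by (rule linear_space_diff[OF linear_space_W xy(1,2)])
    have "T (x - y) = 0" using linear_map_diff[OF linear_space_W lin xy(1,2)] xy(3) by simp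
    then have "nrm (W n) (x - y) = 0" using Tn(2)[OF d] nrm_nonneg[OF normed_space_W d] by simp
    then show "x = y" using nrm_eq_zero[OF normed_space_W d] by simp
  qed
  moreover have "\<exists>z\<in>carr (W n). T z = x" for x
  proof -
    define z where "z k l = (if l < n then coef x (k * n + l) else 0)" for k l
    have u: "u z = coef x" using n by (auto simp: u_def z_def fun_eq_iff)
    have "summable (\<lambda>j. smul (u z j) (e j))" unfolding u using coef_sums sums_summable by blast
    then have "z \<in> carr (W n)" using si by (auto simp: carr_W z_def)
    moreover have "T z = x" unfolding T_def u using coef_sums[of x] by (simp add: sums_iff)
    ultimately show ?thesis by blast
  qed
  then have "T ` carr (W n) = UNIV" by (metis UNIV_eq_I imageI)
  ultimately have "bij_betw T (carr (W n)) (carr (whole_space smul))"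
    by (simp add: bij_betw_def whole_space_def)
  moreover have "\<forall>z\<in>carr (W n). 1 / n * nrm (W n) z \<le> nrm (whole_space smul) (T z) \<and> nrm (whole_space smul) (T z) \<le> n * nrm (W n) z"
    using Tn n by (auto simp: whole_space_def field_simps)
  moreover have "1 / real n > 0" "real n > 0" using n by auto
  ultimately have "isomorphism (W n) (whole_space smul) T" using lin unfolding isomorphism_def by blast
  then show ?thesis unfolding isomorphic_def by blast
qed

end

section \<open>Conjugacy\<close>

context symmetric_basis
begin

text \<open>With \<open>N z\<close> the norm of \<open>R z\<close>, the map \<open>R\<close> is an
  isometry from an admissible renorming of \<open>W n\<close> onto \<open>W m\<close>. The dimension
  bound applied to \<open>R\<close> and to its inverse gives both inequalities.\<close>

lemma dimension_eq_if_isometries_carried: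
  assumes nh: "\<not> hilbertian (whole_space smul)" and n2: "n \<ge> 2" and m2: "m \<ge> 2"
    and R: "isomorphism (W n) (W m) R"
    and inv: "\<And>g z. surjective_isometry (W n) (W n) g \<Longrightarrow> z \<in> carr (W n) \<Longrightarrow> nrm (W m) (R (g z)) = nrm (W m) (R z)"
  shows "n = m"
proof -
  define N where "N z = nrm (W m) (R z)" for z
  let ?S = "inv_into (carr (W n)) R"
  have l: "linear_map (W n) (W m) R" and b: "bij_betw R (carr (W n)) (carr (W m))" using R by (auto simp: isomorphism_def)
  have Rc: "R x \<in> carr (W m)" if "x \<in> carr (W n)" for x by (rule linear_map_carr[OF l that])
  have ST: "?S (R x) = x" if "x \<in> carr (W n)" for x using b that by (simp add: bij_betw_def)
  have TS: "R (?S y) = y" if "y \<in> carr (W m)" for y using b that by (simp add: bij_betw_def f_inv_into_f)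
  have "R x = 0 \<longleftrightarrow> x = 0" if "x \<in> carr (W n)" for x
    using ST[OF that] ST[OF linear_space_zero[OF linear_space_W]] linear_map_zero[OF linear_space_W l] by metis
  then have "norm_on (W n) N"
    unfolding norm_on_def N_def
    using nrm_nonneg[OF normed_space_W Rc] nrm_eq_zero[OF normed_space_W Rc] nrm_scal[OF normed_space_W Rc] nrm_add[OF normed_space_W Rc Rc]
    by (simp add: linear_map_add[OF l] linear_map_scal[OF l])
  moreover have "\<exists>a>0. \<exists>b>0. \<forall>x\<in>carr (W n). a * nrm (W n) x \<le> N x \<and> N x \<le> b * nrm (W n) x"
    using R by (simp add: isomorphism_def N_def)
  ultimately have N: "admissible n N" using inv by (simp add: admissible_def equivalent_norm_def N_def)
  note M = admissible_nrm[of m]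
  have T: "surjective_isometry (WN n N) (WN m (nrm (W m))) R"
    using l b by (simp add: surjective_isometry_def linear_map_def N_def bij_betw_def)
  have S: "surjective_isometry (WN m (nrm (W m))) (WN n N) ?S"
    using surjective_isometry_inv[OF admissible_normed_space[OF N] admissible_normed_space[OF M] T] by simp
  have "n \<le> m" by (rule isometry_block_dimension_le[OF nh N M T S ST TS n2])
  moreover have "m \<le> n" by (rule isometry_block_dimension_le[OF nh M N S T TS ST m2])
  ultimately show ?thesis by simp
qed

text \<open>Conjugacy means that each isometry \<open>g\<close> of the one sum satisfies
  \<open>U\<inverse> g U = T\<inverse> V\<inverse> g' V T\<close> for some isometry
  \<open>g'\<close> of the other. With \<open>R = V T U\<inverse>\<close> this reads
  \<open>R g = g' R\<close>, so the norm of \<open>R z\<close> is invariant under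
  \<open>g\<close>.\<close>

lemma dimension_eq_if_conjugate:
  fixes H :: "nat \<Rightarrow> ('k, 'h::ab_group_add) nspace" and H' :: "nat \<Rightarrow> ('k, 'g::ab_group_add) nspace"
  assumes nh: "\<not> hilbertian (whole_space smul)" and n2: "n \<ge> 2" and m2: "m \<ge> 2"
    and H: "\<And>k. normed_space (H k)" "\<And>k. surjective_isometry (H k) (ell2 n) (\<tau> k)"
    and H': "\<And>k. normed_space (H' k)" "\<And>k. surjective_isometry (H' k) (ell2 m) (\<tau>' k)"
    and U: "isomorphism (whole_space smul) (hilbert_sum e H) U"
    and V: "isomorphism (whole_space smul) (hilbert_sum e H') V"
    and conj: "conjugate_in_GL (whole_space smul)
           (pull_back (whole_space smul) U (Isom (hilbert_sum e H)))
           (pull_back (whole_space smul) V (Isom (hilbert_sum e H')))"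
  shows "n = m"
proof -
  let ?X = "whole_space smul" and ?Z = "hilbert_sum e H" and ?Z' = "hilbert_sum e H'"
  have X: "linear_space ?X" by (rule linear_space_whole) (simp_all add: whole_space_def)
  have cX: "carr ?X = UNIV" by (simp add: whole_space_def)
  have Z: "normed_space ?Z" and Z': "normed_space ?Z'" using H H' normed_space_hilbert_sum by blast+
  note LZ = normed_space_linear[OF Z] and LZ' = normed_space_linear[OF Z']
  obtain T where T: "T \<in> GL ?X"
    and eq: "pull_back ?X U (Isom ?Z) = pull_back ?X T (pull_back ?X V (Isom ?Z'))"
    using conj unfolding conjugate_in_GL_def by blast
  have Ti: "isomorphism ?X ?X T" using T by (simp add: GL_def)
  let ?U = "inv_into UNIV U" and ?V = "inv_into UNIV V" and ?T = "inv_into UNIV T"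
  have bU: "bij_betw U UNIV (carr ?Z)" and bV: "bij_betw V UNIV (carr ?Z')" and bT: "bij T"
    using U V Ti by (auto simp: isomorphism_def cX)
  define R where "R = V \<circ> (T \<circ> ?U)"
  have R: "isomorphism ?Z ?Z' R"
    unfolding R_def using isomorphism_inv[OF X LZ U]
    by (intro isomorphism_compose[OF isomorphism_compose[OF _ Ti] V]) (simp add: cX)
  have carried: "nrm ?Z' (R (g z)) = nrm ?Z' (R z)" if g: "g \<in> Isom ?Z" and z: "z \<in> carr ?Z" for g z
  proof -
    have "restrict (\<lambda>x. ?U (g (U x))) UNIV \<in> pull_back ?X U (Isom ?Z)"
      using g by (simp add: pull_back_def cX)
    then obtain g' where g': "g' \<in> Isom ?Z'" and *: "\<And>x. ?U (g (U x)) = ?T (?V (g' (V (T x))))"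
      unfolding eq by (auto simp: pull_back_def cX fun_eq_iff)
    have w: "R z \<in> carr ?Z'" using R z by (auto simp: isomorphism_def linear_map_def)
    have gw: "g' (R z) \<in> carr ?Z'" using g' w by (auto simp: Isom_def surjective_isometry_def linear_map_def)
    have "U (?U z) = z" using bU z by (simp add: bij_betw_def f_inv_into_f)
    then have "?U (g z) = ?T (?V (g' (R z)))" using *[of "?U z"] by (simp add: R_def)
    then have "R (g z) = V (T (?T (?V (g' (R z)))))" by (simp add: R_def)
    also have "\<dots> = g' (R z)"
      using bT bV gw by (simp add: bij_betw_def f_inv_into_f surj_f_inv_f)
    finally show ?thesis using g' w by (simp add: Isom_def surjective_isometry_def)
  qed
  \<comment> \<open>The maps \<open>\<Theta>\<close> and \<open>\<Theta>'\<close> identify both sums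
    with their models, where the comparison of dimensions is available.\<close>
  define \<Theta> where "\<Theta> = (\<lambda>z k. \<tau> k (z k))"
  define \<Theta>' where "\<Theta>' = (\<lambda>z k. \<tau>' k (z k))"
  have \<Theta>: "surjective_isometry ?Z (W n) \<Theta>" unfolding \<Theta>_def by (rule surjective_isometry_hilbert_sum[OF H(2)])
  have \<Theta>': "surjective_isometry ?Z' (W m) \<Theta>'" unfolding \<Theta>'_def by (rule surjective_isometry_hilbert_sum[OF H'(2)])
  let ?\<Phi> = "inv_into (carr ?Z) \<Theta>"
  have \<Phi>: "surjective_isometry (W n) ?Z ?\<Phi>" by (rule surjective_isometry_inv[OF Z normed_space_W \<Theta>])
  have b: "bij_betw \<Theta> (carr ?Z) (carr (W n))" by (rule surjective_isometry_bij[OF Z normed_space_W \<Theta>])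
  have \<Theta>n: "nrm (W m) (\<Theta>' w) = nrm ?Z' w" if "w \<in> carr ?Z'" for w using \<Theta>' that by (simp add: surjective_isometry_def)
  have \<Phi>c: "?\<Phi> w \<in> carr ?Z" if "w \<in> carr (W n)" for w using \<Phi> that by (auto simp: surjective_isometry_def linear_map_def)
  have Rc: "R z \<in> carr ?Z'" if "z \<in> carr ?Z" for z using R that by (auto simp: isomorphism_def linear_map_def)
  show ?thesis
  proof (rule dimension_eq_if_isometries_carried[OF nh n2 m2])
    show "isomorphism (W n) (W m) (\<Theta>' \<circ> (R \<circ> ?\<Phi>))"
      using isomorphism_of_isometry[OF normed_space_W Z \<Phi>] isomorphism_of_isometry[OF Z' normed_space_W \<Theta>'] R
      by (intro isomorphism_compose)
  next
    fix g w assume g: "surjective_isometry (W n) (W n) g" and w: "w \<in> carr (W n)"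
    let ?g = "?\<Phi> \<circ> (g \<circ> \<Theta>)"
    have gw: "g w \<in> carr (W n)" using g w by (auto simp: surjective_isometry_def linear_map_def)
    have "surjective_isometry ?Z ?Z ?g"
      by (intro surjective_isometry_compose[OF surjective_isometry_compose[OF \<Theta> g] \<Phi>])
    then have "nrm ?Z' (R (restrict ?g (carr ?Z) (?\<Phi> w))) = nrm ?Z' (R (?\<Phi> w))"
      by (intro carried restrict_in_Isom LZ \<Phi>c w)
    moreover have "restrict ?g (carr ?Z) (?\<Phi> w) = ?\<Phi> (g w)"
      using \<Phi>c[OF w] b w by (simp add: bij_betw_def f_inv_into_f)
    ultimately show "nrm (W m) ((\<Theta>' \<circ> (R \<circ> ?\<Phi>)) (g w)) = nrm (W m) ((\<Theta>' \<circ> (R \<circ> ?\<Phi>)) w)"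
      using \<Theta>n[OF Rc[OF \<Phi>c[OF gw]]] \<Theta>n[OF Rc[OF \<Phi>c[OF w]]] by simp
  qed
qed

end

theorem theorem3p5:
  fixes smul :: "'k::real_or_complex \<Rightarrow> 'x::banach \<Rightarrow> 'x"
    and e :: "nat \<Rightarrow> 'x"
    and n :: nat
    and H :: "nat \<Rightarrow> ('k, 'h::ab_group_add) nspace"
  assumes "banach_space_over smul"
    and "one_symmetric_basis smul e"
    and "\<not> hilbertian (whole_space smul)"
    and "pure smul e"
    and "n \<ge> 2"
    and "\<And>k. normed_space (H k) \<and> isometric_spaces (H k) (ell2 n)"
  shows "isomorphic (hilbert_sum e H) (whole_space smul) \<and>
    maximal_isometry_group (hilbert_sum e H) \<and>
    (\<forall>m (H' :: nat \<Rightarrow> ('k, 'g::ab_group_add) nspace) U V.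
       m \<ge> 2 \<and> n \<noteq> m \<and>
       (\<forall>k. normed_space (H' k) \<and> isometric_spaces (H' k) (ell2 m)) \<and>
       isomorphism (whole_space smul) (hilbert_sum e H) U \<and>
       isomorphism (whole_space smul) (hilbert_sum e H') V \<longrightarrow>
       \<not> conjugate_in_GL (whole_space smul)
           (pull_back (whole_space smul) U (Isom (hilbert_sum e H)))
           (pull_back (whole_space smul) V (Isom (hilbert_sum e H'))))"
proof -
  interpret symmetric_basis smul e
    using assms(1,2) by (simp add: symmetric_basis_def symmetric_basis_axioms_def)
  have H: "\<And>k. normed_space (H k)" using assms(6) by blast
  obtain \<tau> where \<tau>: "\<And>k. surjective_isometry (H k) (ell2 n) (\<tau> k)"
    using assms(6) unfolding isometric_spaces_def by metis
  have Z: "normed_space (hilbert_sum e H)" by (rule normed_space_hilbert_sum[OF H])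
  have \<Theta>: "surjective_isometry (hilbert_sum e H) (W n) (\<lambda>z k. \<tau> k (z k))"
    by (rule surjective_isometry_hilbert_sum[OF \<tau>])
  obtain F where "isomorphism (W n) (whole_space smul) F"
    using isomorphic_W[of n] assms(5) unfolding isomorphic_def by auto
  then have "isomorphic (hilbert_sum e H) (whole_space smul)"
    using isomorphism_compose[OF isomorphism_of_isometry[OF Z normed_space_W \<Theta>]] unfolding isomorphic_def by blast
  moreover have "maximal_isometry_group (hilbert_sum e H)"
    by (rule maximal_isometry_group_transfer[OF Z normed_space_W \<Theta> maximal_isometry_group_W[OF assms(3,5)]])
  moreover have "\<not> conjugate_in_GL (whole_space smul)
           (pull_back (whole_space smul) U (Isom (hilbert_sum e H)))
           (pull_back (whole_space smul) V (Isom (hilbert_sum e H')))"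
    if m: "m \<ge> 2" "n \<noteq> m" and H': "\<forall>k. normed_space (H' k) \<and> isometric_spaces (H' k) (ell2 m)"
      and U: "isomorphism (whole_space smul) (hilbert_sum e H) U"
      and V: "isomorphism (whole_space smul) (hilbert_sum e H') V"
    for m and H' :: "nat \<Rightarrow> ('k, 'g) nspace" and U V
  proof
    assume conj: "conjugate_in_GL (whole_space smul)
           (pull_back (whole_space smul) U (Isom (hilbert_sum e H)))
           (pull_back (whole_space smul) V (Isom (hilbert_sum e H')))"
    have N': "\<And>k. normed_space (H' k)" using H' by blast
    obtain \<tau>' where \<tau>': "\<And>k. surjective_isometry (H' k) (ell2 m) (\<tau>' k)"
      using H' unfolding isometric_spaces_def by metis
    show False
      using dimension_eq_if_conjugate[OF assms(3,5) m(1) H \<tau> N' \<tau>' U V conj] m(2) by simp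
  qed
  ultimately show ?thesis by blast
qed

end
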